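(* Consider the continuous-time channel $Y_t=g(X_t,Z_t)$ with feedback delay described in the context. For every $\Delta>0$, $$C(\Delta)\le C^I(\Delta),$$ and $$C(\Delta)\ge C^I(\Delta')\quad\text{for all }\Delta'>\Delta.$$
   Context: **Channel.** The input alphabet $\mathcal{X}$ and output alphabet $\mathcal{Y}$ are not necessarily finite. The output at time $t$ is $Y_t=g(X_t,Z_t)$, where $\{Z_t\}_{t\ge0}$ is a stationary, block-ergodic noise process with values in $\mathcal{Z}$, and $g:\mathcal{X}\times\mathcal{Z}\to\mathcal{Y}$ is measurable. A process is block-ergodic if for every $\tau>0$ the discrete-time process of blocks $(Z_0^\tau,Z_\tau^{2\tau},Z_{2\tau}^{3\tau},\ldots)$ is ergodic. Notation: $X_a^b=\{X_s:a\le s<b\}$. **Codes.** A $(2^{TR},T)$ code with feedback delay $\Delta>0$ consists of: - a message set $\{1,\ldots,2^{\lfloor TR\rfloor}\}$; - measurable encoding maps $x_t(m,y_0^{t-\Delta})\in\mathcal{X}$ for $t\in[0,T)$ (depending only on $m$ when $t<\Delta$); - a measurable decoder $\hat m(y_0^T)$. The message $M$ is uniform and independent of the noise. **Operational capacity.** A rate $R$ is achievable with feedback delay $\Delta$ if for each $T$ there is a $(2^{RT},T)$ code such that $P\{M\ne\hat M(Y_0^T)\}\to0$ as $T\to\infty$. $C(\Delta)$ is the supremum of achievable rates with feedback delay $\Delta$. **Information capacity.** $$C^I(\Delta)=\lim_{T\to\infty}\frac1T\sup_{\mathcal{S}_\Delta(T)}I(X_0^T\to Y_0^T),$$ where this limit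 exists. Here $\mathcal{S}_\Delta(T)$ is the set of input processes on $[0,T)$ of the form $$X_t=\begin{cases}g_t(U_t,Y_0^{t-\Delta}) & t\ge\Delta,\\ g_t(U_t) & t<\Delta,\end{cases}$$ for measurable $\{g_t\}$ and some process $U_0^T$ independent of $Z_0^T$ with finite cardinality (possibly depending on $T$). **Directed information.** For random objects, $I(U;V\mid W)=\sup I([U];[V]\mid W)$ over finite quantizations of $U,V$. The continuous-time directed information is $$I(X_0^T\to Y_0^T)=\inf_{\mathbf{t}}\sum_{i=1}^n I\big(Y_{t_{i-1}}^{t_i};X_0^{t_i}\,\big|\,Y_0^{t_{i-1}}\big),$$ where the infimum is over all finite partitions $0=t_0<\cdots<t_n=T$ and $Y_0^0$ is trivial. *)

theory Defs
  imports "HOL-Probability.Probability"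
begin

text \<open>Time is real. A path segment on [a,b) of a process with values in a measurable
  space S is an element of PiM {a..<b} (\<lambda>_. S) (extensional functions).
  The noise process is modelled through its law mu on the path space
  PiM {0..} (\<lambda>_. SZ).\<close>

definition shift_path :: "real \<Rightarrow> (real \<Rightarrow> 'z) \<Rightarrow> (real \<Rightarrow> 'z)" where
  "shift_path s w = (\<lambda>t\<in>{0..}. w (t + s))"

definition stationary_noise :: "'z measure \<Rightarrow> (real \<Rightarrow> 'z) measure \<Rightarrow> bool" where
  "stationary_noise SZ mu \<longleftrightarrow>
     prob_space mu \<and> sets mu = sets (PiM {0..} (\<lambda>_. SZ)) \<and>
     (\<forall>s\<ge>0. distr mu (PiM {0..} (\<lambda>_. SZ)) (shift_path s) = mu)"

text \<open>Block-ergodicity: for every tau > 0 the block process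
  (Z_0^tau, Z_tau^{2tau}, ...) is ergodic, i.e. every event of the noise path that is
  invariant under the shift by one block (shift by tau) has probability 0 or 1.\<close>
definition block_ergodic :: "'z measure \<Rightarrow> (real \<Rightarrow> 'z) measure \<Rightarrow> bool" where
  "block_ergodic SZ mu \<longleftrightarrow>
     (\<forall>\<tau>>0. \<forall>A\<in>sets mu. shift_path \<tau> -` A \<inter> space mu = A \<longrightarrow>
        measure mu A = 0 \<or> measure mu A = 1)"

text \<open>Given an input strategy f (f t a y' is the input at time t given the randomness a
  (message, or the auxiliary process U) and the past output y' = y_0^{t-Delta}),
  and a noise path z, the output path on [0,T) is the unique extensional function y with
  y t = g (f t a (y restricted to [0,t-Delta))) (z t) for all t in [0,T).
  (Unique existence holds because Delta > 0: induction over blocks of length Delta.)\<close>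
definition out_path ::
  "('x \<Rightarrow> 'z \<Rightarrow> 'y) \<Rightarrow> real \<Rightarrow> real \<Rightarrow> (real \<Rightarrow> 'a \<Rightarrow> (real \<Rightarrow> 'y) \<Rightarrow> 'x) \<Rightarrow> 'a
     \<Rightarrow> (real \<Rightarrow> 'z) \<Rightarrow> (real \<Rightarrow> 'y)" where
  "out_path g \<Delta> T f a z = (THE y. y \<in> extensional {0..<T} \<and>
      (\<forall>t\<in>{0..<T}. y t = g (f t a (restrict y {0..<t - \<Delta>})) (z t)))"

definition in_path ::
  "('x \<Rightarrow> 'z \<Rightarrow> 'y) \<Rightarrow> real \<Rightarrow> real \<Rightarrow> (real \<Rightarrow> 'a \<Rightarrow> (real \<Rightarrow> 'y) \<Rightarrow> 'x) \<Rightarrow> 'a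
     \<Rightarrow> (real \<Rightarrow> 'z) \<Rightarrow> (real \<Rightarrow> 'x)" where
  "in_path g \<Delta> T f a z =
     (\<lambda>t\<in>{0..<T}. f t a (restrict (out_path g \<Delta> T f a z) {0..<t - \<Delta>}))"

definition num_msgs :: "real \<Rightarrow> real \<Rightarrow> nat" where
  "num_msgs T R = 2 ^ nat \<lfloor>T * R\<rfloor>"

text \<open>A (2^{TR},T) code with feedback delay Delta: messages {1..2^floor(TR)},
  measurable encoders x_t(m, y_0^{t-Delta}) (for t < Delta the feedback argument ranges
  over the one-point space PiM {} and so the encoder depends only on m),
  and a measurable decoder of y_0^T.\<close>
definition is_code ::
  "'x measure \<Rightarrow> 'y measure \<Rightarrow> real \<Rightarrow> real \<Rightarrow> real \<Rightarrow>
     (real \<Rightarrow> nat \<Rightarrow> (real \<Rightarrow> 'y) \<Rightarrow> 'x) \<Rightarrow> ((real \<Rightarrow> 'y) \<Rightarrow> nat) \<Rightarrow> bool" where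
  "is_code SX SY \<Delta> T R enc dec \<longleftrightarrow>
     (\<forall>t\<in>{0..<T}. (\<lambda>(m, y). enc t m y) \<in>
         measurable (count_space UNIV \<Otimes>\<^sub>M PiM {0..<t - \<Delta>} (\<lambda>_. SY)) SX) \<and>
     dec \<in> measurable (PiM {0..<T} (\<lambda>_. SY)) (count_space UNIV)"

definition err_prob ::
  "('x \<Rightarrow> 'z \<Rightarrow> 'y) \<Rightarrow> (real \<Rightarrow> 'z) measure \<Rightarrow> real \<Rightarrow> real \<Rightarrow> real \<Rightarrow>
     (real \<Rightarrow> nat \<Rightarrow> (real \<Rightarrow> 'y) \<Rightarrow> 'x) \<Rightarrow> ((real \<Rightarrow> 'y) \<Rightarrow> nat) \<Rightarrow> real" where
  "err_prob g mu \<Delta> T R enc dec =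
     (\<Sum>m\<in>{1..num_msgs T R}.
        measure mu {z \<in> space mu. dec (out_path g \<Delta> T enc m z) \<noteq> m}) / real (num_msgs T R)"

definition achievable ::
  "'x measure \<Rightarrow> 'y measure \<Rightarrow> ('x \<Rightarrow> 'z \<Rightarrow> 'y) \<Rightarrow> (real \<Rightarrow> 'z) measure \<Rightarrow>
     real \<Rightarrow> real \<Rightarrow> bool" where
  "achievable SX SY g mu \<Delta> R \<longleftrightarrow>
     (\<exists>enc dec. (\<forall>T>0. is_code SX SY \<Delta> T R (enc T) (dec T)) \<and>
        ((\<lambda>T. err_prob g mu \<Delta> T R (enc T) (dec T)) \<longlongrightarrow> 0) at_top)"

definition op_capacity ::
  "'x measure \<Rightarrow> 'y measure \<Rightarrow> ('x \<Rightarrow> 'z \<Rightarrow> 'y) \<Rightarrow> (real \<Rightarrow> 'z) measure \<Rightarrow> real \<Rightarrow> ereal" where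
  "op_capacity SX SY g mu \<Delta> = Sup (ereal ` {R. achievable SX SY g mu \<Delta> R})"

text \<open>I(U;V|W) = sup over finite quantizations [U],[V] of I([U];[V]|W) (in bits).
  A finite quantization is a measurable map into nat with finite range.
  For finite-valued [U], the library's conditional mutual information
  I([U];([V],W)) - I([U];W) is well defined.\<close>
definition cmi ::
  "'w measure \<Rightarrow> 'u measure \<Rightarrow> 'v measure \<Rightarrow> 'c measure \<Rightarrow>
     ('w \<Rightarrow> 'u) \<Rightarrow> ('w \<Rightarrow> 'v) \<Rightarrow> ('w \<Rightarrow> 'c) \<Rightarrow> ereal" where
  "cmi P SU SV SW U V W =
     (SUP qr \<in> {(q :: 'u \<Rightarrow> nat, r :: 'v \<Rightarrow> nat). q \<in> measurable SU (count_space UNIV) \<and> finite (q ` space SU) \<and>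
                       r \<in> measurable SV (count_space UNIV) \<and> finite (r ` space SV)}.
        ereal (prob_space.conditional_mutual_information P 2
                 (count_space UNIV) (count_space UNIV) SW
                 (fst qr \<circ> U) (snd qr \<circ> V) W))"

definition partitions :: "real \<Rightarrow> (nat \<times> (nat \<Rightarrow> real)) set" where
  "partitions T = {(n, t). n \<ge> 1 \<and> t 0 = 0 \<and> t n = T \<and> (\<forall>i<n. t i < t (Suc i))}"

definition directed_info ::
  "'w measure \<Rightarrow> 'x measure \<Rightarrow> 'y measure \<Rightarrow> ('w \<Rightarrow> real \<Rightarrow> 'x) \<Rightarrow> ('w \<Rightarrow> real \<Rightarrow> 'y)
     \<Rightarrow> real \<Rightarrow> ereal" where
  "directed_info P SX SY X Y T =
     (INF nt \<in> partitions T. (\<Sum>i\<in>{1..fst nt}.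
        let a = snd nt (i - 1); b = snd nt i in
        cmi P (PiM {a..<b} (\<lambda>_. SY)) (PiM {0..<b} (\<lambda>_. SX)) (PiM {0..<a} (\<lambda>_. SY))
          (\<lambda>\<omega>. restrict (Y \<omega>) {a..<b}) (\<lambda>\<omega>. restrict (X \<omega>) {0..<b})
          (\<lambda>\<omega>. restrict (Y \<omega>) {0..<a})))"

text \<open>The class S_Delta(T): the auxiliary process U_0^T is independent of the noise and
  has finite cardinality, i.e. its path takes finitely many values: it is given by a pmf
  p with finite support on paths u :: real => nat (any finite alphabet embeds into nat).
  X_t = g_t(U_t, Y_0^{t-Delta}) with g_t measurable (for t < Delta, Y_0^{t-Delta} is
  trivial). The underlying probability space is (law of U) x (law of the noise).\<close>
definition admissible_inputs ::
  "'x measure \<Rightarrow> 'y measure \<Rightarrow> real \<Rightarrow> real \<Rightarrow>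
     ((real \<Rightarrow> nat) pmf \<times> (real \<Rightarrow> nat \<Rightarrow> (real \<Rightarrow> 'y) \<Rightarrow> 'x)) set" where
  "admissible_inputs SX SY \<Delta> T = {(p, gs). finite (set_pmf p) \<and>
     (\<forall>t\<in>{0..<T}. (\<lambda>(k, y). gs t k y) \<in>
         measurable (count_space UNIV \<Otimes>\<^sub>M PiM {0..<t - \<Delta>} (\<lambda>_. SY)) SX)}"

definition aux_strategy ::
  "(real \<Rightarrow> nat \<Rightarrow> (real \<Rightarrow> 'y) \<Rightarrow> 'x) \<Rightarrow> real \<Rightarrow> (real \<Rightarrow> nat) \<Rightarrow> (real \<Rightarrow> 'y) \<Rightarrow> 'x" where
  "aux_strategy gs t u y = gs t (u t) y"

definition sup_directed_info ::
  "'x measure \<Rightarrow> 'y measure \<Rightarrow> ('x \<Rightarrow> 'z \<Rightarrow> 'y) \<Rightarrow> (real \<Rightarrow> 'z) measure \<Rightarrow>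
     real \<Rightarrow> real \<Rightarrow> ereal" where
  "sup_directed_info SX SY g mu \<Delta> T =
     (SUP pg \<in> admissible_inputs SX SY \<Delta> T.
        directed_info (measure_pmf (fst pg) \<Otimes>\<^sub>M mu) SX SY
          (\<lambda>\<omega>. in_path g \<Delta> T (aux_strategy (snd pg)) (fst \<omega>) (snd \<omega>))
          (\<lambda>\<omega>. out_path g \<Delta> T (aux_strategy (snd pg)) (fst \<omega>) (snd \<omega>)) T)"

definition info_rate ::
  "'x measure \<Rightarrow> 'y measure \<Rightarrow> ('x \<Rightarrow> 'z \<Rightarrow> 'y) \<Rightarrow> (real \<Rightarrow> 'z) measure \<Rightarrow>
     real \<Rightarrow> real \<Rightarrow> ereal" where
  "info_rate SX SY g mu \<Delta> T = ereal (1 / T) * sup_directed_info SX SY g mu \<Delta> T"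

text \<open>C^I(Delta) is the limit as T \<rightarrow> \<infinity> of info_rate (meaningful where it exists;
  existence is assumed where used).\<close>
definition info_capacity_exists ::
  "'x measure \<Rightarrow> 'y measure \<Rightarrow> ('x \<Rightarrow> 'z \<Rightarrow> 'y) \<Rightarrow> (real \<Rightarrow> 'z) measure \<Rightarrow> real \<Rightarrow> bool" where
  "info_capacity_exists SX SY g mu \<Delta> \<longleftrightarrow>
     (\<exists>L. (info_rate SX SY g mu \<Delta> \<longlongrightarrow> L) at_top)"

definition info_capacity ::
  "'x measure \<Rightarrow> 'y measure \<Rightarrow> ('x \<Rightarrow> 'z \<Rightarrow> 'y) \<Rightarrow> (real \<Rightarrow> 'z) measure \<Rightarrow> real \<Rightarrow> ereal" where
  "info_capacity SX SY g mu \<Delta> = Lim at_top (info_rate SX SY g mu \<Delta>)"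

end

theory Submission
  imports Defs
begin

text \<open>Converse. A code with message M is an admissible input (U constantly equal to M), so by Fano's
  inequality it suffices that I(M; Y) is at most the directed information. On a block shorter than
  the delay, M and the noise are conditionally independent given the inputs up to the end of the
  block and the past outputs, whence I(M; Y_block | past) is at most I(X; Y_block | past); longer
  blocks are subdivided. No regular conditional distributions are needed: everything is expressed
  by conditional entropies of finite-valued variables given sub-sigma-algebras.

  Achievability. For a partition finer than the delay the directed information is at most I(U; Y),
  hence close to I(U; q(Y)) for a finite quantizer q of a whole block. Using the strategies U as
  input letters turns the channel into a finite-alphabet channel without feedback whose noise is
  stationary and ergodic from block to block. Its single-letter information is achieved by
  threshold decoding of the summed information densities: the lower tail of the correct codeword is
  controlled by the ergodic theorem and a Chernoff bound, a wrong codeword by Markov's inequality.\<close>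

subsection \<open>Entropy and conditional probabilities\<close>

text \<open>Both halves rest on one identity: if A takes finitely many values and drives the
  channel, the directed information equals H(A) - H(A | Y_0^T). Every block term is at least H(A |
  Y_0^a) - H(A | Y_0^b), with equality on blocks no longer than the delay, and these differences
  telescope. Entropy is always that of a finite-valued variable, because output paths live in a
  product over uncountably many times and need not have finite entropy; the symmetry H(q | W) - H(q
  | r, W) = H(r | W) - H(r | q, W) moves the finite variable to whichever side is needed. The past
  output in the condition is never quantized, so the supremum over quantizers in \<open>cmi\<close>
  must be shown to reach the unquantized sigma-algebra; this is done by mean-square approximation of
  conditional probabilities. In the achievability half no mixing of the noise is available, so
  independence comes from the random letters: with the noise frozen, the information density
  fluctuates through the letters alone, and its average over them is a function of the noise, to
  which the ergodic bound applies.\<close>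

definition eta :: "real \<Rightarrow> real" where
  "eta x = - (x * log 2 x)"

lemma eta_simps [simp]: "eta 0 = 0" "eta 1 = 0"
  by (simp_all add: eta_def)

lemma eta_measurable [measurable]: "eta \<in> borel_measurable borel"
  unfolding eta_def by measurable

text \<open>Concavity: the right side is the tangent line of \<open>eta\<close> at s. Taking s to be
  a coarser conditional probability shows that conditioning reduces entropy; taking it to be a guess
  built from a decoder gives Fano's inequality.\<close>

lemma eta_tangent:
  assumes "0 \<le> x" "0 < s"
  shows "eta x \<le> - (x * log 2 s) + (s - x) / ln 2"
proof (cases "x = 0")
  case True
  then show ?thesis using assms by (simp add: eta_def)
next
  case False
  with assms have x: "x > 0" by simp
  have "ln (s / x) \<le> s / x - 1" using x assms by (intro ln_le_minus_one) simp
  then have "x * (ln s - ln x) \<le> x * (s / x - 1)"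
    using x assms by (intro mult_left_mono) (simp_all add: ln_div)
  also have "\<dots> = s - x" using x by (simp add: field_simps)
  finally have "x * (ln s - ln x) / ln 2 \<le> (s - x) / ln 2"
    by (intro divide_right_mono) simp_all
  then show ?thesis by (simp add: eta_def log_def field_simps)
qed

lemma eta_nonneg: "0 \<le> x \<Longrightarrow> x \<le> 1 \<Longrightarrow> 0 \<le> eta x"
  by (cases "x = 0") (auto simp: eta_def mult_nonneg_nonpos)

lemma eta_le: "0 \<le> x \<Longrightarrow> x \<le> 1 \<Longrightarrow> eta x \<le> 1 / ln 2"
proof -
  assume "0 \<le> x" "x \<le> 1"
  then have "0 \<le> x / ln 2" by simp
  then show ?thesis using eta_tangent[OF \<open>0 \<le> x\<close>, of 1] by (simp add: diff_divide_distrib)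
qed

text \<open>Near 0 the logarithm is unbounded, so continuity of \<open>eta\<close> there needs an
  explicit bound that vanishes; it comes from ln y <= y - 1 at y = 1 / sqrt x.\<close>

lemma eta_le_sqrt:
  assumes "0 \<le> x"
  shows "eta x \<le> 2 / ln 2 * sqrt x"
proof (cases "x = 0")
  case False
  then have s: "sqrt x > 0" using assms by simp
  have "- ln (sqrt x) \<le> 1 / sqrt x - 1"
    using ln_le_minus_one[of "1 / sqrt x"] s by (simp add: ln_div)
  then have "x * (- 2 * ln (sqrt x)) \<le> x * (2 * (1 / sqrt x))"
    using assms by (intro mult_left_mono) auto
  also have "\<dots> = 2 * sqrt x" using s assms by (simp add: field_simps)
  finally show ?thesis using s assms False
    by (simp add: eta_def log_def ln_sqrt divide_right_mono field_simps)
qed simp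

lemma eta_cont: "continuous_on {0..1} eta"
  unfolding continuous_on_def
proof
  fix x :: real assume x: "x \<in> {0..1}"
  show "(eta \<longlongrightarrow> eta x) (at x within {0..1})"
  proof (cases "x = 0")
    case True
    have "((\<lambda>x. 2 / ln 2 * sqrt x) \<longlongrightarrow> 2 / ln 2 * sqrt 0) (at (0::real) within {0..1})"
      by (intro tendsto_intros)
    then have "(eta \<longlongrightarrow> 0) (at 0 within {0..1})"
      by (intro real_tendsto_sandwich[of "\<lambda>_. 0" eta _ "\<lambda>x. 2 / ln 2 * sqrt x"])
        (use eta_le_sqrt in \<open>auto simp: eventually_at_filter intro!: always_eventually eta_nonneg\<close>)
    then show ?thesis using True by simp
  next
    case False
    have "isCont eta x" unfolding eta_def using False x by (intro continuous_intros) auto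
    then show ?thesis by (simp add: continuous_at_imp_continuous_at_within flip: continuous_within)
  qed
qed

text \<open>Uniform continuity in a form that can be integrated: a mean-square distance between two
  conditional probabilities then bounds the difference of their expected \<open>eta\<close>.\<close>

lemma eta_modulus:
  assumes "e > 0"
  obtains C where "C \<ge> 0" "\<And>x y. x \<in> {0..1} \<Longrightarrow> y \<in> {0..1} \<Longrightarrow> \<bar>eta x - eta y\<bar> \<le> e + C * (x - y)\<^sup>2"
proof -
  have "uniformly_continuous_on {0..1} eta"
    by (rule compact_uniformly_continuous[OF eta_cont]) simp
  then obtain d where d: "d > 0" "\<And>x y. x \<in> {0..1} \<Longrightarrow> y \<in> {0..1} \<Longrightarrow> \<bar>x - y\<bar> < d \<Longrightarrow> \<bar>eta x - eta y\<bar> < e"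
    using assms unfolding uniformly_continuous_on_def dist_real_def by metis
  show ?thesis
  \<comment> \<open>Points at least d apart are paid for by the quadratic term, since
    \<open>eta\<close> oscillates by at most 1 / ln 2 on the unit interval.\<close>
  proof (rule that[of "1 / ln 2 / d\<^sup>2"])
    fix x y :: real assume xy: "x \<in> {0..1}" "y \<in> {0..1}"
    show "\<bar>eta x - eta y\<bar> \<le> e + 1 / ln 2 / d\<^sup>2 * (x - y)\<^sup>2"
    proof (cases "\<bar>x - y\<bar> < d")
      case True
      have "0 \<le> 1 / ln 2 / d\<^sup>2 * (x - y)\<^sup>2" using d by simp
      then show ?thesis using d(2)[OF xy True] by linarith
    next
      case False
      have "d\<^sup>2 \<le> (x - y)\<^sup>2"
        using False d abs_le_square_iff[of d "x - y"] by simp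
      then have "1 / ln 2 / d\<^sup>2 * d\<^sup>2 \<le> 1 / ln 2 / d\<^sup>2 * (x - y)\<^sup>2"
        using d by (intro mult_left_mono) auto
      then have "1 / ln 2 \<le> 1 / ln 2 / d\<^sup>2 * (x - y)\<^sup>2" using d by simp
      moreover have "\<bar>eta x - eta y\<bar> \<le> 1 / ln 2"
        using eta_nonneg[of x] eta_nonneg[of y] eta_le[of x] eta_le[of y] xy by auto
      ultimately show ?thesis using assms by linarith
    qed
  qed (use d in simp)
qed

section \<open>Conditional probability and conditional entropy given a sub-sigma-algebra\<close>

text \<open>Clamping changes the conditional expectation only on a null set and makes every pointwise bound
  below unconditional.\<close>

definition cprob :: "'a measure \<Rightarrow> 'a measure \<Rightarrow> 'a set \<Rightarrow> 'a \<Rightarrow> real" where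
  "cprob P F A x = min 1 (max 0 (real_cond_exp P F (indicator A) x))"

text \<open>H(q | F) in bits. Of F only the sigma-algebra matters; sub-sigma-algebras are passed
  around as measures.\<close>

definition centropy :: "'a measure \<Rightarrow> 'a measure \<Rightarrow> ('a \<Rightarrow> 'k) \<Rightarrow> real" where
  "centropy P F q = (\<Sum>k\<in>q ` space P. \<integral>x. eta (cprob P F (q -` {k} \<inter> space P) x) \<partial>P)"

lemma cprob_bounds [simp]: "0 \<le> cprob P F A x" "cprob P F A x \<le> 1"
  by (auto simp: cprob_def)

lemma cprob_measurable [measurable]: "cprob P F A \<in> borel_measurable F"
  unfolding cprob_def[abs_def] by measurable

lemma cprob_measurable' : "subalgebra P F \<Longrightarrow> cprob P F A \<in> borel_measurable P"
  by (rule measurable_from_subalg[OF _ cprob_measurable])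

context prob_space
begin

lemma subalg_finite: "subalgebra M F \<Longrightarrow> finite_measure_subalgebra M F"
  by unfold_locales

lemma cprob_AE:
  assumes "subalgebra M F" "A \<in> events"
  shows "AE x in M. cprob M F A x = real_cond_exp M F (indicator A) x"
proof -
  interpret finite_measure_subalgebra M F by (rule subalg_finite) fact
  have i: "integrable M (indicator A :: 'a \<Rightarrow> real)"
    using assms by (simp add: integrable_real_indicator emeasure_finite less_top[symmetric])
  have "AE x in M. real_cond_exp M F (indicator A) x \<ge> 0"
    by (rule real_cond_exp_pos) (use assms in auto)
  moreover have "AE x in M. real_cond_exp M F (indicator A) x \<le> 1"
    by (rule real_cond_exp_le_c[OF i]) (auto simp: indicator_def)
  ultimately show ?thesis by eventually_elim (auto simp: cprob_def)
qed

lemma integrable_bounded: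
  fixes f :: "'a \<Rightarrow> real"
  assumes "f \<in> borel_measurable M" "\<And>x. x \<in> space M \<Longrightarrow> \<bar>f x\<bar> \<le> B"
  shows "integrable M f"
  by (rule integrable_const_bound[where B=B]) (use assms in auto)

lemma cprob_integral:
  assumes F: "subalgebra M F" and A: "A \<in> events" and f: "f \<in> borel_measurable F"
    and i: "integrable M (\<lambda>x. f x * indicator A x)"
  shows "integrable M (\<lambda>x. f x * cprob M F A x)"
    "(\<integral>x. f x * cprob M F A x \<partial>M) = (\<integral>x. f x * indicator A x \<partial>M)"
proof -
  interpret finite_measure_subalgebra M F by (rule subalg_finite) fact
  have fM[measurable]: "f \<in> borel_measurable M" by (rule measurable_from_subalg[OF F f])
  have [measurable]: "cprob M F A \<in> borel_measurable M" by (rule cprob_measurable'[OF F])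
  have [measurable]: "real_cond_exp M F (indicator A) \<in> borel_measurable M" by simp
  have ae: "AE x in M. f x * real_cond_exp M F (indicator A) x = f x * cprob M F A x"
    using cprob_AE[OF F A] by eventually_elim simp
  note 1 = real_cond_exp_intg[OF i f borel_measurable_indicator[OF A]]
  show "integrable M (\<lambda>x. f x * cprob M F A x)"
    by (rule integrable_cong_AE_imp[OF 1(1)]) (use ae in auto)
  have "(\<integral>x. f x * cprob M F A x \<partial>M) = (\<integral>x. f x * real_cond_exp M F (indicator A) x \<partial>M)"
    by (rule integral_cong_AE) (use ae in auto)
  then show "(\<integral>x. f x * cprob M F A x \<partial>M) = (\<integral>x. f x * indicator A x \<partial>M)"
    using 1(2) by simp
qed

lemma cprob_integral_bounded:
  assumes F: "subalgebra M F" and A: "A \<in> events" and f: "f \<in> borel_measurable F"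
    and B: "\<And>x. x \<in> space M \<Longrightarrow> \<bar>f x\<bar> \<le> B"
  shows "(\<integral>x. f x * cprob M F A x \<partial>M) = (\<integral>x. f x * indicator A x \<partial>M)"
proof (rule cprob_integral(2)[OF F A f])
  have [measurable]: "f \<in> borel_measurable M" by (rule measurable_from_subalg[OF F f])
  show "integrable M (\<lambda>x. f x * indicator A x)"
    by (rule integrable_bounded[where B="\<bar>B\<bar>"])
      (use A in \<open>auto simp: indicator_def dest!: B intro: order_trans\<close>)
qed

lemma cprob_int:
  assumes F: "subalgebra M F" and A: "A \<in> events" and B: "B \<in> sets F"
  shows "(\<integral>x. indicator B x * cprob M F A x \<partial>M) = prob (A \<inter> B)"
proof -
  have BM: "B \<in> events" using F B by (auto simp: subalgebra_def)
  have "(\<integral>x. indicator B x * cprob M F A x \<partial>M) = (\<integral>x. indicator B x * indicator A x \<partial>M)"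
    by (rule cprob_integral_bounded[OF F A, where B=1]) (use B in \<open>auto simp: indicator_def\<close>)
  also have "\<dots> = (\<integral>x. indicator (A \<inter> B) x \<partial>M)"
    by (rule Bochner_Integration.integral_cong) (auto simp: indicator_def)
  finally show ?thesis using A BM by simp
qed

text \<open>The working tool for identities between conditional probabilities: guess h and test it
  on the sets of F.\<close>

lemma cprob_charact:
  assumes F: "subalgebra M F" and A: "A \<in> events" and h: "h \<in> borel_measurable F" "integrable M h"
    and eq: "\<And>B. B \<in> sets F \<Longrightarrow> (\<integral>x. indicator B x * h x \<partial>M) = prob (A \<inter> B)"
  shows "AE x in M. cprob M F A x = h x"
proof -
  interpret finite_measure_subalgebra M F by (rule subalg_finite) fact
  have i: "integrable M (indicator A :: 'a \<Rightarrow> real)"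
    using A by (simp add: integrable_real_indicator emeasure_finite less_top[symmetric])
  have "AE x in M. real_cond_exp M F (indicator A) x = h x"
  proof (rule real_cond_exp_charact[OF _ i h(2) h(1)])
    fix B assume B: "B \<in> sets F"
    have BM: "B \<in> events" using F B by (auto simp: subalgebra_def)
    have "(\<integral>x\<in>B. indicator A x \<partial>M) = (\<integral>x. indicat_real (A \<inter> B) x \<partial>M)"
      unfolding set_lebesgue_integral_def
      by (rule Bochner_Integration.integral_cong) (auto simp: indicator_def)
    then have "(\<integral>x\<in>B. indicator A x \<partial>M) = prob (A \<inter> B)" using A BM by simp
    then show "(\<integral>x\<in>B. indicator A x \<partial>M) = (\<integral>x\<in>B. h x \<partial>M)"
      using eq[OF B] by (simp add: set_lebesgue_integral_def)
  qed
  then show ?thesis using cprob_AE[OF F A] by eventually_elim simp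
qed

lemma integrable_eta_cprob:
  assumes "subalgebra M F"
  shows "integrable M (\<lambda>x. eta (cprob M F A x))"
proof -
  have [measurable]: "cprob M F A \<in> borel_measurable M" by (rule cprob_measurable'[OF assms])
  show ?thesis
    by (rule integrable_bounded[where B="1 / ln 2"]) (simp_all add: abs_of_nonneg eta_nonneg eta_le)
qed

lemma integrable_cprob:
  assumes "subalgebra M F"
  shows "integrable M (cprob M F A)"
  by (rule integrable_bounded[where B="1"]) (simp_all add: cprob_measurable'[OF assms])

lemma expectation_cprob:
  assumes F: "subalgebra M F" and A: "A \<in> events"
  shows "expectation (cprob M F A) = prob A"
  using cprob_integral_bounded[OF F A, of "\<lambda>_. 1" 1] A by simp

text \<open>A conditional Jensen inequality is avoided by taking the tangent of \<open>eta\<close>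
  at the coarser conditional probability s: log s is measurable for both algebras, so both
  conditional probabilities have the same integral against it.\<close>

lemma expectation_eta_mono:
  assumes F: "subalgebra M F" and G: "subalgebra M G" and FG: "sets F \<subseteq> sets G" and A: "A \<in> events"
  shows "(\<integral>x. eta (cprob M G A x) \<partial>M) \<le> (\<integral>x. eta (cprob M F A x) \<partial>M)"
proof (rule field_le_epsilon)
  fix e :: real assume e: "e > 0"
  \<comment> \<open>The floor d keeps log s bounded; it costs at most d / ln 2 <= e, and d <= 1
    keeps s within the unit interval.\<close>
  define d where "d = min 1 (e * ln 2)"
  have d: "d > 0" "d \<le> 1" "d / ln 2 \<le> e" using e by (auto simp: d_def field_simps min_def)
  define s where "s x = max d (cprob M F A x)" for x
  have s: "d \<le> s x" "s x \<le> 1" "0 < s x" "cprob M F A x \<le> s x" "s x \<le> cprob M F A x + d" for x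
    using d by (auto simp: s_def intro: less_le_trans)
  have sF: "s \<in> borel_measurable F" unfolding s_def[abs_def] by measurable
  have sM [measurable]: "s \<in> borel_measurable M" by (rule measurable_from_subalg[OF F sF])
  have lF: "(\<lambda>x. log 2 (s x)) \<in> borel_measurable F" using sF by measurable
  have spFG: "space F = space G" using F G by (auto simp: subalgebra_def)
  have lG: "(\<lambda>x. log 2 (s x)) \<in> borel_measurable G"
    by (rule measurable_from_subalg[OF _ lF]) (use FG spFG in \<open>auto simp: subalgebra_def\<close>)
  have lb: "\<bar>log 2 (s x)\<bar> \<le> - log 2 d" for x
    using s[of x] d by (simp add: abs_if)
  have [measurable]: "cprob M F A \<in> borel_measurable M" "cprob M G A \<in> borel_measurable M"
    using cprob_measurable'[OF F] cprob_measurable'[OF G] by auto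
  have cl: "\<bar>c * log 2 (s x)\<bar> \<le> - log 2 d" if "0 \<le> c" "c \<le> 1" for c x
    using mult_mono[OF that(2) lb[of x]] that by (simp add: abs_mult)
  have i1: "integrable M (\<lambda>x. cprob M F' A x * log 2 (s x))" if "cprob M F' A \<in> borel_measurable M" for F'
    by (rule integrable_bounded[where B="- log 2 d"]) (use that cl in auto)
  have i1F: "integrable M (\<lambda>x. cprob M F A x * log 2 (s x))" "integrable M (\<lambda>x. cprob M G A x * log 2 (s x))"
    using i1 by auto
  have int_s: "integrable M s"
    by (rule integrable_bounded[where B="1"]) (use s in \<open>auto simp: abs_of_pos\<close>)
  have swap: "(\<integral>x. cprob M G A x * log 2 (s x) \<partial>M) = (\<integral>x. cprob M F A x * log 2 (s x) \<partial>M)"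
    using cprob_integral_bounded[OF G A lG lb] cprob_integral_bounded[OF F A lF lb]
    by (simp add: mult.commute)
  have "(\<integral>x. eta (cprob M G A x) \<partial>M) \<le> (\<integral>x. - (cprob M G A x * log 2 (s x)) + (s x - cprob M G A x) / ln 2 \<partial>M)"
    by (intro integral_mono integrable_eta_cprob G Bochner_Integration.integrable_add
        Bochner_Integration.integrable_minus i1F integrable_divide Bochner_Integration.integrable_diff
        integrable_cprob int_s eta_tangent s cprob_bounds)
  also have "\<dots> = - (\<integral>x. cprob M G A x * log 2 (s x) \<partial>M) + ((\<integral>x. s x \<partial>M) - (\<integral>x. cprob M G A x \<partial>M)) / ln 2"
    by (simp add: i1 int_s integrable_cprob[OF G])
  also have "\<dots> = - (\<integral>x. cprob M F A x * log 2 (s x) \<partial>M) + ((\<integral>x. s x \<partial>M) - (\<integral>x. cprob M F A x \<partial>M)) / ln 2"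
    using swap expectation_cprob[OF F A] expectation_cprob[OF G A] by simp
  also have "\<dots> = (\<integral>x. - (cprob M F A x * log 2 (s x)) + (s x - cprob M F A x) / ln 2 \<partial>M)"
    by (simp add: i1 int_s integrable_cprob[OF F])
  also have "\<dots> \<le> (\<integral>x. eta (cprob M F A x) + d / ln 2 \<partial>M)"
  proof (intro integral_mono integrable_eta_cprob F Bochner_Integration.integrable_add
        Bochner_Integration.integrable_minus i1F integrable_divide Bochner_Integration.integrable_diff
        integrable_cprob int_s integrable_const)
    fix x
    have "cprob M F A x * log 2 (cprob M F A x) \<le> cprob M F A x * log 2 (s x)"
      using s[of x] cprob_bounds(1)[of M F A x] by (cases "cprob M F A x = 0") (auto intro!: mult_left_mono simp del: cprob_bounds)
    moreover have "(s x - cprob M F A x) / ln 2 \<le> d / ln 2"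
      using s(5)[of x] by (intro divide_right_mono) auto
    ultimately show "- (cprob M F A x * log 2 (s x)) + (s x - cprob M F A x) / ln 2 \<le> eta (cprob M F A x) + d / ln 2"
      by (simp add: eta_def)
  qed
  also have "\<dots> = (\<integral>x. eta (cprob M F A x) \<partial>M) + d / ln 2"
    by (simp add: integrable_eta_cprob[OF F] prob_space)
  finally show "(\<integral>x. eta (cprob M G A x) \<partial>M) \<le> (\<integral>x. eta (cprob M F A x) \<partial>M) + e"
    using d by linarith
qed

lemma centropy_mono:
  assumes "subalgebra M F" "subalgebra M G" "sets F \<subseteq> sets G" "q \<in> measurable M (count_space UNIV)"
  shows "centropy M G q \<le> centropy M F q"
  unfolding centropy_def
  by (intro sum_mono expectation_eta_mono assms measurable_sets[OF assms(4)]) auto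

end

section \<open>Generated sub-sigma-algebras and finite quantizers\<close>

definition gen_alg :: "'a measure \<Rightarrow> 's measure \<Rightarrow> ('a \<Rightarrow> 's) \<Rightarrow> 'a measure" where
  "gen_alg P S W = vimage_algebra (space P) W S"

lemma space_gen_alg [simp]: "space (gen_alg P S W) = space P"
  by (simp add: gen_alg_def)

lemma sets_gen_alg: "W \<in> measurable P S \<Longrightarrow> sets (gen_alg P S W) = {W -` B \<inter> space P | B. B \<in> sets S}"
  unfolding gen_alg_def by (rule sets_vimage_algebra2) (auto dest: measurable_space)

lemma subalgebra_gen_alg: "W \<in> measurable P S \<Longrightarrow> subalgebra P (gen_alg P S W)"
  by (auto simp: subalgebra_def sets_gen_alg)

lemma measurable_gen_alg: "W \<in> measurable P S \<Longrightarrow> W \<in> measurable (gen_alg P S W) S"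
  unfolding gen_alg_def by (rule measurable_vimage_algebra1) (auto dest: measurable_space)

lemma gen_alg_subset:
  assumes "W \<in> measurable G S" "space G = space P"
  shows "sets (gen_alg P S W) \<subseteq> sets G"
  using assms(2) measurable_sets[OF assms(1)] measurable_space[OF assms(1)]
  unfolding gen_alg_def by (subst sets_vimage_algebra2) auto

lemma gen_alg_mono:
  assumes W: "W \<in> measurable P S" and f: "f \<in> measurable S S'"
    and eq: "\<And>x. x \<in> space P \<Longrightarrow> W' x = f (W x)"
  shows "sets (gen_alg P S' W') \<subseteq> sets (gen_alg P S W)"
proof (rule gen_alg_subset)
  have "(\<lambda>x. f (W x)) \<in> measurable (gen_alg P S W) S'"
    by (rule measurable_compose[OF measurable_gen_alg[OF W] f])
  then show "W' \<in> measurable (gen_alg P S W) S'"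
    by (rule measurable_cong[THEN iffD1, rotated]) (simp add: eq)
qed simp

definition quantizer :: "'s measure \<Rightarrow> ('s \<Rightarrow> nat) \<Rightarrow> bool" where
  "quantizer S r \<longleftrightarrow> r \<in> measurable S (count_space UNIV) \<and> finite (r ` space S)"

lemma quantizer_measurable: "quantizer S r \<Longrightarrow> r \<in> measurable S (count_space UNIV)"
  by (simp add: quantizer_def)

text \<open>Pairing with \<open>prod_encode\<close> keeps the values in nat, so finitely many
  quantizers have a common refinement from which each is recovered by some \<phi> i. Separate
  approximations can therefore share one quantizer.\<close>

lemma joint_quantizer:
  assumes "finite I" "\<And>i. i \<in> I \<Longrightarrow> quantizer S (r i)"
  shows "\<exists>t \<phi>. quantizer S t \<and> (\<forall>i\<in>I. \<forall>v\<in>space S. r i v = \<phi> i (t v))"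
  using assms
proof (induction I rule: finite_induct)
  case empty
  have "quantizer S (\<lambda>_. 0)" by (auto simp: quantizer_def intro: finite_subset[of _ "{0}"])
  then show ?case by auto
next
  case (insert j I)
  then obtain t \<phi> where t: "quantizer S t" "\<And>i v. i \<in> I \<Longrightarrow> v \<in> space S \<Longrightarrow> r i v = \<phi> i (t v)"
    by blast
  have rj: "quantizer S (r j)" using insert by simp
  have m: "(\<lambda>v. prod_encode (r j v, t v)) \<in> measurable S (count_space UNIV)"
  proof (rule measurable_compose_countable[where f="\<lambda>k v. prod_encode (k, t v)"])
    show "r j \<in> measurable S (count_space UNIV)" using rj by (simp add: quantizer_def)
    show "(\<lambda>v. prod_encode (k, t v)) \<in> measurable S (count_space UNIV)" for k
      using t(1) by (auto simp: quantizer_def intro: measurable_compose)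
  qed
  have "(\<lambda>v. prod_encode (r j v, t v)) ` space S \<subseteq> prod_encode ` (r j ` space S \<times> t ` space S)"
    by auto
  then have "finite ((\<lambda>v. prod_encode (r j v, t v)) ` space S)"
    by (rule finite_subset) (use rj t(1) in \<open>auto simp: quantizer_def\<close>)
  with m have "quantizer S (\<lambda>v. prod_encode (r j v, t v))" by (simp add: quantizer_def)
  moreover have "\<forall>i\<in>insert j I. \<forall>v\<in>space S.
      r i v = (if i = j then fst else \<phi> i \<circ> snd) (prod_decode (prod_encode (r j v, t v)))"
    using t(2) by auto
  ultimately show ?case
    by (intro exI[of _ "\<lambda>v. prod_encode (r j v, t v)"] exI[of _ "\<lambda>i. (if i = j then fst else \<phi> i \<circ> snd) \<circ> prod_decode"]) auto
qed

section \<open>Chain rule, symmetry and Fano's inequality\<close>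

context prob_space
begin

lemma centropy_superset:
  assumes F: "subalgebra M F" and K: "finite K" "q ` space M \<subseteq> K"
  shows "centropy M F q = (\<Sum>k\<in>K. \<integral>x. eta (cprob M F (q -` {k} \<inter> space M) x) \<partial>M)"
  unfolding centropy_def
proof (rule sum.mono_neutral_left[OF K], rule)
  fix k assume k: "k \<in> K - q ` space M"
  then have e: "q -` {k} \<inter> space M = {}" by auto
  have "AE x in M. cprob M F {} x = 0"
    by (rule cprob_charact[OF F]) auto
  then have "(\<integral>x. eta (cprob M F {} x) \<partial>M) = (\<integral>x. 0 \<partial>M)"
    using cprob_measurable'[OF F] by (intro integral_cong_AE) auto
  then show "(\<integral>x. eta (cprob M F (q -` {k} \<inter> space M) x) \<partial>M) = 0" by (simp add: e)
qed

lemma cprob_finite_Union: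
  assumes F: "subalgebra M F" and J: "finite J" "\<And>j. j \<in> J \<Longrightarrow> A j \<in> events" "disjoint_family_on A J"
  shows "AE x in M. cprob M F (\<Union>j\<in>J. A j) x = (\<Sum>j\<in>J. cprob M F (A j) x)"
proof (rule cprob_charact[OF F])
  show "(\<Union>j\<in>J. A j) \<in> events" using J by auto
  show "integrable M (\<lambda>x. \<Sum>j\<in>J. cprob M F (A j) x)"
    by (intro Bochner_Integration.integrable_sum integrable_cprob F)
  fix B assume B: "B \<in> sets F"
  have BM: "B \<in> events" using F B by (auto simp: subalgebra_def)
  have i: "integrable M (\<lambda>x. indicator B x * cprob M F (A j) x)" for j
    by (rule integrable_bounded[where B=1])
      (use BM cprob_measurable'[OF F] in \<open>auto simp: indicator_def\<close>)
  have "(\<integral>x. indicator B x * (\<Sum>j\<in>J. cprob M F (A j) x) \<partial>M) = (\<Sum>j\<in>J. prob (A j \<inter> B))"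
    using i by (simp add: sum_distrib_left cprob_int[OF F J(2) B])
  also have "\<dots> = prob (\<Union>j\<in>J. A j \<inter> B)"
    by (rule finite_measure_finite_Union[symmetric])
      (use J BM in \<open>auto simp: disjoint_family_on_def\<close>)
  also have "(\<Union>j\<in>J. A j \<inter> B) = (\<Union>j\<in>J. A j) \<inter> B" by auto
  finally show "(\<integral>x. indicator B x * (\<Sum>j\<in>J. cprob M F (A j) x) \<partial>M) = prob ((\<Union>j\<in>J. A j) \<inter> B)" .
qed measurable

text \<open>Chain rule; the right side is the joint entropy of q and r given W. On the event q = k
  the conditional law of r given (q, W) is P(q = k, r = j | W) / P(q = k | W), and expanding
  \<open>eta\<close> of this quotient separates the two entropies.\<close>

lemma centropy_chain:
  fixes q :: "'a \<Rightarrow> 'k" and r :: "'a \<Rightarrow> 'j"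
  assumes W: "W \<in> measurable M S"
    and q: "q \<in> measurable M (count_space UNIV)" "finite (q ` space M)"
    and r: "r \<in> measurable M (count_space UNIV)" "finite (r ` space M)"
  shows "centropy M (gen_alg M (count_space UNIV \<Otimes>\<^sub>M S) (\<lambda>x. (q x, W x))) r + centropy M (gen_alg M S W) q
     = (\<Sum>k\<in>q ` space M. \<Sum>j\<in>r ` space M.
          \<integral>x. eta (cprob M (gen_alg M S W) (q -` {k} \<inter> r -` {j} \<inter> space M) x) \<partial>M)"
proof -
  define F where "F = gen_alg M S W"
  define G where "G = gen_alg M (count_space UNIV \<Otimes>\<^sub>M S) (\<lambda>x. (q x, W x))"
  define Q where "Q k = q -` {k} \<inter> space M" for k
  define R where "R j = r -` {j} \<inter> space M" for j
  define K where "K = q ` space M"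
  define J where "J = r ` space M"
  have fin: "finite K" "finite J" using q r by (auto simp: K_def J_def)
  have qW: "(\<lambda>x. (q x, W x)) \<in> measurable M (count_space UNIV \<Otimes>\<^sub>M S)" using q W by simp
  have F: "subalgebra M F" and G: "subalgebra M G"
    unfolding F_def G_def by (intro subalgebra_gen_alg W qW)+
  have FG: "sets F \<subseteq> sets G"
    unfolding F_def G_def by (rule gen_alg_mono[OF qW measurable_snd]) simp
  have subGF: "subalgebra G F" using F G FG by (auto simp: subalgebra_def)
  have Q [measurable]: "Q k \<in> events" for k using q unfolding Q_def by measurable
  have R [measurable]: "R j \<in> events" for j using r unfolding R_def by measurable
  have QG: "Q k \<in> sets G" for k
  proof -
    have "q = (\<lambda>x. fst (q x, W x))" by simp
    then have "q \<in> measurable G (count_space UNIV)"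
      unfolding G_def using measurable_compose[OF measurable_gen_alg[OF qW] measurable_fst] by simp
    then have "q -` {k} \<inter> space G \<in> sets G" by (rule measurable_sets) simp
    then show ?thesis by (simp add: Q_def G_def)
  qed
  \<comment> \<open>The candidate for P(r = j | q = k, W). Where the denominator vanishes, division
    yields 0, and the minimum with 1 bounds it everywhere.\<close>
  define h where "h k j x = min 1 (cprob M F (Q k \<inter> R j) x / cprob M F (Q k) x)" for k j x
  have hF: "h k j \<in> borel_measurable F" for k j unfolding h_def[abs_def] by measurable
  have hM [measurable]: "h k j \<in> borel_measurable M" for k j
    by (rule measurable_from_subalg[OF F hF])
  have h01: "0 \<le> h k j x" "h k j x \<le> 1" for k j x by (auto simp: h_def)
  have [measurable]: "cprob M F A \<in> borel_measurable M" for A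
    by (rule cprob_measurable'[OF F])
  have add: "AE x in M. cprob M F (Q k) x = (\<Sum>j\<in>J. cprob M F (Q k \<inter> R j) x)" for k
  proof -
    have "disjoint_family_on (\<lambda>j. Q k \<inter> R j) J" by (auto simp: disjoint_family_on_def R_def)
    then have "AE x in M. cprob M F (\<Union>j\<in>J. Q k \<inter> R j) x = (\<Sum>j\<in>J. cprob M F (Q k \<inter> R j) x)"
      by (intro cprob_finite_Union[OF F fin(2)]) auto
    moreover have "(\<Union>j\<in>J. Q k \<inter> R j) = Q k" by (auto simp: Q_def R_def J_def)
    ultimately show ?thesis by simp
  qed
  have hp: "AE x in M. \<forall>j\<in>J. h k j x * cprob M F (Q k) x = cprob M F (Q k \<inter> R j) x" for k
    using add[of k]
  proof eventually_elim
    case (elim x)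
    show ?case
    proof
      fix j assume j: "j \<in> J"
      have "cprob M F (Q k \<inter> R j) x \<le> cprob M F (Q k) x"
        unfolding elim by (rule member_le_sum) (use j fin in auto)
      moreover have "0 \<le> cprob M F (Q k \<inter> R j) x" by simp
      ultimately show "h k j x * cprob M F (Q k) x = cprob M F (Q k \<inter> R j) x"
        by (cases "cprob M F (Q k) x = 0")
          (auto simp: h_def min_def divide_le_eq_1 field_simps dest: order_antisym simp del: cprob_bounds)
    qed
  qed
  define g where "g j x = (\<Sum>k\<in>K. indicator (Q k) x * h k j x)" for j x
  have gb: "\<bar>g j x\<bar> \<le> card K" for j x
  proof -
    have "\<bar>g j x\<bar> \<le> (\<Sum>k\<in>K. 1)"
      unfolding g_def by (intro order_trans[OF sum_abs] sum_mono) (auto simp: indicator_def abs_of_nonneg h01)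
    then show ?thesis by simp
  qed
  have gG: "g j \<in> borel_measurable G" for j
  proof -
    have [measurable]: "h k j \<in> borel_measurable G" for k
      by (rule measurable_from_subalg[OF subGF hF])
    show ?thesis unfolding g_def[abs_def] using QG by measurable
  qed
  have [measurable]: "g j \<in> borel_measurable M" for j by (rule measurable_from_subalg[OF G gG])
  have cG: "AE x in M. cprob M G (R j) x = g j x" if j: "j \<in> J" for j
  proof (rule cprob_charact[OF G R gG])
    show "integrable M (g j)" by (rule integrable_bounded[OF _ gb]) measurable
    fix B assume "B \<in> sets G"
    then obtain C where C: "C \<in> sets (count_space UNIV \<Otimes>\<^sub>M S)" and B: "B = (\<lambda>x. (q x, W x)) -` C \<inter> space M"
      unfolding G_def sets_gen_alg[OF qW] by auto
    \<comment> \<open>The slice of B on q = k is determined by W alone, which reduces a test over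
      the larger algebra G to tests over F.\<close>
    define Bk where "Bk k = W -` (Pair k -` C) \<inter> space M" for k
    have BkF: "Bk k \<in> sets F" for k
      unfolding Bk_def F_def sets_gen_alg[OF W] using sets_Pair1[OF C, of k] by auto
    have [measurable]: "Bk k \<in> events" for k using BkF F by (auto simp: subalgebra_def)
    have "(\<integral>x. indicator B x * g j x \<partial>M) = (\<integral>x. (\<Sum>k\<in>K. (indicator (Bk k) x * h k j x) * indicator (Q k) x) \<partial>M)"
      unfolding g_def sum_distrib_left
      by (intro Bochner_Integration.integral_cong sum.cong refl) (auto simp: B Bk_def Q_def indicator_def)
    also have "\<dots> = (\<Sum>k\<in>K. \<integral>x. (indicator (Bk k) x * h k j x) * indicator (Q k) x \<partial>M)"
      by (intro Bochner_Integration.integral_sum integrable_bounded[where B=1])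
        (auto simp: indicator_def h01 abs_of_nonneg)
    also have "\<dots> = (\<Sum>k\<in>K. prob (Q k \<inter> R j \<inter> Bk k))"
    proof (rule sum.cong[OF refl])
      fix k
      have "(\<integral>x. (indicator (Bk k) x * h k j x) * indicator (Q k) x \<partial>M)
         = (\<integral>x. (indicator (Bk k) x * h k j x) * cprob M F (Q k) x \<partial>M)"
        by (rule cprob_integral_bounded[OF F Q, where B=1, symmetric])
          (use hF BkF in \<open>auto simp: indicator_def h01 abs_of_nonneg\<close>)
      also have "\<dots> = (\<integral>x. indicator (Bk k) x * cprob M F (Q k \<inter> R j) x \<partial>M)"
        by (rule integral_cong_AE) (use hp[of k] j in \<open>auto simp: mult.assoc\<close>)
      also have "\<dots> = prob (Q k \<inter> R j \<inter> Bk k)"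
        by (rule cprob_int[OF F _ BkF]) simp
      finally show "(\<integral>x. (indicator (Bk k) x * h k j x) * indicator (Q k) x \<partial>M) = prob (Q k \<inter> R j \<inter> Bk k)" .
    qed
    also have "\<dots> = prob (\<Union>k\<in>K. Q k \<inter> R j \<inter> Bk k)"
    proof (rule finite_measure_finite_Union[symmetric, OF fin(1)])
      show "disjoint_family_on (\<lambda>k. Q k \<inter> R j \<inter> Bk k) K"
        by (auto simp: disjoint_family_on_def Q_def)
    qed auto
    also have "(\<Union>k\<in>K. Q k \<inter> R j \<inter> Bk k) = R j \<inter> B"
      by (auto simp: Q_def R_def Bk_def B K_def)
    finally show "(\<integral>x. indicator B x * g j x \<partial>M) = prob (R j \<inter> B)" .
  qed
  have etah: "integrable M (\<lambda>x. eta (h k j x) * indicator A x)" if "A \<in> events" for k j A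
    by (rule integrable_bounded[where B="1 / ln 2"])
      (use that in \<open>auto simp: indicator_def abs_of_nonneg eta_nonneg eta_le h01\<close>)
  have etahp: "integrable M (\<lambda>x. eta (h k j x) * cprob M F (Q k) x)" for k j
  proof (rule integrable_bounded[where B="1 / ln 2"])
    show "\<bar>eta (h k j x) * cprob M F (Q k) x\<bar> \<le> 1 / ln 2" for x
      using mult_mono[OF eta_le[OF h01] cprob_bounds(2)] by (simp add: abs_of_nonneg eta_nonneg h01)
  qed measurable
  have gQ: "eta (g j x) = (\<Sum>k\<in>K. eta (h k j x) * indicator (Q k) x)" if x: "x \<in> space M" for j x
  proof -
    have *: "(\<Sum>k\<in>K. (if k = q x then f k else 0)) = (f (q x) :: real)" for f
      using x fin by (simp add: K_def)
    have "indicator (Q k) x = (if k = q x then 1 else (0::real))" for k using x by (auto simp: Q_def)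
    then show ?thesis by (simp add: g_def if_distrib[of "\<lambda>c. c * _"] if_distrib[of "\<lambda>c. _ * c"] * cong: if_cong)
  qed
  have "centropy M G r = (\<Sum>j\<in>J. \<integral>x. eta (g j x) \<partial>M)"
    unfolding centropy_def J_def[symmetric] R_def[symmetric]
  proof (intro sum.cong refl integral_cong_AE)
    fix j assume "j \<in> J"
    from cG[OF this] show "AE x in M. eta (cprob M G (R j) x) = eta (g j x)"
      by eventually_elim simp
  qed (use cprob_measurable'[OF G] in auto)
  also have "\<dots> = (\<Sum>j\<in>J. \<integral>x. (\<Sum>k\<in>K. eta (h k j x) * indicator (Q k) x) \<partial>M)"
    by (intro sum.cong refl Bochner_Integration.integral_cong gQ)
  also have "\<dots> = (\<Sum>j\<in>J. \<Sum>k\<in>K. \<integral>x. eta (h k j x) * indicator (Q k) x \<partial>M)"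
    by (intro sum.cong refl Bochner_Integration.integral_sum etah Q)
  also have "\<dots> = (\<Sum>j\<in>J. \<Sum>k\<in>K. \<integral>x. eta (h k j x) * cprob M F (Q k) x \<partial>M)"
    by (intro sum.cong refl cprob_integral_bounded[OF F Q, symmetric, where B="1 / ln 2"]
        measurable_compose[OF hF] eta_measurable) (simp add: abs_of_nonneg eta_nonneg eta_le h01)
  also have "\<dots> = (\<Sum>k\<in>K. \<integral>x. (\<Sum>j\<in>J. eta (h k j x) * cprob M F (Q k) x) \<partial>M)"
    by (subst sum.swap) (simp add: etahp)
  also have "\<dots> = (\<Sum>k\<in>K. \<integral>x. (\<Sum>j\<in>J. eta (cprob M F (Q k \<inter> R j) x)) - eta (cprob M F (Q k) x) \<partial>M)"
  proof (intro sum.cong refl integral_cong_AE)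
    fix k
    show "AE x in M. (\<Sum>j\<in>J. eta (h k j x) * cprob M F (Q k) x)
       = (\<Sum>j\<in>J. eta (cprob M F (Q k \<inter> R j) x)) - eta (cprob M F (Q k) x)"
      using add[of k] hp[of k]
    proof eventually_elim
      case (elim x)
      define p where "p = cprob M F (Q k) x"
      show ?case
      proof (cases "p = 0")
        case True
        then have "cprob M F (Q k \<inter> R j) x = 0" if "j \<in> J" for j
          using elim(2) that by (auto simp: p_def[symmetric])
        then show ?thesis using True by (simp add: p_def)
      next
        case False
        then have p: "p > 0" using cprob_bounds(1)[of M F "Q k" x] unfolding p_def by (simp add: less_le)
        \<comment> \<open>The product rule eta(h p) = p eta(h) + h eta(p).\<close>
        have *: "eta (h k j x) * p = eta (h k j x * p) + h k j x * p * log 2 p" for j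
          using p h01(1)[of k j x] by (cases "h k j x = 0") (simp_all add: eta_def log_mult algebra_simps)
        have s: "(\<Sum>j\<in>J. h k j x * p) = p"
          using elim by (simp add: p_def)
        have "(\<Sum>j\<in>J. eta (h k j x) * p) = (\<Sum>j\<in>J. eta (h k j x * p)) + (\<Sum>j\<in>J. h k j x * p) * log 2 p"
          by (simp only: * sum.distrib sum_distrib_right)
        also have "\<dots> = (\<Sum>j\<in>J. eta (h k j x * p)) - eta p" unfolding s by (simp add: eta_def)
        finally show ?thesis using elim(2) by (simp add: p_def)
      qed
    qed
  qed measurable
  also have "\<dots> = (\<Sum>k\<in>K. (\<Sum>j\<in>J. \<integral>x. eta (cprob M F (Q k \<inter> R j) x) \<partial>M)) - centropy M F q"
    by (simp add: integrable_eta_cprob[OF F] sum_subtractf centropy_def Q_def K_def)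
  finally show ?thesis
    by (simp add: F_def G_def Q_def R_def K_def J_def Int_assoc Int_left_commute)
qed

text \<open>Both sides are the conditional mutual information of two finite-valued variables.\<close>

lemma centropy_diff_sym:
  fixes q :: "'a \<Rightarrow> 'k" and r :: "'a \<Rightarrow> 'j"
  assumes W: "W \<in> measurable M S"
    and q: "q \<in> measurable M (count_space UNIV)" "finite (q ` space M)"
    and r: "r \<in> measurable M (count_space UNIV)" "finite (r ` space M)"
  shows "centropy M (gen_alg M S W) q - centropy M (gen_alg M (count_space UNIV \<Otimes>\<^sub>M S) (\<lambda>x. (r x, W x))) q
     = centropy M (gen_alg M S W) r - centropy M (gen_alg M (count_space UNIV \<Otimes>\<^sub>M S) (\<lambda>x. (q x, W x))) r"
  using centropy_chain[OF assms] centropy_chain[OF W r q]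
    sum.swap[of "\<lambda>k j. \<integral>x. eta (cprob M (gen_alg M S W) (q -` {k} \<inter> r -` {j} \<inter> space M) x) \<partial>M" "r ` space M" "q ` space M"]
  by (simp add: Int_commute[of "r -` _"])

lemma expectation_eta_const:
  assumes Q: "Q \<in> events" and W: "W \<in> measurable M S"
    and c: "\<And>x. x \<in> space M \<Longrightarrow> W x = c"
  shows "(\<integral>x. eta (cprob M (gen_alg M S W) Q x) \<partial>M) = eta (prob Q)"
proof -
  note F = subalgebra_gen_alg[OF W]
  have "AE x in M. cprob M (gen_alg M S W) Q x = prob Q"
  proof (rule cprob_charact[OF F Q])
    fix B assume "B \<in> sets (gen_alg M S W)"
    then obtain C where "B = W -` C \<inter> space M" unfolding sets_gen_alg[OF W] by auto
    then consider "B = {}" | "B = space M" using c by (cases "c \<in> C") auto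
    then show "(\<integral>x. indicator B x * prob Q \<partial>M) = prob (Q \<inter> B)"
    proof cases
      case 2
      have "Q \<inter> B = Q" using 2 sets.sets_into_space[OF Q] by auto
      then show ?thesis using 2 by (simp add: prob_space)
    qed simp
  qed auto
  then have "(\<integral>x. eta (cprob M (gen_alg M S W) Q x) \<partial>M) = (\<integral>x. eta (prob Q) \<partial>M)"
    using cprob_measurable'[OF F] by (intro integral_cong_AE) auto
  then show ?thesis by (simp add: prob_space)
qed

lemma centropy_const:
  assumes q: "q \<in> measurable M (count_space UNIV)" and W: "W \<in> measurable M S"
    and c: "\<And>x. x \<in> space M \<Longrightarrow> W x = c"
  shows "centropy M (gen_alg M S W) q = (\<Sum>k\<in>q ` space M. eta (prob (q -` {k} \<inter> space M)))"
  unfolding centropy_def by (intro sum.cong refl expectation_eta_const[OF measurable_sets[OF q] W c]) auto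

lemma centropy_cong_AE:
  assumes "subalgebra M F" "subalgebra M G"
    and "\<And>k. k \<in> q ` space M \<Longrightarrow> AE x in M. cprob M F (q -` {k} \<inter> space M) x = cprob M G (q -` {k} \<inter> space M) x"
  shows "centropy M F q = centropy M G q"
  unfolding centropy_def
proof (intro sum.cong refl integral_cong_AE)
  fix k assume "k \<in> q ` space M"
  from assms(3)[OF this]
  show "AE x in M. eta (cprob M F (q -` {k} \<inter> space M) x) = eta (cprob M G (q -` {k} \<inter> space M) x)"
    by eventually_elim simp
qed (use assms cprob_measurable'[of M] in auto)

text \<open>The tangent of \<open>eta\<close> is taken at a guess distribution, half of it a point
  mass at the decoded value and half uniform on K. Minus its logarithm at the true value is at most
  1 if the decoder is right and at most 1 + log N otherwise; the additive 1 takes the place of the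
  usual binary entropy.\<close>

lemma fano:
  fixes q :: "'a \<Rightarrow> 'k"
  assumes F: "subalgebra M F" and q: "q \<in> measurable M (count_space UNIV)"
    and K: "finite K" "q ` space M \<subseteq> K" "card K = N"
    and d: "d \<in> measurable F (count_space UNIV)"
  shows "centropy M F q \<le> 1 + prob {x\<in>space M. d x \<noteq> q x} * log 2 N"
proof -
  have "space M \<noteq> {}" by (rule not_empty)
  then have N: "N \<ge> 1" using K by (auto simp: Suc_le_eq card_gt_0_iff)
  define h where "h k x = (1/2) * indicator (d -` {k} \<inter> space M) x + 1 / (2 * real N)" for k x
  have spF: "space F = space M" using F by (simp add: subalgebra_def)
  have dM [measurable]: "d \<in> measurable M (count_space UNIV)" by (rule measurable_from_subalg[OF F d])
  note q [measurable]
  have dk: "d -` {k} \<inter> space M \<in> sets F" for k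
    using measurable_sets[OF d, of "{k}"] by (simp add: spF)
  have hF: "(\<lambda>x. log 2 (h k x)) \<in> borel_measurable F" for k
    unfolding h_def using dk by measurable
  have dkM [measurable]: "d -` {k} \<inter> space M \<in> events" for k
    by measurable
  have hM [measurable]: "h k \<in> borel_measurable M" for k
    unfolding h_def[abs_def] using dkM by measurable
  have hpos: "1 / (2 * real N) \<le> h k x" "0 < h k x" "h k x \<le> 1" for k x
    using N by (auto simp: h_def indicator_def divide_simps)
  have lb: "\<bar>log 2 (h k x)\<bar> \<le> - log 2 (1 / (2 * real N))" for k x
  proof -
    have "log 2 (1 / (2 * real N)) \<le> log 2 (h k x)" "log 2 (h k x) \<le> 0"
      using hpos[of k x] N by simp_all
    then show ?thesis by simp
  qed
  have [measurable]: "cprob M F A \<in> borel_measurable M" for A by (rule cprob_measurable'[OF F])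
  define Q where "Q k = q -` {k} \<inter> space M" for k
  have Q [measurable]: "Q k \<in> events" for k unfolding Q_def by measurable
  have ih: "integrable M (h k)" for k
    by (rule integrable_bounded[where B=1]) (use hpos in \<open>auto simp: abs_of_pos\<close>)
  have il: "integrable M (\<lambda>x. cprob M F (Q k) x * log 2 (h k x))" for k
  proof (rule integrable_bounded)
    show "\<bar>cprob M F (Q k) x * log 2 (h k x)\<bar> \<le> 1 * - log 2 (1 / (2 * real N))" for x
      unfolding abs_mult by (intro mult_mono lb) simp_all
  qed measurable
  have il2: "integrable M (\<lambda>x. log 2 (h k x) * indicator (Q k) x)" for k
  proof (rule integrable_bounded)
    show "\<bar>log 2 (h k x) * indicator (Q k) x\<bar> \<le> - log 2 (1 / (2 * real N)) * 1" for x
      unfolding abs_mult by (intro mult_mono lb order_trans[OF abs_ge_zero lb]) (auto simp: indicator_def)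
  qed measurable
  have Qun: "(\<Union>k\<in>K. Q k) = space M" using K by (auto simp: Q_def)
  have sumQ: "(\<Sum>k\<in>K. prob (Q k)) = 1"
    using finite_measure_finite_Union[OF K(1), of Q] Qun
    by (simp add: image_subset_iff disjoint_family_on_def Q_def[abs_def] prob_space)
       (auto simp: Q_def)
  define E where "E = {x\<in>space M. d x \<noteq> q x}"
  have "E = space M - (\<Union>k\<in>K. (d -` {k} \<inter> space M) \<inter> Q k)"
    using K by (auto simp: E_def Q_def)
  moreover have "(\<Union>k\<in>K. (d -` {k} \<inter> space M) \<inter> Q k) \<in> events"
    by (rule sets.finite_UN[OF K(1)], rule sets.Int[OF dkM Q])
  ultimately have E [measurable]: "E \<in> events" by auto
  have l0: "0 \<le> log 2 (real N)" using N by simp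
  \<comment> \<open>Only an inequality: the decoder may return a value outside K, and then half of
    the mass is lost.\<close>
  have sumh: "(\<Sum>k\<in>K. h k x) \<le> 1" for x
  proof -
    have "(\<Sum>k\<in>K. indicat_real (d -` {k} \<inter> space M) x) \<le> (\<Sum>k\<in>K. if k = d x then 1 else 0)"
      by (intro sum_mono) (auto simp: indicator_def)
    also have "\<dots> \<le> 1" using K by simp
    finally show ?thesis
      using N K by (simp add: h_def sum.distrib flip: sum_divide_distrib)
  qed
  have "centropy M F q = (\<Sum>k\<in>K. \<integral>x. eta (cprob M F (Q k) x) \<partial>M)"
    unfolding Q_def by (rule centropy_superset[OF F K(1,2)])
  also have "\<dots> \<le> (\<Sum>k\<in>K. \<integral>x. - (cprob M F (Q k) x * log 2 (h k x)) + (h k x - cprob M F (Q k) x) / ln 2 \<partial>M)"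
    by (intro sum_mono integral_mono integrable_eta_cprob F Bochner_Integration.integrable_add
        Bochner_Integration.integrable_minus il integrable_divide Bochner_Integration.integrable_diff
        integrable_cprob ih eta_tangent hpos cprob_bounds)
  also have "\<dots> = (\<Sum>k\<in>K. - (\<integral>x. cprob M F (Q k) x * log 2 (h k x) \<partial>M) + ((\<integral>x. h k x \<partial>M) - prob (Q k)) / ln 2)"
    by (simp add: il ih integrable_cprob[OF F] expectation_cprob[OF F Q])
  also have "\<dots> = - (\<Sum>k\<in>K. \<integral>x. cprob M F (Q k) x * log 2 (h k x) \<partial>M) + ((\<integral>x. (\<Sum>k\<in>K. h k x) \<partial>M) - 1) / ln 2"
    by (simp add: sum.distrib sum_negf ih) (simp add: sum_subtractf sumQ flip: sum_divide_distrib)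
  also have "\<dots> \<le> - (\<Sum>k\<in>K. \<integral>x. cprob M F (Q k) x * log 2 (h k x) \<partial>M)"
  proof -
    have "(\<integral>x. (\<Sum>k\<in>K. h k x) \<partial>M) \<le> (\<integral>x. 1 \<partial>M)"
      by (intro integral_mono sumh) (simp_all add: ih)
    then show ?thesis by (simp add: prob_space divide_nonpos_pos)
  qed
  also have "\<dots> = (\<Sum>k\<in>K. \<integral>x. - (log 2 (h k x) * indicator (Q k) x) \<partial>M)"
    using cprob_integral_bounded[OF F Q hF lb] by (simp add: mult.commute sum_negf)
  also have "\<dots> = (\<integral>x. (\<Sum>k\<in>K. - (log 2 (h k x) * indicator (Q k) x)) \<partial>M)"
    using il2 by (subst Bochner_Integration.integral_sum) auto
  also have "\<dots> \<le> (\<integral>x. 1 + indicator E x * log 2 N \<partial>M)"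
  proof (rule integral_mono)
    fix x assume x: "x \<in> space M"
    have "(\<Sum>k\<in>K. - (log 2 (h k x) * indicator (Q k) x)) = (\<Sum>k\<in>K. if k = q x then - log 2 (h k x) else 0)"
      using x by (intro sum.cong) (auto simp: Q_def)
    also have "\<dots> = - log 2 (h (q x) x)" using K x by (simp add: image_subset_iff)
    also have "\<dots> \<le> 1 + indicator E x * log 2 N"
    proof (cases "d x = q x")
      case True
      then have "1 / 2 \<le> h (q x) x" using x by (simp add: h_def)
      then have "log 2 (1/2) \<le> log 2 (h (q x) x)" by simp
      then show ?thesis using True by (simp add: log_divide E_def)
    next
      case False
      have "log 2 (1 / (2 * real N)) \<le> log 2 (h (q x) x)" using hpos[of "q x" x] N by simp
      then show ?thesis using False x N by (simp add: log_divide log_mult E_def)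
    qed
    finally show "(\<Sum>k\<in>K. - (log 2 (h k x) * indicator (Q k) x)) \<le> 1 + indicator E x * log 2 N" .
  next
    show "integrable M (\<lambda>x. 1 + indicator E x * log 2 (real N))"
      by (intro integrable_bounded[where B="1 + log 2 N"]) (use l0 in \<open>auto simp: indicator_def\<close>)
  qed (use il2 in auto)
  also have "\<dots> = 1 + prob E * log 2 N"
    by (subst Bochner_Integration.integral_add) (auto simp: prob_space emeasure_finite less_top[symmetric])
  finally show ?thesis by (simp add: E_def)
qed

end

subsection \<open>Mutual information as a difference of conditional entropies\<close>

context prob_space
begin

text \<open>The conditional probability of A as a function of the value of W. It is the
  Radon-Nikodym derivative of the image of the measure restricted to A with respect to the law of W,
  and so exists for every measurable space S.\<close>

lemma cprob_factor:
  assumes W: "W \<in> measurable M S" and A: "A \<in> events"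
  obtains c where "c \<in> borel_measurable S" "\<And>y. 0 \<le> c y" "\<And>y. c y \<le> 1"
    "AE x in M. cprob M (gen_alg M S W) A x = c (W x)"
    "\<And>B. B \<in> sets S \<Longrightarrow> (\<integral>y. indicator B y * c y \<partial>distr M S W) = prob (A \<inter> (W -` B \<inter> space M))"
proof -
  interpret D: prob_space "distr M S W" by (rule prob_space_distr[OF W])
  define N where "N = distr (density M (indicator A)) S W"
  have W': "W \<in> measurable (density M (indicator A)) S" using W by simp
  have N: "emeasure N B = prob (A \<inter> (W -` B \<inter> space M))" if "B \<in> sets S" for B
  proof -
    have WB: "W -` B \<inter> space M \<in> events" by (rule measurable_sets[OF W that])
    have "emeasure N B = emeasure (density M (indicator A)) (W -` B \<inter> space M)"
      unfolding N_def using emeasure_distr[OF W' that] by simp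
    also have "\<dots> = (\<integral>\<^sup>+x. indicator A x * indicator (W -` B \<inter> space M) x \<partial>M)"
      by (rule emeasure_density) (use A WB in auto)
    also have "\<dots> = (\<integral>\<^sup>+x. indicator (A \<inter> (W -` B \<inter> space M)) x \<partial>M)"
      by (intro nn_integral_cong) (auto simp: indicator_def)
    also have "\<dots> = prob (A \<inter> (W -` B \<inter> space M))"
      using A WB by (subst nn_integral_indicator) (auto simp: emeasure_eq_measure)
    finally show ?thesis .
  qed
  have ac: "absolutely_continuous (distr M S W) N"
    unfolding absolutely_continuous_def
  proof
    fix B assume "B \<in> null_sets (distr M S W)"
    then have B: "B \<in> sets S" "prob (W -` B \<inter> space M) = 0"
      using W by (auto simp: null_sets_def emeasure_distr emeasure_eq_measure)
    then have "prob (A \<inter> (W -` B \<inter> space M)) \<le> 0"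
      using finite_measure_mono[of "A \<inter> (W -` B \<inter> space M)" "W -` B \<inter> space M"] measurable_sets[OF W B(1)] by auto
    then show "B \<in> null_sets N" using B N[OF B(1)] by (simp add: null_sets_def N_def measure_le_0_iff)
  qed
  have setsN: "sets N = sets (distr M S W)" by (simp add: N_def)
  define c0 where "c0 y = enn2real (RN_deriv (distr M S W) N y)" for y
  have c0m: "c0 \<in> borel_measurable S" unfolding c0_def[abs_def] by measurable
  note c0m [measurable]
  have finN: "finite_measure N"
    by (rule finite_measureI) (use N[OF sets.top] in \<open>simp add: N_def\<close>)
  then interpret N: finite_measure N .
  have RN: "density (distr M S W) (RN_deriv (distr M S W) N) = N"
    by (rule D.density_RN_deriv[OF ac setsN])
  have fin: "AE y in distr M S W. RN_deriv (distr M S W) N y \<noteq> \<infinity>"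
    by (rule D.RN_deriv_finite[OF _ ac setsN]) unfold_locales
  have RN0: "density (distr M S W) (\<lambda>y. ennreal (c0 y)) = N"
  proof -
    have "density (distr M S W) (\<lambda>y. ennreal (c0 y)) = density (distr M S W) (RN_deriv (distr M S W) N)"
    proof (rule density_cong)
      show "AE y in distr M S W. ennreal (c0 y) = RN_deriv (distr M S W) N y"
        using fin by eventually_elim (simp add: c0_def less_top)
    qed simp_all
    then show ?thesis using RN by simp
  qed
  have int0: "(\<integral>\<^sup>+y. ennreal (c0 y) * indicator B y \<partial>distr M S W) = prob (A \<inter> (W -` B \<inter> space M))" if B: "B \<in> sets S" for B
    using N[OF B] B unfolding RN0[symmetric] by (simp add: emeasure_density)
  have c0i: "integrable (distr M S W) c0"
  proof (rule integrableI_nonneg)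
    show "AE y in distr M S W. 0 \<le> c0 y" by (simp add: c0_def)
    have "(\<integral>\<^sup>+y. ennreal (c0 y) \<partial>distr M S W) = (\<integral>\<^sup>+y. ennreal (c0 y) * indicator (space S) y \<partial>distr M S W)"
      by (intro nn_integral_cong) simp
    then show "(\<integral>\<^sup>+y. ennreal (c0 y) \<partial>distr M S W) < \<infinity>" using int0[OF sets.top] by simp
  qed simp
  have c0B: "(\<integral>y. indicator B y * c0 y \<partial>distr M S W) = prob (A \<inter> (W -` B \<inter> space M))" if B: "B \<in> sets S" for B
  proof -
    have "(\<integral>y. indicator B y * c0 y \<partial>distr M S W) = enn2real (\<integral>\<^sup>+y. ennreal (indicator B y * c0 y) \<partial>distr M S W)"
      by (rule integral_eq_nn_integral) (use B in \<open>auto simp: c0_def\<close>)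
    also have "(\<integral>\<^sup>+y. ennreal (indicator B y * c0 y) \<partial>distr M S W) = (\<integral>\<^sup>+y. ennreal (c0 y) * indicator B y \<partial>distr M S W)"
      by (intro nn_integral_cong) (auto simp: indicator_def)
    finally show ?thesis using int0[OF B] by simp
  qed
  note F = subalgebra_gen_alg[OF W]
  have ae: "AE x in M. cprob M (gen_alg M S W) A x = c0 (W x)"
  proof (rule cprob_charact[OF F A])
    show "(\<lambda>x. c0 (W x)) \<in> borel_measurable (gen_alg M S W)"
      by (rule measurable_compose[OF measurable_gen_alg[OF W] c0m])
    show "integrable M (\<lambda>x. c0 (W x))"
      using c0i W by (simp add: integrable_distr_eq)
    fix B assume "B \<in> sets (gen_alg M S W)"
    then obtain C where C: "C \<in> sets S" "B = W -` C \<inter> space M" unfolding sets_gen_alg[OF W] by auto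
    have "(\<integral>x. indicator B x * c0 (W x) \<partial>M) = (\<integral>x. indicator C (W x) * c0 (W x) \<partial>M)"
      by (intro Bochner_Integration.integral_cong) (auto simp: C indicator_def)
    also have "\<dots> = (\<integral>y. indicator C y * c0 y \<partial>distr M S W)"
      using C W by (subst integral_distr) auto
    finally show "(\<integral>x. indicator B x * c0 (W x) \<partial>M) = prob (A \<inter> B)"
      using c0B[OF C(1)] C by simp
  qed
  have le1: "AE y in distr M S W. c0 y \<le> 1"
  proof (subst AE_distr_iff[OF W])
    show "AE x in M. c0 (W x) \<le> 1"
      using ae by eventually_elim (metis cprob_bounds(2))
  qed simp
  show thesis
  proof (rule that[of "\<lambda>y. min 1 (c0 y)"])
    show "AE x in M. cprob M (gen_alg M S W) A x = min 1 (c0 (W x))"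
      using ae by eventually_elim (metis cprob_bounds(2) min.absorb2)
    fix B assume B: "B \<in> sets S"
    have "(\<integral>y. indicator B y * min 1 (c0 y) \<partial>distr M S W) = (\<integral>y. indicator B y * c0 y \<partial>distr M S W)"
    proof (rule integral_cong_AE)
      show "AE y in distr M S W. indicator B y * min 1 (c0 y) = indicator B y * c0 y"
        using le1 by eventually_elim simp
    qed (use B in auto)
    then show "(\<integral>y. indicator B y * min 1 (c0 y) \<partial>distr M S W) = prob (A \<inter> (W -` B \<inter> space M))"
      using c0B[OF B] by simp
  qed (auto simp: c0_def)
qed

text \<open>The library defines mutual information as the divergence of the joint law from the
  product law. For finite-valued q the joint law has the density P(q = k | W = y) / P(q = k), and
  its logarithm splits into the two entropies.\<close>

lemma mutual_information_eq:
  fixes q :: "'a \<Rightarrow> 'k" and S :: "'s measure"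
  assumes q: "q \<in> measurable M (count_space UNIV)" "finite (q ` space M)"
    and W: "W \<in> measurable M S"
  shows "mutual_information 2 (count_space UNIV) S q W
    = (\<Sum>k\<in>q ` space M. eta (prob (q -` {k} \<inter> space M))) - centropy M (gen_alg M S W) q"
proof -
  define Q where "Q k = q -` {k} \<inter> space M" for k
  define K where "K = q ` space M"
  have finK: "finite K" using q by (simp add: K_def)
  have Q [measurable]: "Q k \<in> events" for k unfolding Q_def using q(1) by (rule measurable_sets) simp
  define F where "F = gen_alg M S W"
  have F: "subalgebra M F" unfolding F_def by (rule subalgebra_gen_alg[OF W])
  have "\<exists>c. c \<in> borel_measurable S \<and> (\<forall>y. 0 \<le> c y \<and> c y \<le> 1) \<and>
    (AE x in M. cprob M F (Q k) x = c (W x)) \<and>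
    (\<forall>B\<in>sets S. (\<integral>y. indicator B y * c y \<partial>distr M S W) = prob (Q k \<inter> (W -` B \<inter> space M)))" for k
    unfolding F_def by (rule cprob_factor[OF W Q[of k]]) blast
  then have "\<exists>c. \<forall>k. c k \<in> borel_measurable S \<and> (\<forall>y. 0 \<le> c k y \<and> c k y \<le> 1) \<and>
    (AE x in M. cprob M F (Q k) x = c k (W x)) \<and>
    (\<forall>B\<in>sets S. (\<integral>y. indicator B y * c k y \<partial>distr M S W) = prob (Q k \<inter> (W -` B \<inter> space M)))"
    by (intro choice allI)
  then obtain c where c [measurable]: "\<And>k. c k \<in> borel_measurable S"
    and c01: "\<And>k y. 0 \<le> c k y" "\<And>k y. c k y \<le> 1"
    and cW: "\<And>k. AE x in M. cprob M F (Q k) x = c k (W x)"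
    and cB: "\<And>k B. B \<in> sets S \<Longrightarrow> (\<integral>y. indicator B y * c k y \<partial>distr M S W) = prob (Q k \<inter> (W -` B \<inter> space M))"
    by blast
  let ?CS = "count_space (UNIV :: 'k set)"
  let ?DQ = "distr M ?CS q" and ?D = "distr M S W"
  interpret DQ: prob_space ?DQ by (rule prob_space_distr[OF q(1)])
  interpret D: prob_space ?D by (rule prob_space_distr[OF W])
  interpret P: pair_prob_space ?DQ ?D ..
  have qW [measurable]: "(\<lambda>x. (q x, W x)) \<in> measurable M (?CS \<Otimes>\<^sub>M S)" using q W by simp
  have decomp: "\<phi> (q x) = (\<Sum>k\<in>K. \<phi> k * indicator (Q k) x)" if "x \<in> space M" for \<phi> :: "'k \<Rightarrow> real" and x
  proof -
    have "(\<Sum>k\<in>K. \<phi> k * indicator (Q k) x) = (\<Sum>k\<in>K. if k = q x then \<phi> k else 0)"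
      using that by (intro sum.cong) (auto simp: Q_def indicator_def)
    also have "\<dots> = \<phi> (q x)" using that finK by (simp add: K_def)
    finally show ?thesis by simp
  qed
  have intDQ: "(\<integral>k. \<phi> k \<partial>?DQ) = (\<Sum>k\<in>K. \<phi> k * prob (Q k))" for \<phi> :: "'k \<Rightarrow> real"
  proof -
    have "(\<integral>k. \<phi> k \<partial>?DQ) = (\<integral>x. \<phi> (q x) \<partial>M)" by (rule integral_distr[OF q(1)]) simp
    also have "\<dots> = (\<integral>x. (\<Sum>k\<in>K. \<phi> k * indicator (Q k) x) \<partial>M)"
      by (intro Bochner_Integration.integral_cong refl decomp)
    also have "\<dots> = (\<Sum>k\<in>K. \<phi> k * prob (Q k))"
      by (subst Bochner_Integration.integral_sum) (auto simp: emeasure_finite less_top[symmetric])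
    finally show ?thesis .
  qed
  \<comment> \<open>A uniform bound for the density over the finitely many values of q; values of
    probability 0 contribute 1 / 0 = 0.\<close>
  define L where "L = (\<Sum>k\<in>K. 1 / prob (Q k))"
  define f where "f z = (if prob (Q (fst z)) > 0 \<and> fst z \<in> K then c (fst z) (snd z) / prob (Q (fst z)) else 0)" for z :: "'k \<times> 's"
  have fm [measurable]: "f \<in> borel_measurable (?CS \<Otimes>\<^sub>M S)"
  proof -
    have e: "f z = (\<Sum>k\<in>K. indicator ({k} \<times> space S) z * (if prob (Q k) > 0 then c k (snd z) / prob (Q k) else 0))" 
      if z: "z \<in> space (?CS \<Otimes>\<^sub>M S)" for z
    proof -
      have "(\<Sum>k\<in>K. indicator ({k} \<times> space S) z * (if prob (Q k) > 0 then c k (snd z) / prob (Q k) else 0))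
        = (\<Sum>k\<in>K. if k = fst z then (if prob (Q k) > 0 then c k (snd z) / prob (Q k) else 0) else 0)"
        using z by (intro sum.cong) (auto simp: space_pair_measure indicator_def)
      also have "\<dots> = f z" using finK by (auto simp: f_def)
      finally show ?thesis by simp
    qed
    have [measurable]: "{k} \<times> space S \<in> sets (?CS \<Otimes>\<^sub>M S)" for k by (intro pair_measureI) auto
    have "(\<lambda>z. \<Sum>k\<in>K. indicator ({k} \<times> space S) z * (if prob (Q k) > 0 then c k (snd z) / prob (Q k) else 0)) \<in> borel_measurable (?CS \<Otimes>\<^sub>M S)"
      by measurable
    then show ?thesis by (subst measurable_cong[OF e])
  qed
  have f0: "0 \<le> f z" for z by (simp add: f_def c01)
  have fL: "f z \<le> L" for z
  proof (cases "prob (Q (fst z)) > 0 \<and> fst z \<in> K")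
    case True
    then have "f z \<le> 1 / prob (Q (fst z))" by (simp add: f_def divide_right_mono c01)
    also have "\<dots> \<le> L" unfolding L_def by (rule member_le_sum) (use True finK in auto)
    finally show ?thesis .
  qed (auto simp: f_def L_def intro!: sum_nonneg)
  have sp: "sets (?DQ \<Otimes>\<^sub>M ?D) = sets (?CS \<Otimes>\<^sub>M S)" by (intro sets_pair_measure_cong) simp_all
  have intP: "(\<integral>z. \<phi> z \<partial>(?DQ \<Otimes>\<^sub>M ?D)) = (\<Sum>k\<in>K. (\<integral>y. \<phi> (k, y) \<partial>?D) * prob (Q k))"
    if \<phi>: "\<phi> \<in> borel_measurable (?CS \<Otimes>\<^sub>M S)" "\<And>z. \<bar>\<phi> z\<bar> \<le> B" for \<phi> :: "'k \<times> 's \<Rightarrow> real" and B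
  proof -
    have "integrable (?DQ \<Otimes>\<^sub>M ?D) \<phi>"
      by (rule P.integrable_const_bound[where B=B]) (use \<phi> in \<open>auto simp: measurable_cong_sets[OF sp refl]\<close>)
    from P.integral_fst'[OF this] show ?thesis by (simp add: intDQ)
  qed
  have joint: "distr M (?CS \<Otimes>\<^sub>M S) (\<lambda>x. (q x, W x)) = density (?DQ \<Otimes>\<^sub>M ?D) (\<lambda>z. ennreal (f z))"
  proof (rule measure_eqI)
    fix E assume "E \<in> sets (distr M (?CS \<Otimes>\<^sub>M S) (\<lambda>x. (q x, W x)))"
    then have E [measurable]: "E \<in> sets (?CS \<Otimes>\<^sub>M S)" by simp
    define Ek where "Ek k = W -` (Pair k -` E) \<inter> space M" for k
    have Pk: "Pair k -` E \<in> sets S" for k by (rule sets_Pair1[OF E])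
    have [measurable]: "Ek k \<in> events" for k unfolding Ek_def by (rule measurable_sets[OF W Pk])
    have "(\<lambda>x. (q x, W x)) -` E \<inter> space M = (\<Union>k\<in>K. Q k \<inter> Ek k)"
      by (auto simp: K_def Q_def Ek_def)
    moreover have "prob (\<Union>k\<in>K. Q k \<inter> Ek k) = (\<Sum>k\<in>K. prob (Q k \<inter> Ek k))"
    proof (rule finite_measure_finite_Union[OF finK])
      show "disjoint_family_on (\<lambda>k. Q k \<inter> Ek k) K" by (auto simp: disjoint_family_on_def Q_def)
    qed auto
    ultimately have 1: "emeasure (distr M (?CS \<Otimes>\<^sub>M S) (\<lambda>x. (q x, W x))) E = (\<Sum>k\<in>K. prob (Q k \<inter> Ek k))"
      by (simp add: emeasure_distr emeasure_eq_measure)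
    have "emeasure (density (?DQ \<Otimes>\<^sub>M ?D) (\<lambda>z. ennreal (f z))) E = (\<integral>\<^sup>+z. ennreal (f z) * indicator E z \<partial>(?DQ \<Otimes>\<^sub>M ?D))"
      using E by (intro emeasure_density) (auto simp: measurable_cong_sets[OF sp refl] sp)
    also have "\<dots> = (\<integral>\<^sup>+z. ennreal (f z * indicator E z) \<partial>(?DQ \<Otimes>\<^sub>M ?D))"
      by (intro nn_integral_cong) (auto simp: indicator_def)
    also have "\<dots> = ennreal (\<integral>z. f z * indicator E z \<partial>(?DQ \<Otimes>\<^sub>M ?D))"
      by (intro nn_integral_eq_integral P.integrable_const_bound[where B=L] AE_I2)
        (use f0 fL in \<open>auto simp: indicator_def measurable_cong_sets[OF sp refl] intro: order_trans[OF f0 fL]\<close>)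
    also have "(\<integral>z. f z * indicator E z \<partial>(?DQ \<Otimes>\<^sub>M ?D)) = (\<Sum>k\<in>K. (\<integral>y. f (k, y) * indicator E (k, y) \<partial>?D) * prob (Q k))"
    proof (rule intP)
      show "\<bar>f z * indicator E z\<bar> \<le> L" for z
        using f0[of z] fL[of z] by (auto simp: indicator_def)
    qed measurable
    also have "\<dots> = (\<Sum>k\<in>K. prob (Q k \<inter> Ek k))"
    proof (rule sum.cong[OF refl])
      fix k assume k: "k \<in> K"
      show "(\<integral>y. f (k, y) * indicator E (k, y) \<partial>?D) * prob (Q k) = prob (Q k \<inter> Ek k)"
      proof (cases "prob (Q k) > 0")
        case True
        have "(\<integral>y. f (k, y) * indicator E (k, y) \<partial>?D) = (\<integral>y. indicator (Pair k -` E) y * c k y / prob (Q k) \<partial>?D)"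
          by (intro Bochner_Integration.integral_cong) (use True k in \<open>auto simp: f_def indicator_def\<close>)
        also have "\<dots> = prob (Q k \<inter> Ek k) / prob (Q k)"
          using cB[OF Pk] by (simp add: Ek_def)
        finally show ?thesis using True by simp
      next
        case False
        then have 0: "prob (Q k) = 0" by (simp add: zero_less_measure_iff)
        moreover have "prob (Q k \<inter> Ek k) \<le> prob (Q k)" by (rule finite_measure_mono) auto
        ultimately show ?thesis by (simp add: measure_le_0_iff)
      qed
    qed
    finally show "emeasure (distr M (?CS \<Otimes>\<^sub>M S) (\<lambda>x. (q x, W x))) E = emeasure (density (?DQ \<Otimes>\<^sub>M ?D) (\<lambda>z. ennreal (f z))) E"
      using 1 by simp
  qed (simp add: sp)
  \<comment> \<open>The integral over the product is split only for bounded functions: here the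
    lower bound comes from the tangent at 1, the upper one from ln f <= f <= L.\<close>
  have "\<exists>B. \<forall>z. \<bar>f z * log 2 (f z)\<bar> \<le> B"
  proof (intro exI allI)
    fix z
    have L0: "L \<ge> 0" using order_trans[OF f0 fL] .
    have "- (f z * log 2 (f z)) \<le> 1 / ln 2"
    proof -
      have "0 \<le> f z / ln 2" using f0 by simp
      then show ?thesis using eta_tangent[OF f0, of 1 z] by (simp add: eta_def diff_divide_distrib)
    qed
    moreover have "f z * log 2 (f z) \<le> L * (L / ln 2)"
    proof (cases "f z = 0")
      case False
      then have p: "f z > 0" using f0[of z] by simp
      have "ln (f z) \<le> f z" using ln_le_minus_one[OF p] by simp
      then have "log 2 (f z) \<le> L / ln 2" using fL[of z] by (simp add: log_def divide_right_mono)
      then have "f z * log 2 (f z) \<le> f z * (L / ln 2)" using p by (intro mult_left_mono) auto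
      also have "\<dots> \<le> L * (L / ln 2)" using fL[of z] L0 by (intro mult_right_mono) auto
      finally show ?thesis .
    qed (use L0 in simp)
    moreover have "0 \<le> L * (L / ln 2)" "(0::real) \<le> 1 / ln 2" using L0 by auto
    ultimately show "\<bar>f z * log 2 (f z)\<bar> \<le> L * (L / ln 2) + 1 / ln 2"
      by linarith
  qed
  then obtain B where B: "\<And>z. \<bar>f z * log 2 (f z)\<bar> \<le> B" by blast
  have "mutual_information 2 ?CS S q W = (\<integral>z. f z * log 2 (f z) \<partial>(?DQ \<Otimes>\<^sub>M ?D))"
    unfolding mutual_information_def joint
    by (rule P.KL_density) (auto simp: measurable_cong_sets[OF sp refl] f0)
  also have "\<dots> = (\<Sum>k\<in>K. (\<integral>y. f (k, y) * log 2 (f (k, y)) \<partial>?D) * prob (Q k))"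
    by (rule intP[OF _ B]) measurable
  also have "\<dots> = (\<Sum>k\<in>K. eta (prob (Q k)) - (\<integral>x. eta (cprob M F (Q k) x) \<partial>M))"
  proof (rule sum.cong[OF refl])
    fix k assume k: "k \<in> K"
    define p where "p = prob (Q k)"
    have ie: "integrable ?D (\<lambda>y. eta (c k y))"
      by (rule D.integrable_const_bound[where B="1 / ln 2"]) (auto simp: c01 eta_nonneg eta_le abs_of_nonneg)
    have ic: "integrable ?D (c k)"
      by (rule D.integrable_const_bound[where B="1"]) (auto simp: c01 abs_of_nonneg)
    have "(\<integral>y. c k y \<partial>?D) = (\<integral>y. indicator (space S) y * c k y \<partial>?D)"
      by (intro Bochner_Integration.integral_cong) auto
    also have "\<dots> = prob (Q k \<inter> (W -` space S \<inter> space M))" by (rule cB) simp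
    also have "Q k \<inter> (W -` space S \<inter> space M) = Q k" using measurable_space[OF W] by (auto simp: Q_def)
    finally have cp: "(\<integral>y. c k y \<partial>?D) = p" by (simp add: p_def)
    have cpe: "(\<integral>x. eta (cprob M F (Q k) x) \<partial>M) = (\<integral>y. eta (c k y) \<partial>?D)"
    proof -
      have "(\<integral>x. eta (cprob M F (Q k) x) \<partial>M) = (\<integral>x. eta (c k (W x)) \<partial>M)"
      proof (rule integral_cong_AE)
        show "AE x in M. eta (cprob M F (Q k) x) = eta (c k (W x))"
          using cW[of k] by eventually_elim simp
      qed (use W cprob_measurable'[OF F] in auto)
      also have "\<dots> = (\<integral>y. eta (c k y) \<partial>?D)" using W by (subst integral_distr) auto
      finally show ?thesis .
    qed
    show "(\<integral>y. f (k, y) * log 2 (f (k, y)) \<partial>?D) * prob (Q k) = eta (prob (Q k)) - (\<integral>x. eta (cprob M F (Q k) x) \<partial>M)"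
    proof (cases "p > 0")
      case True
      have "(\<integral>y. f (k, y) * log 2 (f (k, y)) \<partial>?D) = (\<integral>y. (- eta (c k y) - log 2 p * c k y) / p \<partial>?D)"
      proof (intro Bochner_Integration.integral_cong refl)
        fix y
        show "f (k, y) * log 2 (f (k, y)) = (- eta (c k y) - log 2 p * c k y) / p"
          using True k c01(1)[of k y] unfolding f_def p_def[symmetric] fst_conv snd_conv
          by (cases "c k y = 0") (auto simp: eta_def log_divide field_simps)
      qed
      also have "\<dots> = (- (\<integral>y. eta (c k y) \<partial>?D) - log 2 p * p) / p"
        using ie ic cp by simp
      finally show ?thesis using True unfolding cpe p_def[symmetric] by (simp add: eta_def mult.commute)
    next
      case False
      then have p0: "p = 0" by (simp add: p_def zero_less_measure_iff)
      have "AE y in ?D. c k y = 0"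
        using integral_nonneg_eq_0_iff_AE[OF ic] c01 cp p0 by simp
      have "(\<integral>y. eta (c k y) \<partial>?D) = (\<integral>y. 0 \<partial>?D)"
      proof (rule integral_cong_AE)
        show "AE y in ?D. eta (c k y) = 0"
          using \<open>AE y in ?D. c k y = 0\<close> by eventually_elim simp
      qed auto
      then show ?thesis using p0 unfolding cpe p_def[symmetric] by simp
    qed
  qed
  finally show ?thesis by (simp add: sum_subtractf centropy_def Q_def K_def F_def)
qed

lemma conditional_mutual_information_eq:
  fixes q :: "'a \<Rightarrow> 'k"
  assumes q: "q \<in> measurable M (count_space UNIV)" "finite (q ` space M)"
    and W: "W \<in> measurable M S" and r: "r \<in> measurable M T"
  shows "conditional_mutual_information 2 (count_space UNIV) T S q r W
    = centropy M (gen_alg M S W) q - centropy M (gen_alg M (T \<Otimes>\<^sub>M S) (\<lambda>x. (r x, W x))) q"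
  unfolding conditional_mutual_information_def
  using mutual_information_eq[OF q W] mutual_information_eq[OF q, of "\<lambda>x. (r x, W x)" "T \<Otimes>\<^sub>M S"] W r
  by simp

end

subsection \<open>Finite quantizations suffice\<close>

context prob_space
begin

text \<open>Induction from rectangles: a rectangle is reached exactly by the indicator quantizer of
  its first side, a complement keeps the quantizer, and a countable union needs only finitely many
  of its parts up to small probability.\<close>

lemma quantized_set_approx:
  assumes V: "V \<in> measurable M SV" and W: "W \<in> measurable M SW"
    and A: "A \<in> sets (gen_alg M (SV \<Otimes>\<^sub>M SW) (\<lambda>x. (V x, W x)))" and e: "(e::real) > 0"
  shows "\<exists>r B. quantizer SV r \<and>
    B \<in> sets (gen_alg M (count_space UNIV \<Otimes>\<^sub>M SW) (\<lambda>x. (r (V x), W x))) \<and> prob ((A - B) \<union> (B - A)) < e"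
proof -
  let ?VW = "\<lambda>x. (V x, W x)"
  define G where "G r = gen_alg M (count_space UNIV \<Otimes>\<^sub>M SW) (\<lambda>x. (r (V x), W x))" for r :: "_ \<Rightarrow> nat"
  have VW [measurable]: "?VW \<in> measurable M (SV \<Otimes>\<^sub>M SW)" using V W by simp
  have rVW: "(\<lambda>x. (r (V x), W x)) \<in> measurable M (count_space UNIV \<Otimes>\<^sub>M SW)" if "quantizer SV r" for r :: "_ \<Rightarrow> nat"
    using measurable_compose[OF V quantizer_measurable[OF that]] W by simp
  have Gsub: "subalgebra M (G r)" if "quantizer SV r" for r
    unfolding G_def by (rule subalgebra_gen_alg[OF rVW[OF that]])
  have GM: "B \<in> events" if "quantizer SV r" "B \<in> sets (G r)" for r B
    using Gsub[OF that(1)] that(2) by (auto simp: subalgebra_def)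
  obtain C where C: "C \<in> sets (SV \<Otimes>\<^sub>M SW)" and A: "A = ?VW -` C \<inter> space M"
    using A unfolding sets_gen_alg[OF VW] by auto
  have "\<forall>e>0. \<exists>r B. quantizer SV r \<and> B \<in> sets (G r) \<and>
      prob ((?VW -` C \<inter> space M - B) \<union> (B - (?VW -` C \<inter> space M))) < e"
    using Int_stable_pair_measure_generator[of SV SW] pair_measure_closed[of SV SW] C[unfolded sets_pair_measure]
  proof (induction rule: sigma_sets_induct_disjoint)
    case (basic C)
    then obtain a b where ab: "C = a \<times> b" "a \<in> sets SV" "b \<in> sets SW" by auto
    define r where "r v = (if v \<in> a then 1 else 0 :: nat)" for v
    have r: "quantizer SV r"
    proof -
      have "r \<in> measurable SV (count_space UNIV)" unfolding r_def[abs_def] using ab(2) by measurable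
      moreover have "finite (r ` space SV)" by (rule finite_subset[of _ "{0, 1}"]) (auto simp: r_def)
      ultimately show ?thesis by (simp add: quantizer_def)
    qed
    have "?VW -` C \<inter> space M = (\<lambda>x. (r (V x), W x)) -` ({1} \<times> b) \<inter> space M"
      by (auto simp: ab r_def split: if_splits)
    moreover have "{1} \<times> b \<in> sets (count_space UNIV \<Otimes>\<^sub>M SW)" using ab by (intro pair_measureI) auto
    ultimately have "?VW -` C \<inter> space M \<in> sets (G r)"
      unfolding G_def sets_gen_alg[OF rVW[OF r]] by blast
    with r show ?case by (intro allI impI exI[of _ r] exI[of _ "?VW -` C \<inter> space M"]) auto
  next
    case empty
    have "quantizer SV (\<lambda>_. 0)" by (auto simp: quantizer_def intro: finite_subset[of _ "{0}"])
    then show ?case by (intro allI impI exI[of _ "\<lambda>_. 0"] exI[of _ "{}"]) auto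
  next
    case (compl C)
    show ?case
    proof (intro allI impI)
      fix e :: real assume "e > 0"
      with compl obtain r B where r: "quantizer SV r" and B: "B \<in> sets (G r)"
        and e: "prob ((?VW -` C \<inter> space M - B) \<union> (B - (?VW -` C \<inter> space M))) < e" by blast
      have sp: "?VW x \<in> space SV \<times> space SW" if "x \<in> space M" for x
        using measurable_space[OF VW that] by (simp add: space_pair_measure)
      have Bs: "B \<subseteq> space M" using sets.sets_into_space[OF B] by (simp add: G_def)
      have B': "space M - B \<in> sets (G r)" using sets.compl_sets[OF B] by (simp add: G_def)
      have "(?VW -` (space SV \<times> space SW - C) \<inter> space M - (space M - B)) \<union> ((space M - B) - (?VW -` (space SV \<times> space SW - C) \<inter> space M))
          = (?VW -` C \<inter> space M - B) \<union> (B - (?VW -` C \<inter> space M))"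
        using sp Bs by auto
      with e r B' show "\<exists>r B. quantizer SV r \<and> B \<in> sets (G r) \<and>
          prob ((?VW -` (space SV \<times> space SW - C) \<inter> space M - B) \<union> (B - (?VW -` (space SV \<times> space SW - C) \<inter> space M))) < e"
        by (intro exI[of _ r] exI[of _ "space M - B"]) simp
    qed
  next
    case (union C)
    show ?case
    proof (intro allI impI)
      fix e :: real assume e: "e > 0"
      define A where "A i = ?VW -` C i \<inter> space M" for i
      have CS: "C i \<in> sets (SV \<Otimes>\<^sub>M SW)" for i
        using union(2) by (auto simp: sets_pair_measure)
      have A [measurable]: "A i \<in> events" for i
        unfolding A_def by (rule measurable_sets[OF VW CS])
      have AU: "?VW -` (\<Union>i. C i) \<inter> space M = (\<Union>i. A i)" by (auto simp: A_def)
      have "(\<lambda>n. prob (\<Union>i<n. A i)) \<longlonglongrightarrow> prob (\<Union>n. \<Union>i<n. A i)"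
        by (rule finite_Lim_measure_incseq) (auto simp: incseq_def intro: less_le_trans)
      moreover have "(\<Union>n. \<Union>i<n. A i) = (\<Union>i. A i)" by auto
      ultimately have "(\<lambda>n. prob (\<Union>i<n. A i)) \<longlonglongrightarrow> prob (\<Union>i. A i)" by simp
      then obtain n where n: "\<bar>prob (\<Union>i<n. A i) - prob (\<Union>i. A i)\<bar> < e / 2"
        using e half_gt_zero[OF e] unfolding LIMSEQ_def dist_real_def by blast
      \<comment> \<open>Half of e is left for the truncated tail, the other half is shared by n
        sets; n + 1 avoids dividing by zero.\<close>
      have e': "e / 2 / (real n + 1) > 0" using e by simp
      have "\<forall>i. \<exists>r B. quantizer SV r \<and> B \<in> sets (G r) \<and> prob ((A i - B) \<union> (B - A i)) < e / 2 / (real n + 1)"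
        using union(3) e' unfolding A_def by blast
      then have "\<exists>r. \<forall>i. \<exists>B. quantizer SV (r i) \<and> B \<in> sets (G (r i)) \<and> prob ((A i - B) \<union> (B - A i)) < e / 2 / (real n + 1)"
        by (rule choice)
      then obtain r where "\<forall>i. \<exists>B. quantizer SV (r i) \<and> B \<in> sets (G (r i)) \<and> prob ((A i - B) \<union> (B - A i)) < e / 2 / (real n + 1)" ..
      then have "\<exists>B. \<forall>i. quantizer SV (r i) \<and> B i \<in> sets (G (r i)) \<and> prob ((A i - B i) \<union> (B i - A i)) < e / 2 / (real n + 1)"
        by (rule choice)
      then obtain B where rB: "\<And>i. quantizer SV (r i)" "\<And>i. B i \<in> sets (G (r i))"
        "\<And>i. prob ((A i - B i) \<union> (B i - A i)) < e / 2 / (real n + 1)" by blast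
      obtain t \<phi> where t: "quantizer SV t" "\<And>i v. i \<in> {..<n} \<Longrightarrow> v \<in> space SV \<Longrightarrow> r i v = \<phi> i (t v)"
        using joint_quantizer[of "{..<n}" SV r] rB(1) by blast
      have Bt: "B i \<in> sets (G t)" if i: "i < n" for i
      proof -
        have "sets (G (r i)) \<subseteq> sets (G t)"
          unfolding G_def
        proof (rule gen_alg_mono[OF rVW[OF t(1)], where f="\<lambda>(k, w). (\<phi> i k, w)"])
          show "(\<lambda>(k, w). (\<phi> i k, w)) \<in> measurable (count_space UNIV \<Otimes>\<^sub>M SW) (count_space UNIV \<Otimes>\<^sub>M SW)"
            by measurable
          show "(r i (V x), W x) = (case (t (V x), W x) of (k, w) \<Rightarrow> (\<phi> i k, w))" if "x \<in> space M" for x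
            using t(2) i measurable_space[OF V that] by simp
        qed
        then show ?thesis using rB(2) by auto
      qed
      have BM [measurable]: "B i \<in> events" if "i < n" for i using GM[OF t(1) Bt[OF that]] .
      define U where "U = (\<Union>i<n. B i)"
      have UG: "U \<in> sets (G t)" unfolding U_def using Bt by auto
      have UM: "U \<in> events" by (rule GM[OF t(1) UG])
      define D where "D = (\<Union>i. A i) - (\<Union>i<n. A i)"
      have DM: "D \<in> events" unfolding D_def by (intro sets.Diff sets.countable_UN sets.finite_UN) auto
      have "prob D = prob (\<Union>i. A i) - prob (\<Union>i<n. A i)"
        unfolding D_def by (rule finite_measure_Diff) auto
      then have pD: "prob D < e / 2" using n by linarith
      have pS: "prob (\<Union>i<n. (A i - B i) \<union> (B i - A i)) \<le> (\<Sum>i<n. prob ((A i - B i) \<union> (B i - A i)))"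
        by (rule finite_measure_subadditive_finite) (auto intro!: sets.Un sets.Diff BM)
      also have "\<dots> \<le> (\<Sum>i<n. e / 2 / (real n + 1))"
        by (intro sum_mono less_imp_le rB(3))
      also have "\<dots> \<le> e / 2" using e by (simp add: field_simps)
      finally have pS: "prob (\<Union>i<n. (A i - B i) \<union> (B i - A i)) \<le> e / 2" .
      have "prob (((\<Union>i. A i) - U) \<union> (U - (\<Union>i. A i))) \<le> prob (D \<union> (\<Union>i<n. (A i - B i) \<union> (B i - A i)))"
        by (rule finite_measure_mono) (auto simp: D_def U_def intro!: DM sets.Un sets.finite_UN sets.Diff BM)
      also have "\<dots> \<le> prob D + prob (\<Union>i<n. (A i - B i) \<union> (B i - A i))"
        by (rule measure_Un_le) (auto intro!: DM sets.Un sets.finite_UN sets.Diff BM)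
      also have "\<dots> < e" using pD pS by linarith
      finally show "\<exists>r B. quantizer SV r \<and> B \<in> sets (G r) \<and>
          prob ((?VW -` (\<Union>i. C i) \<inter> space M - B) \<union> (B - (?VW -` (\<Union>i. C i) \<inter> space M))) < e"
        unfolding AU using t(1) UG by blast
    qed
  qed
  then show ?thesis using e unfolding G_def A by blast
qed

text \<open>Orthogonal projection: the difference u of the two F-measurable candidates has the same
  integral against both conditional probabilities, namely its integral over A, so the cross term in
  the expanded square vanishes.\<close>

lemma cprob_L2_le:
  assumes F: "subalgebra M F" and G: "subalgebra M G" and FG: "sets F \<subseteq> sets G" and A: "A \<in> events"
    and g: "g \<in> borel_measurable F" "\<And>x. 0 \<le> g x" "\<And>x. g x \<le> 1"
  shows "(\<integral>x. (cprob M G A x - cprob M F A x)\<^sup>2 \<partial>M) \<le> (\<integral>x. (cprob M G A x - g x)\<^sup>2 \<partial>M)"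
proof -
  define p c where "p = cprob M G A" and "c = cprob M F A"
  have pc: "0 \<le> p x" "p x \<le> 1" "0 \<le> c x" "c x \<le> 1" for x by (simp_all add: p_def c_def)
  have [measurable]: "p \<in> borel_measurable M" "c \<in> borel_measurable M"
    unfolding p_def c_def using cprob_measurable'[OF F] cprob_measurable'[OF G] by auto
  have gM [measurable]: "g \<in> borel_measurable M" by (rule measurable_from_subalg[OF F g(1)])
  have subGF: "subalgebra G F" using F G FG by (auto simp: subalgebra_def)
  have cF: "c \<in> borel_measurable F" by (simp add: c_def)
  define u where "u x = c x - g x" for x
  have uF: "u \<in> borel_measurable F" unfolding u_def[abs_def] using cF g by measurable
  have uG: "u \<in> borel_measurable G" by (rule measurable_from_subalg[OF subGF uF])
  have [measurable]: "u \<in> borel_measurable M" by (rule measurable_from_subalg[OF F uF])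
  have ub: "\<bar>u x\<bar> \<le> 1" for x using pc[of x] g(2,3)[of x] by (auto simp: u_def abs_le_iff)
  have b: "\<bar>a * b\<bar> \<le> 1" if "\<bar>a\<bar> \<le> 1" "\<bar>b\<bar> \<le> 1" for a b :: real
    using mult_mono[OF that] by (simp add: abs_mult)
  have i1: "integrable M (\<lambda>x. u x * p x)" "integrable M (\<lambda>x. u x * c x)"
    by (rule integrable_bounded[where B=1]; use b ub pc in simp)+
  have pcb: "\<bar>p x - c x\<bar> \<le> 1" for x using pc[of x] by (auto simp: abs_le_iff)
  have i2: "integrable M (\<lambda>x. (p x - c x)\<^sup>2)" "integrable M (\<lambda>x. (u x)\<^sup>2)"
    by (rule integrable_bounded[where B=1]; use ub pcb in \<open>simp add: abs_square_le_1\<close>)+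
  have "(\<integral>x. u x * p x \<partial>M) = (\<integral>x. u x * c x \<partial>M)"
    unfolding p_def c_def
    using cprob_integral_bounded[OF F A uF ub] cprob_integral_bounded[OF G A uG ub] by simp
  then have "(\<integral>x. (p x - c x)\<^sup>2 \<partial>M) \<le> (\<integral>x. (p x - c x)\<^sup>2 \<partial>M) + (\<integral>x. (u x)\<^sup>2 \<partial>M) + 2 * ((\<integral>x. u x * p x \<partial>M) - (\<integral>x. u x * c x \<partial>M))"
    by simp
  also have "\<dots> = (\<integral>x. (p x - c x)\<^sup>2 + (u x)\<^sup>2 + 2 * (u x * p x - u x * c x) \<partial>M)"
    using i1 i2 by simp
  also have "\<dots> = (\<integral>x. (p x - g x)\<^sup>2 \<partial>M)"
    by (intro Bochner_Integration.integral_cong refl) (simp add: u_def power2_eq_square algebra_simps)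
  finally show ?thesis unfolding p_def c_def .
qed

text \<open>The conditional probability p is within 1 / n of a staircase of n level sets. Each level
  set is nearly an event of a quantized algebra, one common refinement carries them all, and by the
  projection property the quantized conditional probability is at least as close to p as that
  staircase.\<close>

lemma quantized_cprob_approx:
  assumes V: "V \<in> measurable M SV" and W: "W \<in> measurable M SW" and A: "A \<in> events" and e: "(e::real) > 0"
  shows "\<exists>r. quantizer SV r \<and>
    (\<integral>x. (cprob M (gen_alg M (SV \<Otimes>\<^sub>M SW) (\<lambda>x. (V x, W x))) A x
         - cprob M (gen_alg M (count_space UNIV \<Otimes>\<^sub>M SW) (\<lambda>x. (r (V x), W x))) A x)\<^sup>2 \<partial>M) < e"
proof -
  let ?VW = "\<lambda>x. (V x, W x)"
  define H where "H = gen_alg M (SV \<Otimes>\<^sub>M SW) ?VW"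
  define G where "G r = gen_alg M (count_space UNIV \<Otimes>\<^sub>M SW) (\<lambda>x. (r (V x), W x))" for r :: "_ \<Rightarrow> nat"
  have VW [measurable]: "?VW \<in> measurable M (SV \<Otimes>\<^sub>M SW)" using V W by simp
  have H: "subalgebra M H" unfolding H_def by (rule subalgebra_gen_alg[OF VW])
  have rVW: "(\<lambda>x. (r (V x), W x)) \<in> measurable M (count_space UNIV \<Otimes>\<^sub>M SW)" if "quantizer SV r" for r :: "_ \<Rightarrow> nat"
    using measurable_compose[OF V quantizer_measurable[OF that]] W by simp
  have Gsub: "subalgebra M (G r)" if "quantizer SV r" for r
    unfolding G_def by (rule subalgebra_gen_alg[OF rVW[OF that]])
  have GM: "B \<in> events" if "quantizer SV r" "B \<in> sets (G r)" for r B
    using Gsub[OF that(1)] that(2) by (auto simp: subalgebra_def)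
  have GH: "sets (G r) \<subseteq> sets H" if "quantizer SV r" for r
    unfolding G_def H_def
  proof (rule gen_alg_mono[OF VW, where f="\<lambda>(v, w). (r v, w)"])
    have [measurable]: "r \<in> measurable SV (count_space UNIV)" by (rule quantizer_measurable[OF that])
    show "(\<lambda>(v, w). (r v, w)) \<in> measurable (SV \<Otimes>\<^sub>M SW) (count_space UNIV \<Otimes>\<^sub>M SW)" by measurable
  qed simp
  define p where "p = cprob M H A"
  have pH: "p \<in> borel_measurable H" by (simp add: p_def)
  have [measurable]: "p \<in> borel_measurable M" unfolding p_def by (rule cprob_measurable'[OF H])
  have p01: "0 \<le> p x" "p x \<le> 1" for x by (simp_all add: p_def)
  obtain n where n: "n > 0" "1 / real n < e / 2"
  proof -
    obtain m where "inverse (real (Suc m)) < e / 2" using reals_Archimedean[of "e / 2"] e by auto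
    then show thesis by (intro that[of "Suc m"]) (auto simp: inverse_eq_divide)
  qed
  \<comment> \<open>The i-th level set lies at height (i + 1) / n, so that the indicators of all of
    them add up to the floor of n p.\<close>
  define D where "D i = {x \<in> space M. real (Suc i) \<le> real n * p x}" for i
  have DH: "D i \<in> sets H" for i
  proof -
    have sp: "space H = space M" by (simp add: H_def)
    have "{x \<in> space H. real (Suc i) \<le> real n * p x} \<in> sets H" using pH by measurable
    then show ?thesis by (simp add: D_def sp)
  qed
  have "\<forall>i. \<exists>r B. quantizer SV r \<and> B \<in> sets (G r) \<and> prob ((D i - B) \<union> (B - D i)) < e / 2"
    unfolding G_def using quantized_set_approx[OF V W, of "D _" "e / 2"] DH e unfolding H_def by simp
  then have "\<exists>r. \<forall>i. \<exists>B. quantizer SV (r i) \<and> B \<in> sets (G (r i)) \<and> prob ((D i - B) \<union> (B - D i)) < e / 2"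
    by (rule choice)
  then obtain r where "\<forall>i. \<exists>B. quantizer SV (r i) \<and> B \<in> sets (G (r i)) \<and> prob ((D i - B) \<union> (B - D i)) < e / 2" ..
  then have "\<exists>B. \<forall>i. quantizer SV (r i) \<and> B i \<in> sets (G (r i)) \<and> prob ((D i - B i) \<union> (B i - D i)) < e / 2"
    by (rule choice)
  then obtain B where r: "\<And>i. quantizer SV (r i)" and B: "\<And>i. B i \<in> sets (G (r i))"
    and DB: "\<And>i. prob ((D i - B i) \<union> (B i - D i)) < e / 2" by blast
  obtain t \<phi> where t: "quantizer SV t" "\<And>i v. i \<in> {..<n} \<Longrightarrow> v \<in> space SV \<Longrightarrow> r i v = \<phi> i (t v)"
    using joint_quantizer[of "{..<n}" SV r] r by blast
  have Bt: "B i \<in> sets (G t)" if i: "i < n" for i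
  proof -
    have "sets (G (r i)) \<subseteq> sets (G t)"
      unfolding G_def
    proof (rule gen_alg_mono[OF rVW[OF t(1)], where f="\<lambda>(k, w). (\<phi> i k, w)"])
      show "(\<lambda>(k, w). (\<phi> i k, w)) \<in> measurable (count_space UNIV \<Otimes>\<^sub>M SW) (count_space UNIV \<Otimes>\<^sub>M SW)"
        by measurable
      show "(r i (V x), W x) = (case (t (V x), W x) of (k, w) \<Rightarrow> (\<phi> i k, w))" if "x \<in> space M" for x
        using t(2) i measurable_space[OF V that] by simp
    qed
    then show ?thesis using B by auto
  qed
  define g where "g x = (\<Sum>i<n. indicator (B i) x) / real n" for x
  have gG: "g \<in> borel_measurable (G t)"
    unfolding g_def[abs_def] using Bt by (intro borel_measurable_divide borel_measurable_sum borel_measurable_indicator) auto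
  have gM [measurable]: "g \<in> borel_measurable M" by (rule measurable_from_subalg[OF Gsub[OF t(1)] gG])
  have g0: "0 \<le> g x" for x by (simp add: g_def sum_nonneg)
  have g1: "g x \<le> 1" for x
  proof -
    have "(\<Sum>i<n. indicat_real (B i) x) \<le> (\<Sum>i<n. 1)" by (intro sum_mono) (simp add: indicator_def)
    then show ?thesis using n by (simp add: g_def)
  qed
  have Ev: "(D i - B i) \<union> (B i - D i) \<in> events" for i
    using DH[of i] H GM[OF r B, of i] by (intro sets.Un sets.Diff) (auto simp: subalgebra_def)
  have pt: "(p x - g x)\<^sup>2 \<le> 1 / real n + (\<Sum>i<n. indicator ((D i - B i) \<union> (B i - D i)) x) / real n" if x: "x \<in> space M" for x
  proof -
    have np: "0 \<le> real n * p x" "real n * p x \<le> real n" using p01[of x] by (auto intro: mult_left_le)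
    define m where "m = nat \<lfloor>real n * p x\<rfloor>"
    have m: "real m \<le> real n * p x" "real n * p x < real m + 1" "m \<le> n"
      using np by (auto simp: m_def le_nat_floor) linarith+
    have "(\<Sum>i<n. indicat_real (D i) x) = (\<Sum>i<n. if i < m then 1 else 0)"
    proof (intro sum.cong refl)
      fix i
      have "real (Suc i) \<le> real n * p x \<longleftrightarrow> i < m" using m by linarith
      then show "indicat_real (D i) x = (if i < m then 1 else 0)" using x by (simp add: D_def)
    qed
    also have "\<dots> = real (card ({..<n} \<inter> {i. i < m}))" by (simp add: sum.If_cases)
    also have "{..<n} \<inter> {i. i < m} = {..<m}" using m by auto
    finally have Dm: "(\<Sum>i<n. indicat_real (D i) x) = real m" by simp
    have "\<bar>real n * p x - real n * g x\<bar> \<le> \<bar>real n * p x - (\<Sum>i<n. indicat_real (D i) x)\<bar> + \<bar>(\<Sum>i<n. indicat_real (D i) x) - real n * g x\<bar>"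
      by linarith
    also have "\<bar>real n * p x - (\<Sum>i<n. indicat_real (D i) x)\<bar> \<le> 1" unfolding Dm using m by linarith
    also have "\<bar>(\<Sum>i<n. indicat_real (D i) x) - real n * g x\<bar> = \<bar>\<Sum>i<n. indicat_real (D i) x - indicat_real (B i) x\<bar>"
      using n by (simp add: g_def sum_subtractf)
    also have "\<dots> \<le> (\<Sum>i<n. indicator ((D i - B i) \<union> (B i - D i)) x)"
      by (intro order_trans[OF sum_abs] sum_mono) (auto simp: indicator_def)
    finally have "real n * \<bar>p x - g x\<bar> \<le> 1 + (\<Sum>i<n. indicator ((D i - B i) \<union> (B i - D i)) x)"
      using n by (simp add: abs_mult flip: right_diff_distrib)
    then have "\<bar>p x - g x\<bar> \<le> (1 + (\<Sum>i<n. indicator ((D i - B i) \<union> (B i - D i)) x)) / real n"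
      using n by (simp add: pos_le_divide_eq mult.commute)
    \<comment> \<open>Both values lie in the unit interval, so the square is dominated by the
      distance and the symmetric differences enter linearly.\<close>
    moreover have "(p x - g x)\<^sup>2 \<le> \<bar>p x - g x\<bar>"
    proof -
      have "\<bar>p x - g x\<bar> \<le> 1" using p01[of x] g0[of x] g1[of x] by (auto simp: abs_le_iff)
      then have "\<bar>p x - g x\<bar> * \<bar>p x - g x\<bar> \<le> 1 * \<bar>p x - g x\<bar>" by (rule mult_right_mono) simp
      then show ?thesis by (simp add: power2_eq_square)
    qed
    ultimately show ?thesis by (simp add: add_divide_distrib)
  qed
  have ind: "integrable M (indicat_real (((D i - B i) \<union> (B i - D i))))" for i
    using Ev by (simp add: integrable_real_indicator emeasure_finite less_top[symmetric])
  have "(\<integral>x. (p x - cprob M (G t) A x)\<^sup>2 \<partial>M) \<le> (\<integral>x. (p x - g x)\<^sup>2 \<partial>M)"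
    unfolding p_def by (rule cprob_L2_le[OF Gsub[OF t(1)] H GH[OF t(1)] A gG g0 g1])
  also have "\<dots> \<le> (\<integral>x. 1 / real n + (\<Sum>i<n. indicator ((D i - B i) \<union> (B i - D i)) x) / real n \<partial>M)"
  proof (rule integral_mono[OF _ _ pt])
    show "integrable M (\<lambda>x. (p x - g x)\<^sup>2)"
    proof (rule integrable_bounded[where B=1])
      fix x
      have "\<bar>p x - g x\<bar> \<le> 1" using p01[of x] g0[of x] g1[of x] by (auto simp: abs_le_iff)
      then show "\<bar>(p x - g x)\<^sup>2\<bar> \<le> 1" by (simp add: abs_square_le_1)
    qed measurable
    show "integrable M (\<lambda>x. 1 / real n + (\<Sum>i<n. indicat_real ((D i - B i) \<union> (B i - D i)) x) / real n)"
      by (intro Bochner_Integration.integrable_add integrable_divide Bochner_Integration.integrable_sum ind) simp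
  qed
  also have "\<dots> = 1 / real n + (\<Sum>i<n. prob ((D i - B i) \<union> (B i - D i))) / real n"
    using ind Ev by (simp add: prob_space)
  also have "\<dots> \<le> 1 / real n + (\<Sum>i<n. e / 2) / real n"
    by (intro add_left_mono divide_right_mono sum_mono less_imp_le[OF DB]) simp
  also have "\<dots> < e" using n by simp
  finally show ?thesis unfolding p_def H_def G_def using t(1) by blast
qed

text \<open>The quantized conditional probabilities are close in mean square, and
  \<open>eta_modulus\<close> turns this into closeness of entropies. Passing from the quantizers
  chosen for single values of q to a common refinement only lowers the entropy, so the bound
  survives.\<close>

lemma centropy_quantize:
  assumes V: "V \<in> measurable M SV" and W: "W \<in> measurable M SW"
    and q: "q \<in> measurable M (count_space UNIV)" "finite (q ` space M)" and e: "(e::real) > 0"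
  shows "\<exists>r. quantizer SV r \<and>
    centropy M (gen_alg M (count_space UNIV \<Otimes>\<^sub>M SW) (\<lambda>x. (r (V x), W x))) q
      \<le> centropy M (gen_alg M (SV \<Otimes>\<^sub>M SW) (\<lambda>x. (V x, W x))) q + e"
proof -
  let ?VW = "\<lambda>x. (V x, W x)"
  define H where "H = gen_alg M (SV \<Otimes>\<^sub>M SW) ?VW"
  define G where "G r = gen_alg M (count_space UNIV \<Otimes>\<^sub>M SW) (\<lambda>x. (r (V x), W x))" for r :: "_ \<Rightarrow> nat"
  have H: "subalgebra M H" unfolding H_def using V W by (intro subalgebra_gen_alg) simp
  have rVW: "(\<lambda>x. (r (V x), W x)) \<in> measurable M (count_space UNIV \<Otimes>\<^sub>M SW)" if "quantizer SV r" for r :: "_ \<Rightarrow> nat"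
    using measurable_compose[OF V quantizer_measurable[OF that]] W by simp
  have Gsub: "subalgebra M (G r)" if "quantizer SV r" for r
    unfolding G_def by (rule subalgebra_gen_alg[OF rVW[OF that]])
  define K where "K = q ` space M"
  define Q where "Q k = q -` {k} \<inter> space M" for k
  have finK: "finite K" using q by (simp add: K_def)
  have Q: "Q k \<in> events" for k unfolding Q_def using q(1) by (rule measurable_sets) simp
  \<comment> \<open>Each value of q costs 2 e1: one from the modulus, one from the quadratic term,
    which d keeps below e1.\<close>
  define e1 where "e1 = e / 2 / (real (card K) + 1)"
  have e1: "e1 > 0" using e by (simp add: e1_def)
  obtain C where C: "C \<ge> 0" "\<And>x y. x \<in> {0..1} \<Longrightarrow> y \<in> {0..1} \<Longrightarrow> \<bar>eta x - eta y\<bar> \<le> e1 + C * (x - y)\<^sup>2"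
    using eta_modulus[OF e1] by blast
  define d where "d = e1 / (C + 1)"
  have d: "d > 0" "C * d \<le> e1" using e1 C by (auto simp: d_def field_simps)
  have "\<forall>k. \<exists>r. quantizer SV r \<and> (\<integral>x. (cprob M H (Q k) x - cprob M (G r) (Q k) x)\<^sup>2 \<partial>M) < d"
    unfolding G_def H_def using quantized_cprob_approx[OF V W Q d(1)] by blast
  then obtain r where r: "\<And>k. quantizer SV (r k)" "\<And>k. (\<integral>x. (cprob M H (Q k) x - cprob M (G (r k)) (Q k) x)\<^sup>2 \<partial>M) < d"
    by metis
  obtain t \<phi> where t: "quantizer SV t" "\<And>i v. i \<in> K \<Longrightarrow> v \<in> space SV \<Longrightarrow> r i v = \<phi> i (t v)"
    using joint_quantizer[of K SV r] r finK by blast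
  have mono: "(\<integral>x. eta (cprob M (G t) (Q k) x) \<partial>M) \<le> (\<integral>x. eta (cprob M (G (r k)) (Q k) x) \<partial>M)" if k: "k \<in> K" for k
  proof (rule expectation_eta_mono[OF Gsub[OF r(1)] Gsub[OF t(1)] _ Q])
    show "sets (G (r k)) \<subseteq> sets (G t)"
      unfolding G_def
    proof (rule gen_alg_mono[OF rVW[OF t(1)], where f="\<lambda>(j, w). (\<phi> k j, w)"])
      show "(\<lambda>(j, w). (\<phi> k j, w)) \<in> measurable (count_space UNIV \<Otimes>\<^sub>M SW) (count_space UNIV \<Otimes>\<^sub>M SW)"
        by measurable
      show "(r k (V x), W x) = (case (t (V x), W x) of (j, w) \<Rightarrow> (\<phi> k j, w))" if "x \<in> space M" for x
        using t(2) k measurable_space[OF V that] by simp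
    qed
  qed
  have close: "(\<integral>x. eta (cprob M (G (r k)) (Q k) x) \<partial>M) \<le> (\<integral>x. eta (cprob M H (Q k) x) \<partial>M) + 2 * e1" for k
  proof -
    define a b where "a = cprob M (G (r k)) (Q k)" and "b = cprob M H (Q k)"
    have [measurable]: "a \<in> borel_measurable M" "b \<in> borel_measurable M"
      unfolding a_def b_def using cprob_measurable'[OF H] cprob_measurable'[OF Gsub[OF r(1)]] by auto
    have ab: "a x \<in> {0..1}" "b x \<in> {0..1}" for x by (auto simp: a_def b_def)
    have i: "integrable M (\<lambda>x. (b x - a x)\<^sup>2)"
    proof (rule integrable_bounded[where B=1])
      fix x
      have "\<bar>b x - a x\<bar> \<le> 1" using ab[of x] by (auto simp: abs_le_iff)
      then show "\<bar>(b x - a x)\<^sup>2\<bar> \<le> 1" by (simp add: abs_square_le_1)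
    qed measurable
    have ie: "integrable M (\<lambda>x. eta (a x))" "integrable M (\<lambda>x. eta (b x))"
      unfolding a_def b_def by (intro integrable_eta_cprob H Gsub r)+
    have "(\<integral>x. eta (a x) \<partial>M) \<le> (\<integral>x. eta (b x) + (e1 + C * (b x - a x)\<^sup>2) \<partial>M)"
    proof (rule integral_mono[OF ie(1)])
      fix x
      show "eta (a x) \<le> eta (b x) + (e1 + C * (b x - a x)\<^sup>2)"
        using C(2)[OF ab(2) ab(1), of x x] by linarith
    qed (use ie i in simp)
    also have "\<dots> = (\<integral>x. eta (b x) \<partial>M) + e1 + C * (\<integral>x. (b x - a x)\<^sup>2 \<partial>M)"
      using ie i by (simp add: prob_space)
    also have "\<dots> \<le> (\<integral>x. eta (b x) \<partial>M) + e1 + C * d"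
      using r(2)[of k] C(1) unfolding a_def b_def by (intro add_left_mono mult_left_mono) auto
    finally show ?thesis using d(2) unfolding a_def b_def by linarith
  qed
  have "centropy M (G t) q \<le> (\<Sum>k\<in>K. (\<integral>x. eta (cprob M H (Q k) x) \<partial>M) + 2 * e1)"
    unfolding centropy_def K_def[symmetric] Q_def[symmetric]
    by (intro sum_mono order_trans[OF mono close])
  also have "\<dots> = centropy M H q + real (card K) * (2 * e1)"
    by (simp add: sum.distrib centropy_def K_def Q_def)
  also have "real (card K) * (2 * e1) \<le> e" using e by (simp add: e1_def field_simps)
  finally show ?thesis using t(1) unfolding G_def H_def by auto
qed

end

subsection \<open>Conditional independence of sub-algebras\<close>

text \<open>The generators are intersections because this family is closed under intersection:
  identities of finite measures need only be checked on it.\<close>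

definition join_alg :: "'a measure \<Rightarrow> 'a measure \<Rightarrow> 'a measure" where
  "join_alg B C = sigma (space B) {b \<inter> c | b c. b \<in> sets B \<and> c \<in> sets C}"

text \<open>The last algebra is the one conditioned on.\<close>

definition cond_indep :: "'a measure \<Rightarrow> 'a measure \<Rightarrow> 'a measure \<Rightarrow> 'a measure \<Rightarrow> bool" where
  "cond_indep P A B C \<longleftrightarrow> (\<forall>a\<in>sets A. \<forall>b\<in>sets B.
     AE x in P. cprob P C (a \<inter> b) x = cprob P C a x * cprob P C b x)"

lemma cond_indep_sym: "cond_indep P A B C \<Longrightarrow> cond_indep P B A C"
  unfolding cond_indep_def
proof (intro ballI)
  fix a b assume *: "\<forall>a\<in>sets A. \<forall>b\<in>sets B. AE x in P. cprob P C (a \<inter> b) x = cprob P C a x * cprob P C b x"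
    and ab: "a \<in> sets B" "b \<in> sets A"
  from *[rule_format, OF ab(2,1)] show "AE x in P. cprob P C (a \<inter> b) x = cprob P C a x * cprob P C b x"
    by (simp add: Int_commute mult.commute)
qed

context prob_space
begin

lemma join_alg_closed: "subalgebra M B \<Longrightarrow> {b \<inter> c | b c. b \<in> sets B \<and> c \<in> sets C} \<subseteq> Pow (space B)"
  using sets.sets_into_space[of _ B] by auto

lemma sets_join_alg:
  "subalgebra M B \<Longrightarrow> sets (join_alg B C) = sigma_sets (space M) {b \<inter> c | b c. b \<in> sets B \<and> c \<in> sets C}"
  unfolding join_alg_def using sets.sets_into_space[of _ B]
  by (subst sets_measure_of) (auto simp: subalgebra_def)

lemma space_join_alg [simp]: "subalgebra M B \<Longrightarrow> space (join_alg B C) = space M"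
  unfolding join_alg_def using sets.sets_into_space[of _ B]
  by (subst space_measure_of) (auto simp: subalgebra_def)

lemma subalgebra_join_alg:
  assumes "subalgebra M B" "subalgebra M C"
  shows "subalgebra M (join_alg B C)"
  unfolding subalgebra_def
proof
  show "sets (join_alg B C) \<subseteq> events"
    unfolding sets_join_alg[OF assms(1)]
    using assms by (intro sets.sigma_sets_subset) (auto simp: subalgebra_def)
qed (use assms in simp)

lemma join_alg_upper:
  assumes B: "subalgebra M B" and C: "subalgebra M C"
  shows "sets B \<subseteq> sets (join_alg B C)" "sets C \<subseteq> sets (join_alg B C)"
proof -
  show "sets B \<subseteq> sets (join_alg B C)"
  proof
    fix b assume b: "b \<in> sets B"
    have "b = b \<inter> space C" using sets.sets_into_space[OF b] B C by (auto simp: subalgebra_def)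
    then have "b \<in> {b \<inter> c | b c. b \<in> sets B \<and> c \<in> sets C}" using b by blast
    then show "b \<in> sets (join_alg B C)" unfolding sets_join_alg[OF B] by (rule sigma_sets.Basic)
  qed
  show "sets C \<subseteq> sets (join_alg B C)"
  proof
    fix c assume c: "c \<in> sets C"
    have "c = space B \<inter> c" using sets.sets_into_space[OF c] B C by (auto simp: subalgebra_def)
    then have "c \<in> {b \<inter> c | b c. b \<in> sets B \<and> c \<in> sets C}" using c by blast
    then show "c \<in> sets (join_alg B C)" unfolding sets_join_alg[OF B] by (rule sigma_sets.Basic)
  qed
qed

text \<open>On a generator b \<inter> c the factorization of P(a \<inter> b | C) yields the right
  integral of P(a | C), and the sets on which both sides agree are closed under complements and
  disjoint unions.\<close>

lemma cond_indep_cprob: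
  assumes A: "subalgebra M A" and B: "subalgebra M B" and C: "subalgebra M C"
    and ci: "cond_indep M A B C" and a: "a \<in> sets A"
  shows "AE x in M. cprob M (join_alg B C) a x = cprob M C a x"
proof (rule cprob_charact[OF subalgebra_join_alg[OF B C]])
  have BM: "sets B \<subseteq> events" and CM: "sets C \<subseteq> events" using B C by (auto simp: subalgebra_def)
  show aM: "a \<in> events" using a A by (auto simp: subalgebra_def)
  have "subalgebra (join_alg B C) C"
    using join_alg_upper[OF B C] B C by (auto simp: subalgebra_def[of _ C])
  then show "cprob M C a \<in> borel_measurable (join_alg B C)" by (rule measurable_from_subalg) simp
  show i: "integrable M (cprob M C a)" by (rule integrable_cprob[OF C])
  have [measurable]: "cprob M C a \<in> borel_measurable M" by (rule cprob_measurable'[OF C])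
  have int: "integrable M (\<lambda>x. indicator D x * cprob M C a x)" if "D \<in> events" for D
    by (rule integrable_bounded[where B=1]) (use that in \<open>auto simp: indicator_def\<close>)
  fix D assume D: "D \<in> sets (join_alg B C)"
  have "Int_stable {b \<inter> c | b c. b \<in> sets B \<and> c \<in> sets C}"
  proof (rule Int_stableI)
    fix x y assume "x \<in> {b \<inter> c | b c. b \<in> sets B \<and> c \<in> sets C}" "y \<in> {b \<inter> c | b c. b \<in> sets B \<and> c \<in> sets C}"
    then obtain b c b' c' where "x = b \<inter> c" "y = b' \<inter> c'" "b \<in> sets B" "c \<in> sets C" "b' \<in> sets B" "c' \<in> sets C" by auto
    then have "x \<inter> y = (b \<inter> b') \<inter> (c \<inter> c')" "b \<inter> b' \<in> sets B" "c \<inter> c' \<in> sets C" by auto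
    then show "x \<inter> y \<in> {b \<inter> c | b c. b \<in> sets B \<and> c \<in> sets C}" by blast
  qed
  moreover have "{b \<inter> c | b c. b \<in> sets B \<and> c \<in> sets C} \<subseteq> Pow (space M)"
    using join_alg_closed[OF B] B by (auto simp: subalgebra_def)
  ultimately show "(\<integral>x. indicator D x * cprob M C a x \<partial>M) = prob (a \<inter> D)"
    using D[unfolded sets_join_alg[OF B]]
  proof (induction rule: sigma_sets_induct_disjoint)
    case (basic D)
    then obtain b c where D: "D = b \<inter> c" and bc: "b \<in> sets B" "c \<in> sets C" by auto
    have bM: "b \<in> events" using bc BM by auto
    define f where "f x = indicator c x * cprob M C a x" for x
    have fC: "f \<in> borel_measurable C" unfolding f_def[abs_def] using bc by measurable
    have fb: "\<bar>f x\<bar> \<le> 1" for x by (simp add: f_def indicator_def)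
    have [measurable]: "cprob M C b \<in> borel_measurable M" "cprob M C (a \<inter> b) \<in> borel_measurable M"
      "c \<in> events" using cprob_measurable'[OF C] bc CM by auto
    have "(\<integral>x. indicator D x * cprob M C a x \<partial>M) = (\<integral>x. f x * indicator b x \<partial>M)"
      by (intro Bochner_Integration.integral_cong refl) (auto simp: D f_def indicator_def)
    also have "\<dots> = (\<integral>x. f x * cprob M C b x \<partial>M)"
      by (rule cprob_integral_bounded[OF C bM fC fb, symmetric])
    also have "\<dots> = (\<integral>x. indicator c x * cprob M C (a \<inter> b) x \<partial>M)"
    proof (rule integral_cong_AE)
      have "AE x in M. cprob M C (a \<inter> b) x = cprob M C a x * cprob M C b x"
        using ci a bc by (auto simp: cond_indep_def)
      then show "AE x in M. f x * cprob M C b x = indicator c x * cprob M C (a \<inter> b) x"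
        by eventually_elim (simp add: f_def)
    qed (simp_all add: f_def)
    also have "\<dots> = prob (a \<inter> b \<inter> c)"
      by (rule cprob_int[OF C _ bc(2)]) (use aM bM in auto)
    finally show ?case by (simp add: D Int_assoc)
  next
    case empty
    then show ?case by simp
  next
    case (compl D)
    have DM: "D \<in> events"
      using compl(1) subalgebra_join_alg[OF B C] by (auto simp: subalgebra_def sets_join_alg[OF B])
    have "(\<integral>x. indicator (space M - D) x * cprob M C a x \<partial>M) = (\<integral>x. cprob M C a x - indicator D x * cprob M C a x \<partial>M)"
      by (intro Bochner_Integration.integral_cong refl) (auto simp: indicator_def)
    also have "\<dots> = prob a - prob (a \<inter> D)"
      using int[OF DM] i expectation_cprob[OF C aM] compl by simp
    also have "\<dots> = prob (a - a \<inter> D)" using aM DM by (intro finite_measure_Diff[symmetric]) auto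
    also have "a - a \<inter> D = a \<inter> (space M - D)" using sets.sets_into_space[OF aM] by auto
    finally show ?case .
  next
    case (union D)
    have DM: "D i \<in> events" for i
      using union(2) subalgebra_join_alg[OF B C] by (auto simp: subalgebra_def sets_join_alg[OF B])
    have DU: "(\<Union>i. D i) \<in> events" using DM by auto
    have "(\<integral>x\<in>(\<Union>i. D i). cprob M C a x \<partial>M) = (\<Sum>i. \<integral>x\<in>D i. cprob M C a x \<partial>M)"
    proof (rule lebesgue_integral_countable_add)
      show "D i \<inter> D j = {}" if "i \<noteq> j" for i j using union(1) that by (auto simp: disjoint_family_on_def)
      show "set_integrable M (\<Union>i. D i) (cprob M C a)" using int[OF DU] by (simp add: set_integrable_def)
    qed (rule DM)
    also have "\<dots> = (\<Sum>i. prob (a \<inter> D i))"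
      using union(3) by (simp add: set_lebesgue_integral_def)
    also have "\<dots> = prob (\<Union>i. a \<inter> D i)"
    proof (rule sums_unique[symmetric, OF finite_measure_UNION])
      show "disjoint_family (\<lambda>i. a \<inter> D i)" using union(1) by (auto simp: disjoint_family_on_def)
    qed (use DM aM in auto)
    also have "(\<Union>i. a \<inter> D i) = a \<inter> (\<Union>i. D i)" by auto
    finally show ?case by (simp add: set_lebesgue_integral_def)
  qed
qed

text \<open>The converse criterion: P(a \<inter> b | C) can be computed by first conditioning on D,
  which contains b, and there a already has its conditional probability given C.\<close>

lemma cond_indepI_cprob:
  assumes A: "subalgebra M A" and C: "subalgebra M C" and D: "subalgebra M D"
    and sub: "sets C \<subseteq> sets D" "sets B \<subseteq> sets D"
    and eq: "\<And>a. a \<in> sets A \<Longrightarrow> AE x in M. cprob M D a x = cprob M C a x"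
  shows "cond_indep M A B C"
  unfolding cond_indep_def
proof (intro ballI)
  fix a b assume a: "a \<in> sets A" and b: "b \<in> sets B"
  have aM: "a \<in> events" using a A by (auto simp: subalgebra_def)
  have bM [measurable]: "b \<in> events" using b sub D by (auto simp: subalgebra_def)
  have [measurable]: "cprob M C a \<in> borel_measurable M" "cprob M C b \<in> borel_measurable M" "cprob M D a \<in> borel_measurable M"
    using cprob_measurable'[OF C] cprob_measurable'[OF D] by auto
  show "AE x in M. cprob M C (a \<inter> b) x = cprob M C a x * cprob M C b x"
  proof (rule cprob_charact[OF C])
    show "a \<inter> b \<in> events" using aM bM by auto
    show "integrable M (\<lambda>x. cprob M C a x * cprob M C b x)"
      by (rule integrable_bounded[where B=1]) (auto intro: mult_le_one)
    fix c assume c: "c \<in> sets C"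
    have cM [measurable]: "c \<in> events" using c C by (auto simp: subalgebra_def)
    define f where "f x = indicator c x * cprob M C a x" for x
    have fC: "f \<in> borel_measurable C" unfolding f_def[abs_def] using c by measurable
    have fb: "\<bar>f x\<bar> \<le> 1" for x by (simp add: f_def indicator_def)
    have "(\<integral>x. indicator c x * (cprob M C a x * cprob M C b x) \<partial>M) = (\<integral>x. f x * cprob M C b x \<partial>M)"
      by (simp add: f_def mult.assoc)
    also have "\<dots> = (\<integral>x. f x * indicator b x \<partial>M)"
      by (rule cprob_integral_bounded[OF C bM fC fb])
    also have "\<dots> = (\<integral>x. indicator (b \<inter> c) x * cprob M D a x \<partial>M)"
    proof (rule integral_cong_AE)
      show "AE x in M. f x * indicator b x = indicator (b \<inter> c) x * cprob M D a x"
        using eq[OF a] by eventually_elim (auto simp: f_def indicator_def)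
    qed (simp_all add: f_def)
    also have "\<dots> = prob (a \<inter> (b \<inter> c))"
      by (rule cprob_int[OF D aM]) (use b c sub in auto)
    finally show "(\<integral>x. indicator c x * (cprob M C a x * cprob M C b x) \<partial>M) = prob (a \<inter> b \<inter> c)"
      by (simp add: Int_assoc)
  qed measurable
qed

lemma cprob_between:
  assumes C: "subalgebra M C" and C': "subalgebra M C'" and D: "subalgebra M D"
    and sub: "sets C \<subseteq> sets C'" "sets C' \<subseteq> sets D" and aM: "a \<in> events"
    and eq: "AE x in M. cprob M D a x = cprob M C a x"
  shows "AE x in M. cprob M C' a x = cprob M C a x"
proof (rule cprob_charact[OF C' aM])
  have "subalgebra C' C" using C C' sub by (auto simp: subalgebra_def)
  then show "cprob M C a \<in> borel_measurable C'" by (rule measurable_from_subalg) simp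
  show "integrable M (cprob M C a)" by (rule integrable_cprob[OF C])
  fix B assume B: "B \<in> sets C'"
  have BM [measurable]: "B \<in> events" using B C' by (auto simp: subalgebra_def)
  have [measurable]: "cprob M C a \<in> borel_measurable M" "cprob M D a \<in> borel_measurable M"
    using cprob_measurable'[OF C] cprob_measurable'[OF D] by auto
  have "(\<integral>x. indicator B x * cprob M C a x \<partial>M) = (\<integral>x. indicator B x * cprob M D a x \<partial>M)"
  proof (rule integral_cong_AE)
    show "AE x in M. indicator B x * cprob M C a x = indicator B x * cprob M D a x"
      using eq by eventually_elim simp
  qed measurable
  also have "\<dots> = prob (a \<inter> B)" by (rule cprob_int[OF D aM]) (use B sub in auto)
  finally show "(\<integral>x. indicator B x * cprob M C a x \<partial>M) = prob (a \<inter> B)" .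
qed

text \<open>An event of A has the same conditional probability given C and given the join of B and
  C, hence also given anything in between. This is how new inputs and outputs are added to the
  condition below.\<close>

lemma cond_indep_weak_union:
  assumes A: "subalgebra M A" and B: "subalgebra M B" and C: "subalgebra M C" and C': "subalgebra M C'"
    and ci: "cond_indep M A B C" and sub: "sets C \<subseteq> sets C'" "sets C' \<subseteq> sets (join_alg B C)"
  shows "cond_indep M A B C'"
proof (rule cond_indepI_cprob[OF A C' subalgebra_join_alg[OF B C] sub(2) join_alg_upper(1)[OF B C]])
  fix a assume a: "a \<in> sets A"
  have aM: "a \<in> events" using a A by (auto simp: subalgebra_def)
  note 1 = cond_indep_cprob[OF A B C ci a]
  from 1 cprob_between[OF C C' subalgebra_join_alg[OF B C] sub aM 1]
  show "AE x in M. cprob M (join_alg B C) a x = cprob M C' a x" by eventually_elim simp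
qed

text \<open>Meant for outputs: they are determined by the noise together with the condition, so the
  message adds no knowledge about them.\<close>

lemma cond_indep_cprob_join:
  assumes A: "subalgebra M A" and B: "subalgebra M B" and C: "subalgebra M C"
    and ci: "cond_indep M A B C" and b: "b \<in> sets (join_alg B C)"
  shows "AE x in M. cprob M (join_alg A C) b x = cprob M C b x"
proof -
  note D = subalgebra_join_alg[OF B C]
  have "cond_indep M A (join_alg B C) C"
    by (rule cond_indepI_cprob[OF A C D join_alg_upper(2)[OF B C] order_refl cond_indep_cprob[OF A B C ci]])
  from cond_indep_cprob[OF D A C cond_indep_sym[OF this] b] show ?thesis .
qed

end

subsection \<open>The feedback channel\<close>

text \<open>Unlike \<^const>\<open>out_path\<close>, this does not depend on a horizon.\<close>

definition run :: "('x \<Rightarrow> 'z \<Rightarrow> 'y) \<Rightarrow> real \<Rightarrow> (real \<Rightarrow> 'a \<Rightarrow> (real \<Rightarrow> 'y) \<Rightarrow> 'x) \<Rightarrow> 'a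
     \<Rightarrow> (real \<Rightarrow> 'z) \<Rightarrow> real \<Rightarrow> 'y" where
  "run g \<Delta> f a z = wfrec {(s, t). 0 \<le> s \<and> s < t - \<Delta>} (\<lambda>y t. g (f t a (restrict y {0..<t - \<Delta>})) (z t))"

text \<open>The index of the length-\<Delta> block containing a time is a rank for the feedback
  recursion: whatever is fed back at time t lies in an earlier block.\<close>

lemma nat_floor_delay:
  assumes "\<Delta> > 0" "0 \<le> s" "s < t - \<Delta>"
  shows "nat \<lfloor>s / \<Delta>\<rfloor> < nat \<lfloor>t / \<Delta>\<rfloor>"
proof -
  have "(s + \<Delta>) / \<Delta> \<le> t / \<Delta>" using assms by (intro divide_right_mono) auto
  then have "s / \<Delta> + 1 \<le> t / \<Delta>" using assms by (simp add: add_divide_distrib)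
  from floor_mono[OF this] have "\<lfloor>s / \<Delta>\<rfloor> + 1 \<le> \<lfloor>t / \<Delta>\<rfloor>" by simp
  moreover have "0 \<le> \<lfloor>s / \<Delta>\<rfloor>" using assms by simp
  ultimately show ?thesis by linarith
qed

lemma run_eq:
  fixes g :: "'x \<Rightarrow> 'z \<Rightarrow> 'y"
  assumes "\<Delta> > 0"
  shows "run g \<Delta> f a z t = g (f t a (restrict (run g \<Delta> f a z) {0..<t - \<Delta>})) (z t)"
proof -
  let ?R = "{(s, t). 0 \<le> s \<and> s < t - \<Delta>}" and ?F = "\<lambda>y t. g (f t a (restrict y {0..<t - \<Delta>})) (z t)"
  have "wf ?R"
    by (rule wf_subset[of "Wellfounded.measure (\<lambda>t. nat \<lfloor>t / \<Delta>\<rfloor>)"]) (use nat_floor_delay[OF assms] in auto)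
  moreover have "adm_wf ?R ?F"
  proof (unfold adm_wf_def, intro allI impI)
    fix y y' :: "real \<Rightarrow> 'y" and t
    assume "\<forall>s. (s, t) \<in> ?R \<longrightarrow> y s = y' s"
    then have "restrict y {0..<t - \<Delta>} = restrict y' {0..<t - \<Delta>}" by (auto simp: restrict_def)
    then show "?F y t = ?F y' t" by simp
  qed
  ultimately have "run g \<Delta> f a z = ?F (run g \<Delta> f a z)"
    unfolding run_def by (rule wfrec_fixpoint)
  then show ?thesis by (rule fun_cong)
qed

text \<open>Agreement in earlier blocks of length \<Delta> forces agreement now. It serves twice: to
  evaluate the definite description in \<open>out_path\<close>, and later to recognise one block of
  a long transmission as a fresh run.\<close>

lemma run_unique:
  assumes "\<Delta> > 0" and y: "\<And>t. t \<in> {0..<T} \<Longrightarrow> y t = g (f t a (restrict y {0..<t - \<Delta>})) (z t)"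
    and "t \<in> {0..<T}"
  shows "y t = run g \<Delta> f a z t"
  using \<open>t \<in> {0..<T}\<close>
proof (induction "nat \<lfloor>t / \<Delta>\<rfloor>" arbitrary: t rule: less_induct)
  case less
  have "restrict y {0..<t - \<Delta>} = restrict (run g \<Delta> f a z) {0..<t - \<Delta>}"
    using less assms(1) nat_floor_delay[OF assms(1)] by (intro restrict_ext) auto
  then show ?case using y[OF less.prems] run_eq[OF assms(1), of g f a z t] by simp
qed

lemma restrict_restrict_delay:
  "\<Delta> > 0 \<Longrightarrow> t < T \<Longrightarrow> restrict (restrict y {0..<T}) {0..<t - \<Delta>} = restrict y {0..<t - \<Delta>}" for t \<Delta> T :: real
  by (auto simp: restrict_def)

lemma out_path_eq:
  assumes "\<Delta> > 0"
  shows "out_path g \<Delta> T f a z = restrict (run g \<Delta> f a z) {0..<T}"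
  unfolding out_path_def
proof (rule the_equality)
  show "restrict (run g \<Delta> f a z) {0..<T} \<in> extensional {0..<T} \<and>
    (\<forall>t\<in>{0..<T}. restrict (run g \<Delta> f a z) {0..<T} t =
      g (f t a (restrict (restrict (run g \<Delta> f a z) {0..<T}) {0..<t - \<Delta>})) (z t))"
    using run_eq[OF assms, of g f a z] assms by (auto simp: restrict_restrict_delay)
  fix y assume y: "y \<in> extensional {0..<T} \<and> (\<forall>t\<in>{0..<T}. y t = g (f t a (restrict y {0..<t - \<Delta>})) (z t))"
  then have "y t = run g \<Delta> f a z t" if "t \<in> {0..<T}" for t
    by (intro run_unique[OF assms _ that]) auto
  then show "y = restrict (run g \<Delta> f a z) {0..<T}"
    using y by (intro extensionalityI[of _ "{0..<T}"]) auto
qed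

lemma in_path_eq:
  assumes "\<Delta> > 0"
  shows "in_path g \<Delta> T f a z = (\<lambda>t\<in>{0..<T}. f t a (restrict (run g \<Delta> f a z) {0..<t - \<Delta>}))"
  unfolding in_path_def out_path_eq[OF assms]
proof (rule restrict_ext)
  fix t assume "t \<in> {0..<T}"
  then show "f t a (restrict (restrict (run g \<Delta> f a z) {0..<T}) {0..<t - \<Delta>}) = f t a (restrict (run g \<Delta> f a z) {0..<t - \<Delta>})"
    by (subst restrict_restrict_delay[OF assms]) auto
qed

lemma run_measurable:
  assumes g: "(\<lambda>(x, z). g x z) \<in> measurable (SX \<Otimes>\<^sub>M SZ) SY" and \<Delta>: "\<Delta> > 0"
    and A: "A \<in> measurable M (count_space UNIV)" and Z: "Z \<in> measurable M (PiM {0..} (\<lambda>_. SZ))"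
    and f: "\<And>t. t \<in> {0..<T} \<Longrightarrow> (\<lambda>(m, y). f t m y) \<in> measurable (count_space UNIV \<Otimes>\<^sub>M PiM {0..<t - \<Delta>} (\<lambda>_. SY)) SX"
    and t: "t \<in> {0..<T}"
  shows "(\<lambda>\<omega>. run g \<Delta> f (A \<omega>) (Z \<omega>) t) \<in> measurable M SY"
  using t
proof (induction "nat \<lfloor>t / \<Delta>\<rfloor>" arbitrary: t rule: less_induct)
  case less
  have past: "(\<lambda>\<omega>. restrict (run g \<Delta> f (A \<omega>) (Z \<omega>)) {0..<t - \<Delta>}) \<in> measurable M (PiM {0..<t - \<Delta>} (\<lambda>_. SY))"
    by (rule measurable_restrict) (use less nat_floor_delay[OF \<Delta>] \<Delta> in auto)
  have "(\<lambda>\<omega>. (A \<omega>, restrict (run g \<Delta> f (A \<omega>) (Z \<omega>)) {0..<t - \<Delta>})) \<in> measurable M (count_space UNIV \<Otimes>\<^sub>M PiM {0..<t - \<Delta>} (\<lambda>_. SY))"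
    using A past by simp
  from measurable_compose[OF this f[OF less.prems]]
  have X: "(\<lambda>\<omega>. f t (A \<omega>) (restrict (run g \<Delta> f (A \<omega>) (Z \<omega>)) {0..<t - \<Delta>})) \<in> measurable M SX" by simp
  have "(\<lambda>\<omega>. Z \<omega> t) \<in> measurable M SZ"
    by (rule measurable_compose[OF Z measurable_component_singleton]) (use less.prems in auto)
  with X have "(\<lambda>\<omega>. (f t (A \<omega>) (restrict (run g \<Delta> f (A \<omega>) (Z \<omega>)) {0..<t - \<Delta>}), Z \<omega> t)) \<in> measurable M (SX \<Otimes>\<^sub>M SZ)"
    by simp
  from measurable_compose[OF this g]
  have "(\<lambda>\<omega>. g (f t (A \<omega>) (restrict (run g \<Delta> f (A \<omega>) (Z \<omega>)) {0..<t - \<Delta>})) (Z \<omega> t)) \<in> measurable M SY" by simp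
  then show ?case by (subst run_eq[OF \<Delta>])
qed

text \<open>\<open>A\<close> stands for the message or the auxiliary process. It has finitely many
  values, so its independence of the noise is stated for single values only.\<close>

locale feedback_channel = prob_space M for M :: "'w measure" +
  fixes SX :: "'x measure" and SY :: "'y measure" and SZ :: "'z measure" and g :: "'x \<Rightarrow> 'z \<Rightarrow> 'y"
    and \<Delta> T :: real and f :: "real \<Rightarrow> 'a \<Rightarrow> (real \<Rightarrow> 'y) \<Rightarrow> 'x" and A :: "'w \<Rightarrow> 'a" and Z :: "'w \<Rightarrow> real \<Rightarrow> 'z"
  assumes g: "(\<lambda>(x, z). g x z) \<in> measurable (SX \<Otimes>\<^sub>M SZ) SY" and delay: "\<Delta> > 0"
    and A: "A \<in> measurable M (count_space UNIV)" "finite (A ` space M)"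
    and Z: "Z \<in> measurable M (PiM {0..} (\<lambda>_. SZ))"
    and f: "\<And>t. t \<in> {0..<T} \<Longrightarrow> (\<lambda>(m, y). f t m y) \<in> measurable (count_space UNIV \<Otimes>\<^sub>M PiM {0..<t - \<Delta>} (\<lambda>_. SY)) SX"
    and indep: "\<And>k B. B \<in> sets (PiM {0..} (\<lambda>_. SZ)) \<Longrightarrow>
      prob ({\<omega>\<in>space M. A \<omega> = k} \<inter> {\<omega>\<in>space M. Z \<omega> \<in> B}) = prob {\<omega>\<in>space M. A \<omega> = k} * prob {\<omega>\<in>space M. Z \<omega> \<in> B}"
begin

definition Y :: "'w \<Rightarrow> real \<Rightarrow> 'y" where
  "Y \<omega> = run g \<Delta> f (A \<omega>) (Z \<omega>)"

definition X :: "'w \<Rightarrow> real \<Rightarrow> 'x" where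
  "X \<omega> t = f t (A \<omega>) (restrict (Y \<omega>) {0..<t - \<Delta>})"

abbreviation PY :: "real set \<Rightarrow> (real \<Rightarrow> 'y) measure" where "PY I \<equiv> PiM I (\<lambda>_. SY)"
abbreviation PX :: "real set \<Rightarrow> (real \<Rightarrow> 'x) measure" where "PX I \<equiv> PiM I (\<lambda>_. SX)"

abbreviation Yr :: "real set \<Rightarrow> 'w \<Rightarrow> real \<Rightarrow> 'y" where "Yr I \<omega> \<equiv> restrict (Y \<omega>) I"
abbreviation Xr :: "real set \<Rightarrow> 'w \<Rightarrow> real \<Rightarrow> 'x" where "Xr I \<omega> \<equiv> restrict (X \<omega>) I"

text \<open>H(q | Y_0^s), with the output path up to s unquantized.\<close>

definition cY :: "real \<Rightarrow> ('w \<Rightarrow> 'k) \<Rightarrow> real" where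
  "cY s q = centropy M (gen_alg M (PY {0..<s}) (Yr {0..<s})) q"

lemma Y_eq: "Y \<omega> t = g (X \<omega> t) (Z \<omega> t)"
  unfolding X_def Y_def by (rule run_eq[OF delay])

lemma Yr_measurable: "I \<subseteq> {0..<T} \<Longrightarrow> Yr I \<in> measurable M (PY I)"
  unfolding Y_def by (rule measurable_restrict) (use run_measurable[OF g delay A(1) Z f] in blast)

text \<open>An input before a + \<Delta> reads only outputs before a. This is why all inputs of a
  block no longer than the delay are fixed by the message and the past outputs.\<close>

lemma Xr_measurable_from:
  assumes G: "A \<in> measurable G (count_space UNIV)" "Yr {0..<a} \<in> measurable G (PY {0..<a})"
    and I: "I \<subseteq> {0..<T}" "I \<subseteq> {..<a + \<Delta>}"
  shows "Xr I \<in> measurable G (PX I)"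
proof (rule measurable_restrict)
  fix t assume t: "t \<in> I"
  have "(\<lambda>y. restrict y {0..<t - \<Delta>}) \<in> measurable (PY {0..<a}) (PY {0..<t - \<Delta>})"
    by (rule measurable_restrict_subset) (use t I in auto)
  from measurable_compose[OF G(2) this]
  have "Yr {0..<t - \<Delta>} \<in> measurable G (PY {0..<t - \<Delta>})"
  proof (rule measurable_cong[THEN iffD1, rotated])
    fix \<omega>
    have "{0..<a} \<inter> {0..<t - \<Delta>} = {0..<t - \<Delta>}" using t I by auto
    then show "restrict (Yr {0..<a} \<omega>) {0..<t - \<Delta>} = Yr {0..<t - \<Delta>} \<omega>" by simp
  qed
  then have "(\<lambda>\<omega>. (A \<omega>, Yr {0..<t - \<Delta>} \<omega>)) \<in> measurable G (count_space UNIV \<Otimes>\<^sub>M PY {0..<t - \<Delta>})"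
    using G by simp
  from measurable_compose[OF this f[of t]] t I show "(\<lambda>\<omega>. X \<omega> t) \<in> measurable G SX"
    by (auto simp: X_def)
qed

lemma Xr_measurable: "I \<subseteq> {0..<T} \<Longrightarrow> Xr I \<in> measurable M (PX I)"
  by (rule Xr_measurable_from[OF A(1) Yr_measurable[OF order_refl]]) (use delay in auto)

text \<open>The channel acts at each instant separately, so inputs and noise determine the output
  without reference to the message.\<close>

lemma Yr_measurable_from:
  assumes G: "Xr {0..<b} \<in> measurable G (PX {0..<b})" "Z \<in> measurable G (PiM {0..} (\<lambda>_. SZ))"
    and I: "I \<subseteq> {0..<b}"
  shows "Yr I \<in> measurable G (PY I)"
proof (rule measurable_restrict)
  fix t assume t: "t \<in> I"
  have "(\<lambda>\<omega>. Xr {0..<b} \<omega> t) \<in> measurable G SX"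
    by (rule measurable_compose[OF G(1) measurable_component_singleton]) (use t I in auto)
  then have "(\<lambda>\<omega>. X \<omega> t) \<in> measurable G SX" using t I by auto
  moreover have "(\<lambda>\<omega>. Z \<omega> t) \<in> measurable G SZ"
    by (rule measurable_compose[OF G(2) measurable_component_singleton]) (use t I in auto)
  ultimately have "(\<lambda>\<omega>. (X \<omega> t, Z \<omega> t)) \<in> measurable G (SX \<Otimes>\<^sub>M SZ)" by simp
  from measurable_compose[OF this g] show "(\<lambda>\<omega>. Y \<omega> t) \<in> measurable G SY"
    by (simp add: Y_eq)
qed

lemma restrict_measurable_from:
  assumes "(\<lambda>\<omega>. restrict (h \<omega>) I) \<in> measurable G (PiM I (\<lambda>_. S))" "J \<subseteq> I"
  shows "(\<lambda>\<omega>. restrict (h \<omega>) J) \<in> measurable G (PiM J (\<lambda>_. S))"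
proof -
  have "(\<lambda>\<omega>. restrict (restrict (h \<omega>) I) J) \<in> measurable G (PiM J (\<lambda>_. S))"
    by (rule measurable_compose[OF assms(1) measurable_restrict_subset[OF assms(2)]])
  moreover have "I \<inter> J = J" using assms(2) by auto
  ultimately show ?thesis by simp
qed

abbreviation CA where "CA \<equiv> gen_alg M (count_space UNIV) A"
abbreviation CZ where "CZ \<equiv> gen_alg M (PiM {0..} (\<lambda>_. SZ)) Z"
text \<open>Inputs are known up to b and outputs up to a. In the induction below the inputs run
  ahead of the outputs by at most the delay.\<close>

definition CXY where "CXY b a = gen_alg M (PX {0..<b} \<Otimes>\<^sub>M PY {0..<a}) (\<lambda>\<omega>. (Xr {0..<b} \<omega>, Yr {0..<a} \<omega>))"

lemma sub_A: "subalgebra M CA" and sub_Z: "subalgebra M CZ"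
  by (rule subalgebra_gen_alg[OF A(1)], rule subalgebra_gen_alg[OF Z])

lemma XY_meas: "a \<le> T \<Longrightarrow> b \<le> T \<Longrightarrow> (\<lambda>\<omega>. (Xr {0..<b} \<omega>, Yr {0..<a} \<omega>)) \<in> measurable M (PX {0..<b} \<Otimes>\<^sub>M PY {0..<a})"
  by (intro measurable_Pair Xr_measurable Yr_measurable) auto

lemma sub_XY: "a \<le> T \<Longrightarrow> b \<le> T \<Longrightarrow> subalgebra M (CXY b a)"
  unfolding CXY_def by (rule subalgebra_gen_alg[OF XY_meas])

lemma XY_meas_CXY:
  assumes "a \<le> T" "b \<le> T"
  shows "Xr {0..<b} \<in> measurable (CXY b a) (PX {0..<b})" "Yr {0..<a} \<in> measurable (CXY b a) (PY {0..<a})"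
proof -
  note m = measurable_gen_alg[OF XY_meas[OF assms], folded CXY_def]
  from measurable_compose[OF m measurable_fst] show "Xr {0..<b} \<in> measurable (CXY b a) (PX {0..<b})" by simp
  from measurable_compose[OF m measurable_snd] show "Yr {0..<a} \<in> measurable (CXY b a) (PY {0..<a})" by simp
qed

lemma measurable_join_alg:
  assumes B: "subalgebra M B" and C: "subalgebra M C"
  shows "h \<in> measurable B S \<Longrightarrow> h \<in> measurable (join_alg B C) S"
    and "h \<in> measurable C S \<Longrightarrow> h \<in> measurable (join_alg B C) S"
proof -
  have "subalgebra (join_alg B C) B" "subalgebra (join_alg B C) C"
    using join_alg_upper[OF B C] B C by (auto simp: subalgebra_def[of _ B] subalgebra_def[of _ C])
  then show "h \<in> measurable B S \<Longrightarrow> h \<in> measurable (join_alg B C) S"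
    and "h \<in> measurable C S \<Longrightarrow> h \<in> measurable (join_alg B C) S"
    by (blast intro: measurable_from_subalg)+
qed

text \<open>The message is independent of the noise given the past inputs and outputs: outputs are
  functions of inputs and noise, inputs are functions of the message and past outputs, and
  conditional independence survives conditioning on such functions.\<close>

lemma cond_indep_message_noise:
  assumes "0 \<le> a" "a \<le> b" "b \<le> a + \<Delta>" "b \<le> T"
  shows "cond_indep M CA CZ (CXY b a)"
  using assms
proof (induction "nat \<lceil>a / \<Delta>\<rceil>" arbitrary: a b rule: less_induct)
  case less
  have aT: "a \<le> T" using less by simp
  note subs = sub_A sub_Z
  have "cond_indep M CA CZ (CXY a a)"
  proof (cases "a = 0")
    case True
    \<comment> \<open>At time 0 the condition is trivial, so the claim is plain independence of
      message and noise.\<close>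
    have trivial: "D = {} \<or> D = space M" if D: "D \<in> sets (CXY 0 0)" for D
    proof -
      obtain E where "D = (\<lambda>\<omega>. (Xr {0..<0} \<omega>, Yr {0..<0} \<omega>)) -` E \<inter> space M"
        using D unfolding CXY_def sets_gen_alg[OF XY_meas[of 0 0, OF aT[unfolded True] aT[unfolded True]]] by auto
      then show ?thesis by (cases "(\<lambda>_. undefined, \<lambda>_. undefined) \<in> E") (auto simp: restrict_def)
    qed
    have sub: "subalgebra M (CXY 0 0)" using sub_XY[of 0 0] aT True by simp
    have const: "AE x in M. cprob M (CXY 0 0) E x = prob E" if E: "E \<in> events" for E
    proof (rule cprob_charact[OF sub E])
      fix B assume "B \<in> sets (CXY 0 0)"
      from trivial[OF this] show "(\<integral>x. indicator B x * prob E \<partial>M) = prob (E \<inter> B)"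
        using sets.Int_space_eq2[OF E] by (auto simp: prob_space)
    qed auto
    have "cond_indep M CA CZ (CXY 0 0)"
      unfolding cond_indep_def
    proof (intro ballI)
      fix E B assume E: "E \<in> sets CA" and B: "B \<in> sets CZ"
      then have EM: "E \<in> events" and BM: "B \<in> events" using subs by (auto simp: subalgebra_def)
      obtain C where C: "C \<in> sets (PiM {0..} (\<lambda>_. SZ))" "B = {\<omega>\<in>space M. Z \<omega> \<in> C}"
        using B unfolding sets_gen_alg[OF Z] by (auto simp: vimage_def Int_def conj_commute)
      obtain K where K: "E = {\<omega>\<in>space M. A \<omega> \<in> K}"
        using E unfolding sets_gen_alg[OF A(1)] by (auto simp: vimage_def Int_def conj_commute)
      define J where "J = K \<inter> A ` space M"
      define Q where "Q k = {\<omega>\<in>space M. A \<omega> = k}" for k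
      have Q: "Q k \<in> events" for k unfolding Q_def using A(1) by measurable
      have finJ: "finite J" using A(2) by (simp add: J_def)
      have EJ: "E = (\<Union>k\<in>J. Q k)" by (auto simp: K J_def Q_def)
      have "prob (E \<inter> B) = prob (\<Union>k\<in>J. Q k \<inter> B)" by (simp add: EJ)
      also have "\<dots> = (\<Sum>k\<in>J. prob (Q k \<inter> B))"
      proof (rule finite_measure_finite_Union[OF finJ])
        show "disjoint_family_on (\<lambda>k. Q k \<inter> B) J" by (auto simp: disjoint_family_on_def Q_def)
      qed (use Q BM in auto)
      also have "\<dots> = (\<Sum>k\<in>J. prob (Q k) * prob B)"
        unfolding C Q_def by (intro sum.cong refl indep C)
      also have "\<dots> = prob (\<Union>k\<in>J. Q k) * prob B"
        unfolding sum_distrib_right[symmetric]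
      proof (subst finite_measure_finite_Union[OF finJ])
        show "disjoint_family_on Q J" by (auto simp: disjoint_family_on_def Q_def)
      qed (use Q in auto)
      finally have eq: "prob (E \<inter> B) = prob E * prob B" by (simp add: EJ)
      show "AE x in M. cprob M (CXY 0 0) (E \<inter> B) x = cprob M (CXY 0 0) E x * cprob M (CXY 0 0) B x"
        using const[OF EM] const[OF BM] const[OF sets.Int[OF EM BM]] by eventually_elim (simp add: eq)
    qed
    then show ?thesis using True by simp
  next
    case False
    \<comment> \<open>One delay back, clipped at 0: the rank strictly drops, and a <= a' + \<Delta>
      lets the hypothesis for a' cover all inputs before a.\<close>
    define a' where "a' = max 0 (a - \<Delta>)"
    have a': "0 \<le> a'" "a' \<le> a" "a \<le> a' + \<Delta>" "a' \<le> T" using less.prems delay by (auto simp: a'_def)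
    have "nat \<lceil>a' / \<Delta>\<rceil> < nat \<lceil>a / \<Delta>\<rceil>"
    proof -
      have 1: "0 < \<lceil>a / \<Delta>\<rceil>" using False less.prems delay by simp
      have "\<lceil>a' / \<Delta>\<rceil> < \<lceil>a / \<Delta>\<rceil>"
      proof (cases "a \<le> \<Delta>")
        case False
        then have "a' / \<Delta> = a / \<Delta> - 1" using delay by (simp add: a'_def diff_divide_distrib)
        then show ?thesis by simp
      qed (use 1 in \<open>simp add: a'_def\<close>)
      with 1 show ?thesis by simp
    qed
    then have IH: "cond_indep M CA CZ (CXY a a')" using a' aT by (intro less.hyps) auto
    have subs': "subalgebra M (CXY a a')" "subalgebra M (CXY a a)"
      using aT a' by (auto intro: sub_XY)
    note J = subalgebra_join_alg[OF sub_Z subs'(1)]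
    show ?thesis
    proof (rule cond_indep_weak_union[OF sub_A sub_Z subs' IH])
      show "sets (CXY a a') \<subseteq> sets (CXY a a)"
        unfolding CXY_def[of a a']
      proof (rule gen_alg_subset)
        show "(\<lambda>\<omega>. (Xr {0..<a} \<omega>, Yr {0..<a'} \<omega>)) \<in> measurable (CXY a a) (PX {0..<a} \<Otimes>\<^sub>M PY {0..<a'})"
          by (intro measurable_Pair restrict_measurable_from[of _ "{0..<a}" "CXY a a" SY "{0..<a'}"] XY_meas_CXY) (use aT a' in auto)
      qed (simp add: CXY_def)
      \<comment> \<open>The outputs between a' and a are functions of inputs and noise, so they may
        join the condition from the noise side.\<close>
      show "sets (CXY a a) \<subseteq> sets (join_alg CZ (CXY a a'))"
        unfolding CXY_def[of a a]
      proof (rule gen_alg_subset)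
        have x: "Xr {0..<a} \<in> measurable (join_alg CZ (CXY a a')) (PX {0..<a})"
          by (rule measurable_join_alg(2)[OF sub_Z subs'(1) XY_meas_CXY(1)]) (use aT a' in auto)
        have "Z \<in> measurable (join_alg CZ (CXY a a')) (PiM {0..} (\<lambda>_. SZ))"
          by (rule measurable_join_alg(1)[OF sub_Z subs'(1) measurable_gen_alg[OF Z]])
        from Yr_measurable_from[OF x this order_refl] x
        show "(\<lambda>\<omega>. (Xr {0..<a} \<omega>, Yr {0..<a} \<omega>)) \<in> measurable (join_alg CZ (CXY a a')) (PX {0..<a} \<Otimes>\<^sub>M PY {0..<a})"
          by simp
      qed (simp add: sub_Z)
    qed
  qed
  have subs': "subalgebra M (CXY a a)" "subalgebra M (CXY b a)"
    using aT less.prems by (auto intro: sub_XY)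
  \<comment> \<open>The inputs from a to b are functions of the message and the outputs before a, so
    here they join the condition from the message side, with the two roles exchanged.\<close>
  have "cond_indep M CZ CA (CXY b a)"
  proof (rule cond_indep_weak_union[OF sub_Z sub_A subs' cond_indep_sym])
    show "cond_indep M CA CZ (CXY a a)" by fact
    show "sets (CXY a a) \<subseteq> sets (CXY b a)"
      unfolding CXY_def[of a a]
    proof (rule gen_alg_subset)
      show "(\<lambda>\<omega>. (Xr {0..<a} \<omega>, Yr {0..<a} \<omega>)) \<in> measurable (CXY b a) (PX {0..<a} \<Otimes>\<^sub>M PY {0..<a})"
        by (intro measurable_Pair restrict_measurable_from[of _ "{0..<b}" "CXY b a" SX "{0..<a}"] XY_meas_CXY) (use aT less.prems in auto)
    qed (simp add: CXY_def)
    show "sets (CXY b a) \<subseteq> sets (join_alg CA (CXY a a))"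
      unfolding CXY_def[of b a]
    proof (rule gen_alg_subset)
      have y: "Yr {0..<a} \<in> measurable (join_alg CA (CXY a a)) (PY {0..<a})"
        by (rule measurable_join_alg(2)[OF sub_A subs'(1) XY_meas_CXY(2)]) (use aT in auto)
      have "A \<in> measurable (join_alg CA (CXY a a)) (count_space UNIV)"
        by (rule measurable_join_alg(1)[OF sub_A subs'(1) measurable_gen_alg[OF A(1)]])
      have "{0..<b} \<subseteq> {..<a + \<Delta>}" "{0..<b} \<subseteq> {0..<T}" using less.prems by auto
      from Xr_measurable_from[OF \<open>A \<in> _\<close> y this(2,1)] y
      show "(\<lambda>\<omega>. (Xr {0..<b} \<omega>, Yr {0..<a} \<omega>)) \<in> measurable (join_alg CA (CXY a a)) (PX {0..<b} \<Otimes>\<^sub>M PY {0..<a})"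
        by simp
    qed (simp add: sub_A)
  qed
  then show ?case by (rule cond_indep_sym)
qed

end

subsection \<open>Directed information and the converse\<close>

lemma partition_bounds:
  assumes nt: "nt \<in> partitions T" and "j \<le> fst nt"
  shows "0 \<le> snd nt j" "snd nt j \<le> T"
proof -
  have st: "snd nt i < snd nt (Suc i)" if "i < fst nt" for i using nt that by (auto simp: partitions_def)
  have "snd nt 0 \<le> snd nt j"
    by (rule inc_induct[of 0 j "\<lambda>i. snd nt i \<le> snd nt j"]) (use assms(2) in \<open>auto intro: order_trans[OF less_imp_le[OF st]]\<close>)
  then show "0 \<le> snd nt j" using nt by (auto simp: partitions_def)
  have "snd nt j \<le> snd nt (fst nt)"
    by (rule inc_induct[OF assms(2), of "\<lambda>i. snd nt i \<le> snd nt (fst nt)"]) (auto intro: order_trans[OF less_imp_le[OF st]])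
  then show "snd nt j \<le> T" using nt by (auto simp: partitions_def)
qed

context prob_space
begin

lemma quantizer_compose:
  assumes "V \<in> measurable M S" "quantizer S r"
  shows "(\<lambda>x. r (V x)) \<in> measurable M (count_space UNIV)" "finite ((\<lambda>x. r (V x)) ` space M)"
proof -
  show "(\<lambda>x. r (V x)) \<in> measurable M (count_space UNIV)"
    by (rule measurable_compose[OF assms(1) quantizer_measurable[OF assms(2)]])
  show "finite ((\<lambda>x. r (V x)) ` space M)"
    by (rule finite_subset[of _ "r ` space S"]) (use assms measurable_space[OF assms(1)] in \<open>auto simp: quantizer_def\<close>)
qed

lemma centropy_refine:
  assumes W: "W \<in> measurable M S" and h: "h \<in> measurable S S'" and q: "q \<in> measurable M (count_space UNIV)"
    and eq: "\<And>x. x \<in> space M \<Longrightarrow> W' x = h (W x)"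
  shows "centropy M (gen_alg M S W) q \<le> centropy M (gen_alg M S' W') q"
proof (rule centropy_mono)
  have "(\<lambda>x. h (W x)) \<in> measurable M S'" using W h by simp
  then have "W' \<in> measurable M S'" by (rule measurable_cong[THEN iffD1, rotated]) (simp add: eq)
  then show "subalgebra M (gen_alg M S' W')" by (rule subalgebra_gen_alg)
qed (use subalgebra_gen_alg[OF W] gen_alg_mono[OF W h eq] q in auto)

text \<open>Data processing. V need not be finite-valued, so it is quantized for q up to e; symmetry
  then turns the claim into the fact that conditioning on r leaves less entropy than conditioning on
  its function q.\<close>

lemma mutual_information_mono:
  assumes V: "V \<in> measurable M SV" and W: "W \<in> measurable M S"
    and r: "r \<in> measurable M (count_space UNIV)" "finite (r ` space M)"
    and q: "\<And>x. x \<in> space M \<Longrightarrow> q x = \<phi> (r x)"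
  shows "centropy M (gen_alg M S W) q - centropy M (gen_alg M (SV \<Otimes>\<^sub>M S) (\<lambda>x. (V x, W x))) q
    \<le> centropy M (gen_alg M S W) r - centropy M (gen_alg M (SV \<Otimes>\<^sub>M S) (\<lambda>x. (V x, W x))) r"
proof (rule field_le_epsilon)
  fix e :: real assume e: "e > 0"
  have "(\<lambda>x. \<phi> (r x)) \<in> measurable M (count_space UNIV)" by (rule measurable_compose[OF r(1)]) simp
  then have qm: "q \<in> measurable M (count_space UNIV)"
    by (rule measurable_cong[THEN iffD1, rotated]) (simp add: q)
  have "q ` space M \<subseteq> \<phi> ` (r ` space M)" using q by auto
  then have qf: "finite (q ` space M)" using r(2) by (rule finite_surj[rotated])
  obtain v where v: "quantizer SV v"
    "centropy M (gen_alg M (count_space UNIV \<Otimes>\<^sub>M S) (\<lambda>x. (v (V x), W x))) q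
      \<le> centropy M (gen_alg M (SV \<Otimes>\<^sub>M S) (\<lambda>x. (V x, W x))) q + e"
    using centropy_quantize[OF V W qm qf e] by blast
  note vV = quantizer_compose[OF V v(1)]
  have rW: "(\<lambda>x. (r x, W x)) \<in> measurable M (count_space UNIV \<Otimes>\<^sub>M S)" using r W by simp
  have "centropy M (gen_alg M (count_space UNIV \<Otimes>\<^sub>M S) (\<lambda>x. (r x, W x))) (\<lambda>x. v (V x))
     \<le> centropy M (gen_alg M (count_space UNIV \<Otimes>\<^sub>M S) (\<lambda>x. (q x, W x))) (\<lambda>x. v (V x))"
  proof (rule centropy_refine[OF rW _ vV(1), where h="\<lambda>(k, w). (\<phi> k, w)"])
    show "(\<lambda>(k, w). (\<phi> k, w)) \<in> measurable (count_space UNIV \<Otimes>\<^sub>M S) (count_space UNIV \<Otimes>\<^sub>M S)"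
      unfolding split_beta by (intro measurable_Pair measurable_compose[OF measurable_fst] measurable_snd) simp
  qed (simp add: q)
  moreover have "centropy M (gen_alg M (SV \<Otimes>\<^sub>M S) (\<lambda>x. (V x, W x))) r
     \<le> centropy M (gen_alg M (count_space UNIV \<Otimes>\<^sub>M S) (\<lambda>x. (v (V x), W x))) r"
  proof (rule centropy_refine[OF _ _ r(1), where h="\<lambda>(k, w). (v k, w)"])
    have [measurable]: "v \<in> measurable SV (count_space UNIV)" by (rule quantizer_measurable[OF v(1)])
    show "(\<lambda>(k, w). (v k, w)) \<in> measurable (SV \<Otimes>\<^sub>M S) (count_space UNIV \<Otimes>\<^sub>M S)" by measurable
  qed (use V W in auto)
  ultimately show "centropy M (gen_alg M S W) q - centropy M (gen_alg M (SV \<Otimes>\<^sub>M S) (\<lambda>x. (V x, W x))) q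
    \<le> centropy M (gen_alg M S W) r - centropy M (gen_alg M (SV \<Otimes>\<^sub>M S) (\<lambda>x. (V x, W x))) r + e"
    using v(2) centropy_diff_sym[OF W qm qf vV] centropy_diff_sym[OF W r vV] by linarith
qed

text \<open>Here and in the next lemma the divergence-based terms under the supremum are replaced by
  entropy differences, the form used from here on.\<close>

lemma cmi_upper:
  assumes U: "U \<in> measurable M SU" and V: "V \<in> measurable M SV" and W: "W \<in> measurable M SW"
    and le: "\<And>q r. quantizer SU q \<Longrightarrow> quantizer SV r \<Longrightarrow>
      centropy M (gen_alg M SW W) (\<lambda>x. q (U x))
        - centropy M (gen_alg M (count_space UNIV \<Otimes>\<^sub>M SW) (\<lambda>x. (r (V x), W x))) (\<lambda>x. q (U x)) \<le> c"
  shows "cmi M SU SV SW U V W \<le> ereal c"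
  unfolding cmi_def
proof (rule SUP_least)
  fix qr :: "('b \<Rightarrow> nat) \<times> ('c \<Rightarrow> nat)"
  assume "qr \<in> {(q, r). q \<in> SU \<rightarrow>\<^sub>M count_space UNIV \<and> finite (q ` space SU) \<and> r \<in> SV \<rightarrow>\<^sub>M count_space UNIV \<and> finite (r ` space SV)}"
  then have qr: "quantizer SU (fst qr)" "quantizer SV (snd qr)" by (auto simp: quantizer_def)
  note qU = quantizer_compose[OF U qr(1)] and rV = quantizer_compose[OF V qr(2)]
  show "ereal (conditional_mutual_information 2 (count_space UNIV) (count_space UNIV) SW (fst qr \<circ> U) (snd qr \<circ> V) W) \<le> ereal c"
    using conditional_mutual_information_eq[OF qU W rV(1)] le[OF qr] by (simp add: comp_def)
qed

lemma cmi_lower: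
  assumes U: "U \<in> measurable M SU" and V: "V \<in> measurable M SV" and W: "W \<in> measurable M SW"
    and q: "quantizer SU q" and r: "quantizer SV r"
  shows "ereal (centropy M (gen_alg M SW W) (\<lambda>x. q (U x))
        - centropy M (gen_alg M (count_space UNIV \<Otimes>\<^sub>M SW) (\<lambda>x. (r (V x), W x))) (\<lambda>x. q (U x))) \<le> cmi M SU SV SW U V W"
  unfolding cmi_def
proof (rule SUP_upper2)
  show "(q, r) \<in> {(q, r). q \<in> SU \<rightarrow>\<^sub>M count_space UNIV \<and> finite (q ` space SU) \<and> r \<in> SV \<rightarrow>\<^sub>M count_space UNIV \<and> finite (r ` space SV)}"
    using q r by (auto simp: quantizer_def)
  note qU = quantizer_compose[OF U q] and rV = quantizer_compose[OF V r]
  show "ereal (centropy M (gen_alg M SW W) (\<lambda>x. q (U x))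
        - centropy M (gen_alg M (count_space UNIV \<Otimes>\<^sub>M SW) (\<lambda>x. (r (V x), W x))) (\<lambda>x. q (U x)))
     \<le> ereal (conditional_mutual_information 2 (count_space UNIV) (count_space UNIV) SW (fst (q, r) \<circ> U) (snd (q, r) \<circ> V) W)"
    using conditional_mutual_information_eq[OF qU W rV(1)] by (simp add: comp_def)
qed

end

section \<open>Block terms of the directed information as entropy drops of the message\<close>

context feedback_channel
begin

text \<open>A block together with its past generates the same algebra as the whole path up to b:
  \<open>restrict\<close> goes one way, \<open>merge\<close> the other.\<close>

lemma cY_block:
  assumes ab: "0 \<le> a" "a \<le> b" "b \<le> T" and q: "q \<in> measurable M (count_space UNIV)"
  shows "cY b q = centropy M (gen_alg M (PY {a..<b} \<Otimes>\<^sub>M PY {0..<a}) (\<lambda>\<omega>. (Yr {a..<b} \<omega>, Yr {0..<a} \<omega>))) q"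
proof -
  have m: "Yr {0..<b} \<in> measurable M (PY {0..<b})" "Yr {a..<b} \<in> measurable M (PY {a..<b})" "Yr {0..<a} \<in> measurable M (PY {0..<a})"
    by (intro Yr_measurable; use ab in auto)+
  have p: "(\<lambda>\<omega>. (Yr {a..<b} \<omega>, Yr {0..<a} \<omega>)) \<in> measurable M (PY {a..<b} \<Otimes>\<^sub>M PY {0..<a})"
    using m by simp
  have un: "{a..<b} \<union> {0..<a} = {0..<b}" using ab by auto
  have "centropy M (gen_alg M (PY {0..<b}) (Yr {0..<b})) q
     \<le> centropy M (gen_alg M (PY {a..<b} \<Otimes>\<^sub>M PY {0..<a}) (\<lambda>\<omega>. (Yr {a..<b} \<omega>, Yr {0..<a} \<omega>))) q"
  proof (rule centropy_refine[OF m(1) _ q, where h="\<lambda>y. (restrict y {a..<b}, restrict y {0..<a})"])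
    show "(\<lambda>y. (restrict y {a..<b}, restrict y {0..<a})) \<in> measurable (PY {0..<b}) (PY {a..<b} \<Otimes>\<^sub>M PY {0..<a})"
      by (intro measurable_Pair measurable_restrict_subset) (use ab in auto)
    have "{0..<b} \<inter> {a..<b} = {a..<b}" "{0..<b} \<inter> {0..<a} = {0..<a}" using ab by auto
    then show "(Yr {a..<b} x, Yr {0..<a} x) = (restrict (Yr {0..<b} x) {a..<b}, restrict (Yr {0..<b} x) {0..<a})" for x
      by simp
  qed
  moreover have "centropy M (gen_alg M (PY {a..<b} \<Otimes>\<^sub>M PY {0..<a}) (\<lambda>\<omega>. (Yr {a..<b} \<omega>, Yr {0..<a} \<omega>))) q
     \<le> centropy M (gen_alg M (PY {0..<b}) (Yr {0..<b})) q"
  proof (rule centropy_refine[OF p _ q, where h="merge {a..<b} {0..<a}"])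
    show "merge {a..<b} {0..<a} \<in> measurable (PY {a..<b} \<Otimes>\<^sub>M PY {0..<a}) (PY {0..<b})"
      using measurable_merge[of "{a..<b}" "{0..<a}" "\<lambda>_. SY"] by (simp add: un)
    show "Yr {0..<b} x = merge {a..<b} {0..<a} (Yr {a..<b} x, Yr {0..<a} x)" for x
      using ab by (auto simp: merge_def restrict_def fun_eq_iff)
  qed
  ultimately show ?thesis by (simp add: cY_def)
qed

text \<open>On such a block the inputs are functions of the message and the past outputs, so the
  message tells at least as much about the block as any quantized input does. Symmetry then turns
  this into the entropy drop of A.\<close>

lemma cmi_block_upper:
  assumes ab: "0 \<le> a" "a \<le> b" "b \<le> T" "b \<le> a + \<Delta>"
  shows "cmi M (PY {a..<b}) (PX {0..<b}) (PY {0..<a}) (Yr {a..<b}) (Xr {0..<b}) (Yr {0..<a}) \<le> ereal (cY a A - cY b A)"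
proof (rule cmi_upper)
  show V: "Yr {a..<b} \<in> measurable M (PY {a..<b})" and W: "Yr {0..<a} \<in> measurable M (PY {0..<a})"
    and X: "Xr {0..<b} \<in> measurable M (PX {0..<b})"
    using ab by (auto intro: Yr_measurable Xr_measurable)
  fix q r assume q: "quantizer (PY {a..<b}) q" and r: "quantizer (PX {0..<b}) r"
  note qV = quantizer_compose[OF V q] and rX = quantizer_compose[OF X r]
  let ?W = "gen_alg M (PY {0..<a}) (Yr {0..<a})"
  let ?AW = "gen_alg M (count_space UNIV \<Otimes>\<^sub>M PY {0..<a}) (\<lambda>\<omega>. (A \<omega>, Yr {0..<a} \<omega>))"
  let ?rW = "gen_alg M (count_space UNIV \<Otimes>\<^sub>M PY {0..<a}) (\<lambda>\<omega>. (r (Xr {0..<b} \<omega>), Yr {0..<a} \<omega>))"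
  have AW: "(\<lambda>\<omega>. (A \<omega>, Yr {0..<a} \<omega>)) \<in> measurable M (count_space UNIV \<Otimes>\<^sub>M PY {0..<a})"
    using A(1) W by simp
  have rW: "(\<lambda>\<omega>. (r (Xr {0..<b} \<omega>), Yr {0..<a} \<omega>)) \<in> measurable M (count_space UNIV \<Otimes>\<^sub>M PY {0..<a})"
    using rX(1) W by simp
  have "centropy M ?AW (\<lambda>\<omega>. q (Yr {a..<b} \<omega>)) \<le> centropy M ?rW (\<lambda>\<omega>. q (Yr {a..<b} \<omega>))"
  proof (rule centropy_mono[OF subalgebra_gen_alg[OF rW] subalgebra_gen_alg[OF AW] gen_alg_subset qV(1)])
    note m = measurable_gen_alg[OF AW]
    from measurable_compose[OF m measurable_fst] have 1: "A \<in> measurable ?AW (count_space UNIV)" by simp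
    from measurable_compose[OF m measurable_snd] have 2: "Yr {0..<a} \<in> measurable ?AW (PY {0..<a})" by simp
    have "Xr {0..<b} \<in> measurable ?AW (PX {0..<b})"
      by (rule Xr_measurable_from[OF 1 2]) (use ab in auto)
    from measurable_compose[OF this quantizer_measurable[OF r]] 2
    show "(\<lambda>\<omega>. (r (Xr {0..<b} \<omega>), Yr {0..<a} \<omega>)) \<in> measurable ?AW (count_space UNIV \<Otimes>\<^sub>M PY {0..<a})" by simp
  qed simp
  moreover have "centropy M (gen_alg M (PY {a..<b} \<Otimes>\<^sub>M PY {0..<a}) (\<lambda>\<omega>. (Yr {a..<b} \<omega>, Yr {0..<a} \<omega>))) A
    \<le> centropy M (gen_alg M (count_space UNIV \<Otimes>\<^sub>M PY {0..<a}) (\<lambda>\<omega>. (q (Yr {a..<b} \<omega>), Yr {0..<a} \<omega>))) A"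
  proof (rule centropy_refine[OF _ _ A(1), where h="\<lambda>(k, w). (q k, w)"])
    have [measurable]: "q \<in> measurable (PY {a..<b}) (count_space UNIV)" by (rule quantizer_measurable[OF q])
    show "(\<lambda>(k, w). (q k, w)) \<in> measurable (PY {a..<b} \<Otimes>\<^sub>M PY {0..<a}) (count_space UNIV \<Otimes>\<^sub>M PY {0..<a})" by measurable
  qed (use V W in auto)
  ultimately show "centropy M ?W (\<lambda>\<omega>. q (Yr {a..<b} \<omega>)) - centropy M ?rW (\<lambda>\<omega>. q (Yr {a..<b} \<omega>)) \<le> cY a A - cY b A"
    using centropy_diff_sym[OF W A qV] unfolding cY_block[OF ab(1-3) A(1)] unfolding cY_def by linarith
qed

text \<open>Given the inputs and past outputs the block depends on the noise only, so the message
  adds nothing. Quantizing the output and then the input costs e / 2 each. The conclusion again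
  contains the unquantized block, which is what lets consecutive pieces telescope.\<close>

lemma short_block_lower:
  assumes ab: "0 \<le> a" "a \<le> b" "b \<le> T" "b \<le> a + \<Delta>" and e: "e > 0"
  shows "\<exists>r. quantizer (PX {0..<b}) r \<and>
    cY a A - cY b A \<le> cY a (\<lambda>\<omega>. r (Xr {0..<b} \<omega>)) - cY b (\<lambda>\<omega>. r (Xr {0..<b} \<omega>)) + e"
proof -
  have V: "Yr {a..<b} \<in> measurable M (PY {a..<b})" and W: "Yr {0..<a} \<in> measurable M (PY {0..<a})"
    and X: "Xr {0..<b} \<in> measurable M (PX {0..<b})"
    using ab by (auto intro: Yr_measurable Xr_measurable)
  have e2: "e / 2 > 0" using e by simp
  let ?W = "gen_alg M (PY {0..<a}) (Yr {0..<a})"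
  let ?AW = "gen_alg M (count_space UNIV \<Otimes>\<^sub>M PY {0..<a}) (\<lambda>\<omega>. (A \<omega>, Yr {0..<a} \<omega>))"
  let ?VW = "gen_alg M (PY {a..<b} \<Otimes>\<^sub>M PY {0..<a}) (\<lambda>\<omega>. (Yr {a..<b} \<omega>, Yr {0..<a} \<omega>))"
  obtain v where v: "quantizer (PY {a..<b}) v" and
    v1: "centropy M (gen_alg M (count_space UNIV \<Otimes>\<^sub>M PY {0..<a}) (\<lambda>\<omega>. (v (Yr {a..<b} \<omega>), Yr {0..<a} \<omega>))) A
      \<le> centropy M ?VW A + e / 2"
    using centropy_quantize[OF V W A e2] by blast
  note vV = quantizer_compose[OF V v]
  obtain r where r: "quantizer (PX {0..<b}) r" and
    r1: "centropy M (gen_alg M (count_space UNIV \<Otimes>\<^sub>M PY {0..<a}) (\<lambda>\<omega>. (r (Xr {0..<b} \<omega>), Yr {0..<a} \<omega>))) (\<lambda>\<omega>. v (Yr {a..<b} \<omega>))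
      \<le> centropy M (CXY b a) (\<lambda>\<omega>. v (Yr {a..<b} \<omega>)) + e / 2"
    using centropy_quantize[OF X W vV e2] unfolding CXY_def by blast
  note rX = quantizer_compose[OF X r]
  have AW: "(\<lambda>\<omega>. (A \<omega>, Yr {0..<a} \<omega>)) \<in> measurable M (count_space UNIV \<Otimes>\<^sub>M PY {0..<a})"
    using A(1) W by simp
  have sC: "subalgebra M (CXY b a)" using ab by (intro sub_XY) auto
  note sJ = subalgebra_join_alg[OF sub_A sC]
  \<comment> \<open>The quantized block is determined by noise, inputs and past outputs, hence
    conditionally independent of the message.\<close>
  have "centropy M (join_alg CA (CXY b a)) (\<lambda>\<omega>. v (Yr {a..<b} \<omega>)) = centropy M (CXY b a) (\<lambda>\<omega>. v (Yr {a..<b} \<omega>))"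
  proof (rule centropy_cong_AE[OF sJ sC])
    fix k
    have J2: "subalgebra M (join_alg CZ (CXY b a))" by (rule subalgebra_join_alg[OF sub_Z sC])
    have "Xr {0..<b} \<in> measurable (join_alg CZ (CXY b a)) (PX {0..<b})"
      by (rule measurable_join_alg(2)[OF sub_Z sC XY_meas_CXY(1)]) (use ab in auto)
    moreover have "Z \<in> measurable (join_alg CZ (CXY b a)) (PiM {0..} (\<lambda>_. SZ))"
      by (rule measurable_join_alg(1)[OF sub_Z sC measurable_gen_alg[OF Z]])
    ultimately have "Yr {a..<b} \<in> measurable (join_alg CZ (CXY b a)) (PY {a..<b})"
      by (rule Yr_measurable_from) (use ab in auto)
    from measurable_compose[OF this quantizer_measurable[OF v]]
    have "(\<lambda>\<omega>. v (Yr {a..<b} \<omega>)) \<in> measurable (join_alg CZ (CXY b a)) (count_space UNIV)" .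
    from measurable_sets[OF this, of "{k}"]
    have "(\<lambda>\<omega>. v (Yr {a..<b} \<omega>)) -` {k} \<inter> space M \<in> sets (join_alg CZ (CXY b a))"
      by (simp add: sub_Z)
    from cond_indep_cprob_join[OF sub_A sub_Z sC cond_indep_message_noise[OF ab(1,2,4,3)] this]
    show "AE x in M. cprob M (join_alg CA (CXY b a)) ((\<lambda>\<omega>. v (Yr {a..<b} \<omega>)) -` {k} \<inter> space M) x
       = cprob M (CXY b a) ((\<lambda>\<omega>. v (Yr {a..<b} \<omega>)) -` {k} \<inter> space M) x" .
  qed
  moreover have "centropy M (join_alg CA (CXY b a)) (\<lambda>\<omega>. v (Yr {a..<b} \<omega>)) \<le> centropy M ?AW (\<lambda>\<omega>. v (Yr {a..<b} \<omega>))"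
  proof (rule centropy_mono[OF subalgebra_gen_alg[OF AW] sJ gen_alg_subset vV(1)])
    have "A \<in> measurable (join_alg CA (CXY b a)) (count_space UNIV)"
      by (rule measurable_join_alg(1)[OF sub_A sC measurable_gen_alg[OF A(1)]])
    moreover have "Yr {0..<a} \<in> measurable (join_alg CA (CXY b a)) (PY {0..<a})"
      by (rule measurable_join_alg(2)[OF sub_A sC XY_meas_CXY(2)]) (use ab in auto)
    ultimately show "(\<lambda>\<omega>. (A \<omega>, Yr {0..<a} \<omega>)) \<in> measurable (join_alg CA (CXY b a)) (count_space UNIV \<Otimes>\<^sub>M PY {0..<a})"
      by simp
  qed (simp add: sub_A)
  moreover have "centropy M ?VW (\<lambda>\<omega>. r (Xr {0..<b} \<omega>))
    \<le> centropy M (gen_alg M (count_space UNIV \<Otimes>\<^sub>M PY {0..<a}) (\<lambda>\<omega>. (v (Yr {a..<b} \<omega>), Yr {0..<a} \<omega>))) (\<lambda>\<omega>. r (Xr {0..<b} \<omega>))"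
  proof (rule centropy_refine[OF _ _ rX(1), where h="\<lambda>(k, w). (v k, w)"])
    have [measurable]: "v \<in> measurable (PY {a..<b}) (count_space UNIV)" by (rule quantizer_measurable[OF v])
    show "(\<lambda>(k, w). (v k, w)) \<in> measurable (PY {a..<b} \<Otimes>\<^sub>M PY {0..<a}) (count_space UNIV \<Otimes>\<^sub>M PY {0..<a})" by measurable
  qed (use V W in auto)
  ultimately have "cY a A - cY b A \<le> cY a (\<lambda>\<omega>. r (Xr {0..<b} \<omega>)) - cY b (\<lambda>\<omega>. r (Xr {0..<b} \<omega>)) + e"
    using v1 r1 centropy_diff_sym[OF W A vV] centropy_diff_sym[OF W rX vV]
    unfolding cY_block[OF ab(1-3) A(1)] cY_block[OF ab(1-3) rX(1)] unfolding cY_def by linarith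
  with r show ?thesis by blast
qed

text \<open>A long block is cut into pieces shorter than the delay; quantizing the whole input once
  makes the sum over the pieces telescope.\<close>

lemma cmi_block_lower:
  assumes ab: "0 \<le> a" "a \<le> b" "b \<le> T"
  shows "ereal (cY a A - cY b A) \<le> cmi M (PY {a..<b}) (PX {0..<b}) (PY {0..<a}) (Yr {a..<b}) (Xr {0..<b}) (Yr {0..<a})"
proof (rule ereal_le_epsilon2)
  fix e :: real assume e: "e > 0"
  have V: "Yr {a..<b} \<in> measurable M (PY {a..<b})" and W: "Yr {0..<a} \<in> measurable M (PY {0..<a})"
    and X: "Xr {0..<b} \<in> measurable M (PX {0..<b})"
    using ab by (auto intro: Yr_measurable Xr_measurable)
  obtain n :: nat where n: "n > 0" "b - a \<le> real n * \<Delta>"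
  proof -
    obtain m :: nat where "(b - a) / \<Delta> \<le> real m" using real_arch_simple by blast
    then have "b - a \<le> real m * \<Delta>" using delay by (simp add: divide_le_eq)
    \<comment> \<open>The successor makes n positive even for an empty block.\<close>
    then have "b - a \<le> real (Suc m) * \<Delta>" using delay by (simp add: algebra_simps)
    then show thesis by (intro that[of "Suc m"]) auto
  qed
  define s where "s j = a + real j * ((b - a) / real n)" for j
  have sn: "s 0 = a" "s n = b" using n by (auto simp: s_def)
  have step: "s (Suc j) = s j + (b - a) / real n" for j by (simp add: s_def distrib_right add_divide_distrib)
  have sab: "a \<le> s j" "s j \<le> b" if "j \<le> n" for j
  proof -
    show "a \<le> s j" using ab by (simp add: s_def)
    have "real j * ((b - a) / real n) \<le> real n * ((b - a) / real n)"
      using that ab by (intro mult_right_mono) auto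
    then show "s j \<le> b" using n by (simp add: s_def)
  qed
  have sstep: "s j \<le> s (Suc j)" "s (Suc j) \<le> s j + \<Delta>" for j
    using n ab by (auto simp: step divide_le_eq mult.commute)
  have en: "e / 2 / real n > 0" using e n by simp
  have "\<forall>j\<in>{..<n}. \<exists>r. quantizer (PX {0..<s (Suc j)}) r \<and>
    cY (s j) A - cY (s (Suc j)) A \<le> cY (s j) (\<lambda>\<omega>. r (Xr {0..<s (Suc j)} \<omega>)) - cY (s (Suc j)) (\<lambda>\<omega>. r (Xr {0..<s (Suc j)} \<omega>)) + e / 2 / real n"
  proof (intro ballI short_block_lower en sstep)
    fix j assume "j \<in> {..<n}"
    then show "0 \<le> s j" "s (Suc j) \<le> T" using sab[of j] sab[of "Suc j"] ab by auto
  qed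
  then obtain r where r: "\<And>j. j < n \<Longrightarrow> quantizer (PX {0..<s (Suc j)}) (r j)"
    "\<And>j. j < n \<Longrightarrow> cY (s j) A - cY (s (Suc j)) A \<le> cY (s j) (\<lambda>\<omega>. r j (Xr {0..<s (Suc j)} \<omega>)) - cY (s (Suc j)) (\<lambda>\<omega>. r j (Xr {0..<s (Suc j)} \<omega>)) + e / 2 / real n"
    unfolding bchoice_iff by auto
  \<comment> \<open>The quantizer for one piece, read as a quantizer of all inputs up to b.\<close>
  define r' where "r' j x = r j (restrict x {0..<s (Suc j)})" for j x
  have sub: "{0..<s (Suc j)} \<subseteq> {0..<b}" if "j < n" for j using sab[of "Suc j"] that by auto
  have r': "quantizer (PX {0..<b}) (r' j)" if j: "j < n" for j
  proof -
    have m: "(\<lambda>x. restrict x {0..<s (Suc j)}) \<in> measurable (PX {0..<b}) (PX {0..<s (Suc j)})"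
      by (rule measurable_restrict_subset[OF sub[OF j]])
    have "r' j ` space (PX {0..<b}) \<subseteq> r j ` space (PX {0..<s (Suc j)})"
      using measurable_space[OF m] by (auto simp: r'_def)
    then show ?thesis
      using r(1)[OF j] measurable_compose[OF m quantizer_measurable[OF r(1)[OF j]]]
      by (auto simp: quantizer_def r'_def[abs_def] intro: finite_subset)
  qed
  obtain t \<phi> where t: "quantizer (PX {0..<b}) t" and t1: "\<And>j x. j < n \<Longrightarrow> x \<in> space (PX {0..<b}) \<Longrightarrow> r' j x = \<phi> j (t x)"
    using joint_quantizer[of "{..<n}" "PX {0..<b}" r'] r' by auto
  define tX where "tX \<omega> = t (Xr {0..<b} \<omega>)" for \<omega>
  have tX: "tX \<in> measurable M (count_space UNIV)" "finite (tX ` space M)"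
    unfolding tX_def[abs_def] by (rule quantizer_compose[OF X t])+
  \<comment> \<open>By data processing the common refinement is no worse than the quantizer of the
    piece, although it may also look at inputs of later pieces.\<close>
  have piece: "cY (s j) A - cY (s (Suc j)) A \<le> cY (s j) tX - cY (s (Suc j)) tX + e / 2 / real n" if j: "j < n" for j
  proof -
    have jb: "0 \<le> s j" "s j \<le> s (Suc j)" "s (Suc j) \<le> T"
      using sab[of j] sab[of "Suc j"] ab j sstep(1)[of j] by auto
    have rj: "(\<lambda>\<omega>. r j (Xr {0..<s (Suc j)} \<omega>)) \<in> measurable M (count_space UNIV)"
      by (rule quantizer_compose(1)[OF _ r(1)[OF j]]) (use jb in \<open>auto intro: Xr_measurable\<close>)
    have V': "Yr {s j..<s (Suc j)} \<in> measurable M (PY {s j..<s (Suc j)})" and W': "Yr {0..<s j} \<in> measurable M (PY {0..<s j})"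
      using jb by (auto intro: Yr_measurable)
    have "cY (s j) (\<lambda>\<omega>. r j (Xr {0..<s (Suc j)} \<omega>)) - cY (s (Suc j)) (\<lambda>\<omega>. r j (Xr {0..<s (Suc j)} \<omega>)) \<le> cY (s j) tX - cY (s (Suc j)) tX"
      unfolding cY_block[OF jb rj] cY_block[OF jb tX(1)]
      unfolding cY_def
    proof (rule mutual_information_mono[OF V' W' tX, where \<phi>="\<phi> j"])
      fix \<omega> assume "\<omega> \<in> space M"
      then have "Xr {0..<b} \<omega> \<in> space (PX {0..<b})" by (rule measurable_space[OF X])
      from t1[OF j this] have "r j (restrict (Xr {0..<b} \<omega>) {0..<s (Suc j)}) = \<phi> j (tX \<omega>)"
        by (simp only: tX_def r'_def)
      moreover have "{0..<b} \<inter> {0..<s (Suc j)} = {0..<s (Suc j)}" using sub[OF j] by auto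
      ultimately show "r j (Xr {0..<s (Suc j)} \<omega>) = \<phi> j (tX \<omega>)"
        by (simp only: restrict_restrict)
    qed
    with r(2)[OF j] show ?thesis by linarith
  qed
  have "cY a A - cY b A = (\<Sum>j<n. cY (s j) A - cY (s (Suc j)) A)"
    using sum_lessThan_telescope'[of "\<lambda>j. cY (s j) A" n] sn by simp
  also have "\<dots> \<le> (\<Sum>j<n. cY (s j) tX - cY (s (Suc j)) tX + e / 2 / real n)"
    by (intro sum_mono piece) simp
  also have "\<dots> = cY a tX - cY b tX + e / 2"
    using sum_lessThan_telescope'[of "\<lambda>j. cY (s j) tX" n] sn n by (simp add: sum.distrib)
  finally have 1: "cY a A - cY b A \<le> cY a tX - cY b tX + e / 2" .
  have e2: "e / 2 > 0" using e by simp
  obtain v where v: "quantizer (PY {a..<b}) v" and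
    v1: "centropy M (gen_alg M (count_space UNIV \<Otimes>\<^sub>M PY {0..<a}) (\<lambda>\<omega>. (v (Yr {a..<b} \<omega>), Yr {0..<a} \<omega>))) tX
      \<le> centropy M (gen_alg M (PY {a..<b} \<Otimes>\<^sub>M PY {0..<a}) (\<lambda>\<omega>. (Yr {a..<b} \<omega>, Yr {0..<a} \<omega>))) tX + e / 2"
    using centropy_quantize[OF V W tX e2] by blast
  note vV = quantizer_compose[OF V v]
  have "cY a A - cY b A \<le> centropy M (gen_alg M (PY {0..<a}) (Yr {0..<a})) (\<lambda>\<omega>. v (Yr {a..<b} \<omega>))
      - centropy M (gen_alg M (count_space UNIV \<Otimes>\<^sub>M PY {0..<a}) (\<lambda>\<omega>. (t (Xr {0..<b} \<omega>), Yr {0..<a} \<omega>))) (\<lambda>\<omega>. v (Yr {a..<b} \<omega>)) + e"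
    using 1 v1 centropy_diff_sym[OF W tX vV] unfolding cY_block[OF ab tX(1)] unfolding cY_def tX_def by linarith
  then have "ereal (cY a A - cY b A) \<le> ereal (centropy M (gen_alg M (PY {0..<a}) (Yr {0..<a})) (\<lambda>\<omega>. v (Yr {a..<b} \<omega>))
      - centropy M (gen_alg M (count_space UNIV \<Otimes>\<^sub>M PY {0..<a}) (\<lambda>\<omega>. (t (Xr {0..<b} \<omega>), Yr {0..<a} \<omega>))) (\<lambda>\<omega>. v (Yr {a..<b} \<omega>))) + ereal e"
    by simp
  also have "\<dots> \<le> cmi M (PY {a..<b}) (PX {0..<b}) (PY {0..<a}) (Yr {a..<b}) (Xr {0..<b}) (Yr {0..<a}) + ereal e"
    by (intro add_right_mono cmi_lower V W X v t)
  finally show "ereal (cY a A - cY b A) \<le> cmi M (PY {a..<b}) (PX {0..<b}) (PY {0..<a}) (Yr {a..<b}) (Xr {0..<b}) (Yr {0..<a}) + ereal e" .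
qed

lemma cY_0: "0 \<le> T \<Longrightarrow> cY 0 A = (\<Sum>k\<in>A ` space M. eta (prob (A -` {k} \<inter> space M)))"
  unfolding cY_def by (rule centropy_const[OF A(1), where c="\<lambda>_. undefined"]) (use Yr_measurable[of "{0..<0}"] in \<open>auto simp: restrict_def\<close>)

definition DI :: ereal where
  "DI = directed_info M SX SY (\<lambda>\<omega>. restrict (X \<omega>) {0..<T}) (\<lambda>\<omega>. restrict (Y \<omega>) {0..<T}) T"

definition block_cmi :: "real \<Rightarrow> real \<Rightarrow> ereal" where
  "block_cmi a b = cmi M (PY {a..<b}) (PX {0..<b}) (PY {0..<a}) (Yr {a..<b}) (Xr {0..<b}) (Yr {0..<a})"

lemma DI_eq: "DI = (INF nt \<in> partitions T. \<Sum>i\<in>{1..fst nt}. block_cmi (snd nt (i - 1)) (snd nt i))"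
  unfolding DI_def directed_info_def Let_def
proof (intro INF_cong refl sum.cong)
  fix nt i assume nt: "nt \<in> partitions T" and i: "i \<in> {1..fst nt}"
  note t = partition_bounds[OF nt]
  have "{0..<T} \<inter> {snd nt (i - 1)..<snd nt i} = {snd nt (i - 1)..<snd nt i}"
    "{0..<T} \<inter> {0..<snd nt i} = {0..<snd nt i}" "{0..<T} \<inter> {0..<snd nt (i - 1)} = {0..<snd nt (i - 1)}"
    using t[of i] t[of "i - 1"] i by auto
  then show "cmi M (PY {snd nt (i - 1)..<snd nt i}) (PX {0..<snd nt i}) (PY {0..<snd nt (i - 1)})
      (\<lambda>\<omega>. restrict (restrict (Y \<omega>) {0..<T}) {snd nt (i - 1)..<snd nt i})
      (\<lambda>\<omega>. restrict (restrict (X \<omega>) {0..<T}) {0..<snd nt i})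
      (\<lambda>\<omega>. restrict (restrict (Y \<omega>) {0..<T}) {0..<snd nt (i - 1)}) = block_cmi (snd nt (i - 1)) (snd nt i)"
    by (simp add: block_cmi_def)
qed

end

context feedback_channel
begin

text \<open>The lower bound for a block term holds at every block length, so it telescopes along
  every partition.\<close>

lemma DI_lower:
  "ereal (cY 0 A - cY T A) \<le> DI"
  unfolding DI_eq
proof (rule INF_greatest)
  fix nt assume nt: "nt \<in> partitions T"
  define n t where "n = fst nt" and "t = snd nt"
  have t: "t 0 = 0" "t n = T" "\<And>i. i < n \<Longrightarrow> t i < t (Suc i)"
    using nt by (auto simp: n_def t_def partitions_def)
  have b: "0 \<le> t j" "t j \<le> T" if "j \<le> n" for j
    using partition_bounds[OF nt] that by (auto simp: n_def t_def)
  have "ereal (cY 0 A - cY T A) = ereal (\<Sum>i<n. cY (t i) A - cY (t (Suc i)) A)"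
    using sum_lessThan_telescope'[of "\<lambda>i. cY (t i) A" n] t by simp
  also have "\<dots> = (\<Sum>i<n. ereal (cY (t i) A - cY (t (Suc i)) A))" by simp
  also have "\<dots> \<le> (\<Sum>i<n. block_cmi (t i) (t (Suc i)))"
    unfolding block_cmi_def
    by (intro sum_mono cmi_block_lower) (use b t(3) in \<open>auto simp: less_imp_le\<close>)
  also have "\<dots> = (\<Sum>i\<in>{1..n}. block_cmi (t (i - 1)) (t i))"
    by (rule sum.reindex_bij_witness[of _ "\<lambda>i. i - 1" Suc]) auto
  finally show "ereal (cY 0 A - cY T A) \<le> (\<Sum>i\<in>{1..fst nt}. block_cmi (snd nt (i - 1)) (snd nt i))"
    by (simp add: n_def t_def)
qed

text \<open>For an infimum one partition suffices: a uniform one of mesh at most \<Delta>, where the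
  block terms are bounded above.\<close>

lemma DI_upper:
  assumes T: "T > 0"
  shows "DI \<le> ereal (cY 0 A - cY T A)"
proof -
  obtain n :: nat where n: "n > 0" "T \<le> real n * \<Delta>"
  proof -
    obtain m :: nat where "T / \<Delta> \<le> real m" using real_arch_simple by blast
    then have "T \<le> real m * \<Delta>" using delay by (simp add: divide_le_eq)
    then have "T \<le> real (Suc m) * \<Delta>" using delay by (simp add: algebra_simps)
    then show thesis by (intro that[of "Suc m"]) auto
  qed
  define t where "t i = real i * (T / real n)" for i
  have tn: "t 0 = 0" "t n = T" using n by (auto simp: t_def)
  have step: "t (Suc i) = t i + T / real n" for i by (simp add: t_def distrib_right add_divide_distrib)
  have p: "(n, t) \<in> partitions T" using n T tn by (auto simp: partitions_def step)
  have b: "0 \<le> t j" "t j \<le> T" if "j \<le> n" for j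
    using partition_bounds[OF p] that by auto
  have "DI \<le> (\<Sum>i\<in>{1..n}. block_cmi (t (i - 1)) (t i))"
    unfolding DI_eq by (rule INF_lower2[OF p]) simp
  also have "\<dots> = (\<Sum>i<n. block_cmi (t i) (t (Suc i)))"
    by (rule sum.reindex_bij_witness[of _ Suc "\<lambda>i. i - 1"]) auto
  also have "\<dots> \<le> (\<Sum>i<n. ereal (cY (t i) A - cY (t (Suc i)) A))"
    unfolding block_cmi_def
  proof (intro sum_mono cmi_block_upper)
    fix i assume i: "i \<in> {..<n}"
    show "0 \<le> t i" "t (Suc i) \<le> T" using b i by auto
    show "t i \<le> t (Suc i)" using T by (simp add: step)
    show "t (Suc i) \<le> t i + \<Delta>" using n by (simp add: step divide_le_eq mult.commute)
  qed
  also have "\<dots> = ereal (\<Sum>i<n. cY (t i) A - cY (t (Suc i)) A)" by simp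
  also have "\<dots> = ereal (cY 0 A - cY T A)"
    using sum_lessThan_telescope'[of "\<lambda>i. cY (t i) A" n] tn by simp
  finally show ?thesis .
qed

lemma DI_fano:
  assumes T: "T > 0" and K: "finite K" "A ` space M \<subseteq> K" "card K = N" and dec: "dec \<in> measurable (PY {0..<T}) (count_space UNIV)"
    and unif: "\<And>k. k \<in> K \<Longrightarrow> prob (A -` {k} \<inter> space M) = 1 / real N"
  shows "ereal ((1 - prob {\<omega>\<in>space M. dec (Yr {0..<T} \<omega>) \<noteq> A \<omega>}) * log 2 N - 1) \<le> DI"
proof -
  have Y: "Yr {0..<T} \<in> measurable M (PY {0..<T})" by (rule Yr_measurable) simp
  have "cY T A \<le> 1 + prob {\<omega>\<in>space M. dec (Yr {0..<T} \<omega>) \<noteq> A \<omega>} * log 2 N"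
    unfolding cY_def
    by (rule fano[OF subalgebra_gen_alg[OF Y] A(1) K measurable_compose[OF measurable_gen_alg[OF Y] dec]])
  moreover have "cY 0 A = log 2 N"
  proof -
    have "space M \<noteq> {}" by (rule not_empty)
    then have N: "N \<ge> 1" using K by (auto simp: Suc_le_eq card_gt_0_iff)
    \<comment> \<open>Every value in K has positive probability, so it is attained, and the entropy
      of A is exactly log N.\<close>
    have im: "A ` space M = K"
    proof
      show "K \<subseteq> A ` space M"
      proof
        fix k assume k: "k \<in> K"
        have "A -` {k} \<inter> space M \<noteq> {}" using unif[OF k] N by (metis divide_eq_0_iff measure_empty of_nat_0_eq_iff not_one_le_zero zero_neq_one)
        then show "k \<in> A ` space M" by auto
      qed
    qed (rule K)
    have "cY 0 A = (\<Sum>k\<in>K. eta (1 / real N))"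
      using T unif by (subst cY_0) (auto simp: im)
    also have "\<dots> = log 2 N" using N K by (simp add: eta_def log_divide)
    finally show ?thesis .
  qed
  ultimately have "(1 - prob {\<omega>\<in>space M. dec (Yr {0..<T} \<omega>) \<noteq> A \<omega>}) * log 2 N - 1 \<le> cY 0 A - cY T A"
    by (simp add: algebra_simps)
  then have "ereal ((1 - prob {\<omega>\<in>space M. dec (Yr {0..<T} \<omega>) \<noteq> A \<omega>}) * log 2 N - 1) \<le> ereal (cY 0 A - cY T A)" by simp
  then show ?thesis using DI_lower by (rule order_trans)
qed

end

section \<open>Invariance of directed information under almost sure modification\<close>

lemma (in prob_space) mutual_information_cong_AE:
  assumes m: "U \<in> measurable M S" "U' \<in> measurable M S" "V \<in> measurable M T" "V' \<in> measurable M T"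
    and ae: "AE x in M. U x = U' x" "AE x in M. V x = V' x"
  shows "mutual_information b S T U V = mutual_information b S T U' V'"
proof -
  have "distr M S U = distr M S U'" by (rule distr_cong_AE) (use m ae in auto)
  moreover have "distr M T V = distr M T V'" by (rule distr_cong_AE) (use m ae in auto)
  moreover have "distr M (S \<Otimes>\<^sub>M T) (\<lambda>x. (U x, V x)) = distr M (S \<Otimes>\<^sub>M T) (\<lambda>x. (U' x, V' x))"
  proof (rule distr_cong_AE)
    show "AE x in M. (U x, V x) = (U' x, V' x)" using ae by eventually_elim simp
  qed (use m in auto)
  ultimately show ?thesis by (simp add: mutual_information_def)
qed

lemma (in prob_space) cmi_cong_AE:
  assumes m: "U \<in> measurable M SU" "U' \<in> measurable M SU" "V \<in> measurable M SV" "V' \<in> measurable M SV"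
      "W \<in> measurable M SW" "W' \<in> measurable M SW"
    and ae: "AE x in M. U x = U' x" "AE x in M. V x = V' x" "AE x in M. W x = W' x"
  shows "cmi M SU SV SW U V W = cmi M SU SV SW U' V' W'"
  unfolding cmi_def
proof (rule SUP_cong[OF refl])
  fix qr :: "('b \<Rightarrow> nat) \<times> ('c \<Rightarrow> nat)"
  assume "qr \<in> {(q, r). q \<in> SU \<rightarrow>\<^sub>M count_space UNIV \<and> finite (q ` space SU) \<and> r \<in> SV \<rightarrow>\<^sub>M count_space UNIV \<and> finite (r ` space SV)}"
  then have q: "fst qr \<in> measurable SU (count_space UNIV)" and r: "snd qr \<in> measurable SV (count_space UNIV)" by auto
  have qU: "fst qr \<circ> U \<in> measurable M (count_space UNIV)" "fst qr \<circ> U' \<in> measurable M (count_space UNIV)"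
    by (rule measurable_comp[OF m(1) q], rule measurable_comp[OF m(2) q])
  have rV: "snd qr \<circ> V \<in> measurable M (count_space UNIV)" "snd qr \<circ> V' \<in> measurable M (count_space UNIV)"
    by (rule measurable_comp[OF m(3) r], rule measurable_comp[OF m(4) r])
  have rVW: "(\<lambda>x. ((snd qr \<circ> V) x, W x)) \<in> measurable M (count_space UNIV \<Otimes>\<^sub>M SW)"
    "(\<lambda>x. ((snd qr \<circ> V') x, W' x)) \<in> measurable M (count_space UNIV \<Otimes>\<^sub>M SW)"
    using rV m by (auto intro!: measurable_Pair simp: comp_def)
  have "AE x in M. (fst qr \<circ> U) x = (fst qr \<circ> U') x" using ae(1) by eventually_elim simp
  moreover have "AE x in M. ((snd qr \<circ> V) x, W x) = ((snd qr \<circ> V') x, W' x)"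
    using ae(2,3) by eventually_elim simp
  ultimately show "ereal (conditional_mutual_information 2 (count_space UNIV) (count_space UNIV) SW (fst qr \<circ> U) (snd qr \<circ> V) W)
     = ereal (conditional_mutual_information 2 (count_space UNIV) (count_space UNIV) SW (fst qr \<circ> U') (snd qr \<circ> V') W')"
    unfolding conditional_mutual_information_def
    using mutual_information_cong_AE[OF qU rVW] mutual_information_cong_AE[OF qU m(5,6) _ ae(3)] by simp
qed

lemma (in prob_space) directed_info_cong_AE:
  assumes m: "X \<in> measurable M (PiM {0..<T} (\<lambda>_. SX))" "X' \<in> measurable M (PiM {0..<T} (\<lambda>_. SX))"
      "Y \<in> measurable M (PiM {0..<T} (\<lambda>_. SY))" "Y' \<in> measurable M (PiM {0..<T} (\<lambda>_. SY))"
    and ae: "AE x in M. X x = X' x" "AE x in M. Y x = Y' x"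
  shows "directed_info M SX SY X Y T = directed_info M SX SY X' Y' T"
  unfolding directed_info_def Let_def
proof (intro INF_cong refl sum.cong)
  fix nt i assume nt: "nt \<in> partitions T" and i: "i \<in> {1..fst nt}"
  define a b where "a = snd nt (i - 1)" and "b = snd nt i"
  have ab: "0 \<le> a" "a \<le> T" "0 \<le> b" "b \<le> T"
    using partition_bounds[OF nt, of "i - 1"] partition_bounds[OF nt, of i] i by (auto simp: a_def b_def)
  have r: "(\<lambda>x. restrict (h x) J) \<in> measurable M (PiM J (\<lambda>_. S))"
    if "h \<in> measurable M (PiM {0..<T} (\<lambda>_. S))" "J \<subseteq> {0..<T}" for h :: "_ \<Rightarrow> real \<Rightarrow> 's" and S :: "'s measure" and J
    by (rule measurable_compose[OF that(1) measurable_restrict_subset[OF that(2)]])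
  show "cmi M (PiM {snd nt (i - 1)..<snd nt i} (\<lambda>_. SY)) (PiM {0..<snd nt i} (\<lambda>_. SX)) (PiM {0..<snd nt (i - 1)} (\<lambda>_. SY))
      (\<lambda>\<omega>. restrict (Y \<omega>) {snd nt (i - 1)..<snd nt i}) (\<lambda>\<omega>. restrict (X \<omega>) {0..<snd nt i}) (\<lambda>\<omega>. restrict (Y \<omega>) {0..<snd nt (i - 1)})
    = cmi M (PiM {snd nt (i - 1)..<snd nt i} (\<lambda>_. SY)) (PiM {0..<snd nt i} (\<lambda>_. SX)) (PiM {0..<snd nt (i - 1)} (\<lambda>_. SY))
      (\<lambda>\<omega>. restrict (Y' \<omega>) {snd nt (i - 1)..<snd nt i}) (\<lambda>\<omega>. restrict (X' \<omega>) {0..<snd nt i}) (\<lambda>\<omega>. restrict (Y' \<omega>) {0..<snd nt (i - 1)})"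
    unfolding a_def[symmetric] b_def[symmetric]
  proof (rule cmi_cong_AE)
    show "AE x in M. restrict (Y x) {a..<b} = restrict (Y' x) {a..<b}" using ae(2) by eventually_elim simp
    show "AE x in M. restrict (X x) {0..<b} = restrict (X' x) {0..<b}" using ae(1) by eventually_elim simp
    show "AE x in M. restrict (Y x) {0..<a} = restrict (Y' x) {0..<a}" using ae(2) by eventually_elim simp
  qed (use m ab in \<open>auto intro!: r\<close>)
qed

text \<open>A random variable with law p is defined on all of UNIV; the projection makes its range finite
  without changing it almost surely.\<close>

definition supp_proj :: "'u pmf \<Rightarrow> 'u \<Rightarrow> 'u" where
  "supp_proj p u = (if u \<in> set_pmf p then u else (SOME v. v \<in> set_pmf p))"

lemma supp_proj_in: "supp_proj p u \<in> set_pmf p"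
  using set_pmf_not_empty[of p] by (auto simp: supp_proj_def intro: someI_ex)

lemma supp_proj_id: "u \<in> set_pmf p \<Longrightarrow> supp_proj p u = u"
  by (simp add: supp_proj_def)

text \<open>The whole path u is treated as one finite-valued variable, although the strategy reads
  only its value u t at time t.\<close>

locale channel_input =
  fixes SX :: "'x measure" and SY :: "'y measure" and SZ :: "'z measure" and g :: "'x \<Rightarrow> 'z \<Rightarrow> 'y"
    and mu :: "(real \<Rightarrow> 'z) measure" and \<Delta> T :: real
    and p :: "(real \<Rightarrow> nat) pmf" and gs :: "real \<Rightarrow> nat \<Rightarrow> (real \<Rightarrow> 'y) \<Rightarrow> 'x"
  assumes g_meas: "(\<lambda>(x, z). g x z) \<in> measurable (SX \<Otimes>\<^sub>M SZ) SY" and pos: "\<Delta> > 0"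
    and mu: "prob_space mu" "sets mu = sets (PiM {0..} (\<lambda>_. SZ))"
    and adm: "(p, gs) \<in> admissible_inputs SX SY \<Delta> T"
begin

abbreviation "P \<equiv> measure_pmf p \<Otimes>\<^sub>M mu"
definition "A \<omega> = supp_proj p (fst \<omega>)" for \<omega> :: "(real \<Rightarrow> nat) \<times> (real \<Rightarrow> 'z)"

lemma fin: "finite (set_pmf p)" using adm by (simp add: admissible_inputs_def)

lemma strategy_measurable:
  assumes "t \<in> {0..<T}"
  shows "(\<lambda>(u, y). aux_strategy gs t u y) \<in> measurable (count_space UNIV \<Otimes>\<^sub>M PiM {0..<t - \<Delta>} (\<lambda>_. SY)) SX"
proof -
  have gs: "(\<lambda>(k, y). gs t k y) \<in> measurable (count_space UNIV \<Otimes>\<^sub>M PiM {0..<t - \<Delta>} (\<lambda>_. SY)) SX"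
    using adm assms by (auto simp: admissible_inputs_def)
  have "(\<lambda>uy. (fst uy t, snd uy)) \<in> measurable (count_space UNIV \<Otimes>\<^sub>M PiM {0..<t - \<Delta>} (\<lambda>_. SY)) (count_space UNIV \<Otimes>\<^sub>M PiM {0..<t - \<Delta>} (\<lambda>_. SY))"
    by (intro measurable_Pair measurable_compose[OF measurable_fst] measurable_snd) simp
  from measurable_compose[OF this gs] show ?thesis
    by (simp add: aux_strategy_def split_beta)
qed

lemma fst_measurable: "fst \<in> measurable P (count_space UNIV)"
  using measurable_fst[of "measure_pmf p" mu]
  by (simp add: measurable_cong_sets[OF refl sets_measure_pmf_count_space])

lemma A_measurable: "A \<in> measurable P (count_space UNIV)"
  unfolding A_def[abs_def] by (rule measurable_compose[OF measurable_fst]) simp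

lemma snd_measurable: "snd \<in> measurable P (PiM {0..} (\<lambda>_. SZ))"
  using measurable_snd[of "measure_pmf p" mu] by (simp add: measurable_cong_sets[OF refl mu(2)])

sublocale P: prob_space P
proof -
  interpret mu: prob_space mu by (rule mu)
  interpret pair_prob_space "measure_pmf p" mu ..
  show "prob_space P" by unfold_locales
qed

lemma prob_prod:
  assumes B: "B \<in> sets mu"
  shows "measure P (D \<times> B) = measure (measure_pmf p) D * measure mu B"
proof -
  interpret mu: prob_space mu by (rule mu)
  show ?thesis
    by (simp add: measure_def mu.emeasure_pair_measure_Times[of D "measure_pmf p" B] B enn2real_mult)
qed

lemma AE_fst: "AE \<omega> in P. A \<omega> = fst \<omega>"
proof -
  interpret mu: prob_space mu by (rule mu)
  interpret pair_prob_space "measure_pmf p" mu ..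
  have "AE u in measure_pmf p. AE z in mu. A (u, z) = fst (u, z)"
    by (auto simp: AE_measure_pmf_iff A_def supp_proj_id)
  then show ?thesis
  proof (rule AE_pair_measure[rotated])
    have "(\<lambda>\<omega>. fst \<omega>) -` {u. supp_proj p u = u} \<inter> space P \<in> sets P"
      by (rule measurable_sets[OF fst_measurable]) simp
    moreover have "(\<lambda>\<omega>. fst \<omega>) -` {u. supp_proj p u = u} \<inter> space P = {\<omega> \<in> space P. A \<omega> = fst \<omega>}"
      by (auto simp: A_def)
    ultimately show "{\<omega> \<in> space P. A \<omega> = fst \<omega>} \<in> sets P" by simp
  qed
qed

sublocale ch: feedback_channel P SX SY SZ g \<Delta> T "aux_strategy gs" A snd
proof
  show "finite (A ` space P)"
    by (rule finite_subset[OF _ fin]) (auto simp: A_def supp_proj_in)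
  fix k B assume B: "B \<in> sets (PiM {0::real..} (\<lambda>_. SZ))"
  have Bm: "B \<in> sets mu" using B mu by simp
  have Bs: "B \<subseteq> space mu" by (rule sets.sets_into_space[OF Bm])
  have "{\<omega> \<in> space P. A \<omega> = k} \<inter> {\<omega> \<in> space P. snd \<omega> \<in> B} = {u. supp_proj p u = k} \<times> B"
    using Bs by (auto simp: A_def space_pair_measure)
  moreover have "{\<omega> \<in> space P. A \<omega> = k} = {u. supp_proj p u = k} \<times> space mu"
    by (auto simp: A_def space_pair_measure)
  moreover have "{\<omega> \<in> space P. snd \<omega> \<in> B} = UNIV \<times> B"
    using Bs by (auto simp: space_pair_measure)
  moreover have "measure mu (space mu) = 1" using mu(1) by (rule prob_space.prob_space)
  moreover have "measure (measure_pmf p) UNIV = 1" using measure_pmf.prob_space[of p] by simp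
  ultimately show "P.prob ({\<omega> \<in> space P. A \<omega> = k} \<inter> {\<omega> \<in> space P. snd \<omega> \<in> B}) =
     P.prob {\<omega> \<in> space P. A \<omega> = k} * P.prob {\<omega> \<in> space P. snd \<omega> \<in> B}"
    using prob_prod[OF Bm] prob_prod[OF sets.top] by simp
qed (use g_meas pos A_measurable snd_measurable strategy_measurable in auto)

lemma directed_info_eq:
  "directed_info P SX SY (\<lambda>\<omega>. in_path g \<Delta> T (aux_strategy gs) (fst \<omega>) (snd \<omega>))
      (\<lambda>\<omega>. out_path g \<Delta> T (aux_strategy gs) (fst \<omega>) (snd \<omega>)) T = ch.DI"
  unfolding ch.DI_def
proof (rule P.directed_info_cong_AE)
  let ?f = "aux_strategy gs"
  have run: "(\<lambda>\<omega>. run g \<Delta> ?f (fst \<omega>) (snd \<omega>) t) \<in> measurable P SY" if "t \<in> {0..<T}" for t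
    by (rule run_measurable[OF g_meas pos fst_measurable snd_measurable strategy_measurable that])
  show "(\<lambda>\<omega>. out_path g \<Delta> T ?f (fst \<omega>) (snd \<omega>)) \<in> measurable P (PiM {0..<T} (\<lambda>_. SY))"
    unfolding out_path_eq[OF pos] by (rule measurable_restrict) (rule run)
  show "(\<lambda>\<omega>. in_path g \<Delta> T ?f (fst \<omega>) (snd \<omega>)) \<in> measurable P (PiM {0..<T} (\<lambda>_. SX))"
    unfolding in_path_eq[OF pos]
  proof (rule measurable_restrict)
    fix t assume t: "t \<in> {0..<T}"
    have "(\<lambda>\<omega>. restrict (run g \<Delta> ?f (fst \<omega>) (snd \<omega>)) {0..<t - \<Delta>}) \<in> measurable P (PiM {0..<t - \<Delta>} (\<lambda>_. SY))"
      by (rule measurable_restrict, rule run) (use t pos in auto)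
    then have "(\<lambda>\<omega>. (fst \<omega>, restrict (run g \<Delta> ?f (fst \<omega>) (snd \<omega>)) {0..<t - \<Delta>})) \<in> measurable P (count_space UNIV \<Otimes>\<^sub>M PiM {0..<t - \<Delta>} (\<lambda>_. SY))"
      using fst_measurable by simp
    from measurable_compose[OF this strategy_measurable[OF t]]
    show "(\<lambda>\<omega>. ?f t (fst \<omega>) (restrict (run g \<Delta> ?f (fst \<omega>) (snd \<omega>)) {0..<t - \<Delta>})) \<in> measurable P SX" by simp
  qed
  show "AE \<omega> in P. in_path g \<Delta> T ?f (fst \<omega>) (snd \<omega>) = restrict (ch.X \<omega>) {0..<T}"
    using AE_fst by eventually_elim (simp add: in_path_eq[OF pos] ch.X_def[abs_def] ch.Y_def)
  show "AE \<omega> in P. out_path g \<Delta> T ?f (fst \<omega>) (snd \<omega>) = restrict (ch.Y \<omega>) {0..<T}"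
    using AE_fst by eventually_elim (simp add: out_path_eq[OF pos] ch.Y_def)
qed (use ch.Xr_measurable ch.Yr_measurable in auto)

end

section \<open>Codes as admissible inputs, and the converse\<close>

lemma run_cong_strategy: "(\<And>t y. f t a y = f' t a' y) \<Longrightarrow> run g \<Delta> f a z = run g \<Delta> f' a' z"
  unfolding run_def by (simp only:)

lemma out_path_measurable:
  assumes g: "(\<lambda>(x, z). g x z) \<in> measurable (SX \<Otimes>\<^sub>M SZ) SY" and \<Delta>: "\<Delta> > 0"
    and mu: "sets mu = sets (PiM {0..} (\<lambda>_. SZ))"
    and f: "\<And>t. t \<in> {0..<T} \<Longrightarrow> (\<lambda>(m, y). f t m y) \<in> measurable (count_space UNIV \<Otimes>\<^sub>M PiM {0..<t - \<Delta>} (\<lambda>_. SY)) SX"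
  shows "(\<lambda>z. out_path g \<Delta> T f a z) \<in> measurable mu (PiM {0..<T} (\<lambda>_. SY))"
  unfolding out_path_eq[OF \<Delta>]
proof (rule measurable_restrict)
  fix t assume "t \<in> {0..<T}"
  have "(\<lambda>z. z) \<in> measurable mu (PiM {0..} (\<lambda>_. SZ))"
    using measurable_ident by (simp add: measurable_cong_sets[OF mu refl])
  from run_measurable[OF g \<Delta> measurable_const this f \<open>t \<in> {0..<T}\<close>, of a]
  show "(\<lambda>z. run g \<Delta> f a z t) \<in> measurable mu SY" by simp
qed

context channel_input
begin

lemma prob_rect:
  assumes B: "B \<in> sets mu"
  shows "P.prob ({u. supp_proj p u = k} \<times> B) = pmf p k * measure mu B"
proof -
  have "measure (measure_pmf p) {u. supp_proj p u = k} = measure (measure_pmf p) {k}"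
  proof (rule measure_pmf.finite_measure_eq_AE)
    show "AE u in measure_pmf p. (u \<in> {u. supp_proj p u = k}) = (u \<in> {k})"
      by (auto simp: AE_measure_pmf_iff supp_proj_id)
  qed auto
  then show ?thesis using prob_prod[OF B] by (simp add: pmf.rep_eq)
qed

lemma A_vimage: "A -` {k} \<inter> space P = {u. supp_proj p u = k} \<times> space mu"
  by (auto simp: A_def space_pair_measure)

lemma prob_A: "P.prob (A -` {k} \<inter> space P) = pmf p k"
  using prob_rect[OF sets.top, of k] mu(1) by (simp add: A_vimage prob_space.prob_space)

end

lemma code_directed_info:
  assumes g: "(\<lambda>(x, z). g x z) \<in> measurable (SX \<Otimes>\<^sub>M SZ) SY" and \<Delta>: "\<Delta> > 0"
    and mu: "prob_space mu" "sets mu = sets (PiM {0..} (\<lambda>_. SZ))" and T: "T > 0"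
    and code: "is_code SX SY \<Delta> T R enc dec"
  shows "ereal ((1 - err_prob g mu \<Delta> T R enc dec) * log 2 (num_msgs T R) - 1) \<le> sup_directed_info SX SY g mu \<Delta> T"
    and "err_prob g mu \<Delta> T R enc dec \<le> 1"
proof -
  define N where "N = num_msgs T R"
  have N: "N > 0" by (simp add: N_def num_msgs_def)
  \<comment> \<open>A strategy sees only the current value of U, so the message is sent as a
    constant path; \<open>c\<close> is injective, and decoding to the path amounts to decoding to
    the message.\<close>
  define c where "c m = (\<lambda>_::real. m)" for m :: nat
  have inj: "inj_on c S" for S by (auto simp: inj_on_def c_def fun_eq_iff)
  define p where "p = map_pmf c (pmf_of_set {1..N})"
  have sp: "set_pmf p = c ` {1..N}" using N by (simp add: p_def)
  have pk: "pmf p (c m) = 1 / real N" if "m \<in> {1..N}" for m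
  proof -
    have "pmf (map_pmf c (pmf_of_set {1..N})) (c m) = pmf (pmf_of_set {1..N}) m"
      by (rule pmf_map_inj'[of c]) (auto simp: inj_on_def c_def fun_eq_iff)
    then show ?thesis using N that by (simp add: p_def)
  qed
  have encm: "(\<lambda>(m, y). enc t m y) \<in> measurable (count_space UNIV \<Otimes>\<^sub>M PiM {0..<t - \<Delta>} (\<lambda>_. SY)) SX"
    if "t \<in> {0..<T}" for t using code that by (auto simp: is_code_def)
  have dec: "dec \<in> measurable (PiM {0..<T} (\<lambda>_. SY)) (count_space UNIV)" using code by (simp add: is_code_def)
  have adm: "(p, enc) \<in> admissible_inputs SX SY \<Delta> T"
    using sp encm by (auto simp: admissible_inputs_def)
  interpret channel_input SX SY SZ g mu \<Delta> T p enc
    by (rule channel_input.intro[OF g \<Delta> mu adm])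
  interpret mu: prob_space mu by (rule mu)
  define E where "E = {\<omega> \<in> space P. c (dec (ch.Yr {0..<T} \<omega>)) \<noteq> A \<omega>}"
  define D where "D m = {z \<in> space mu. dec (out_path g \<Delta> T enc m z) \<noteq> m}" for m
  have D: "D m \<in> sets mu" for m
  proof -
    have "(\<lambda>z. dec (out_path g \<Delta> T enc m z)) \<in> measurable mu (count_space UNIV)"
      by (rule measurable_compose[OF out_path_measurable[OF g \<Delta> mu(2) encm] dec])
    from measurable_sets[OF this, of "- {m}"] show ?thesis
      by (simp add: D_def vimage_def Int_def conj_commute)
  qed
  \<comment> \<open>On the slice where the path is c m this is the error event of message m, so its
    probability becomes the average in \<open>err_prob\<close>.\<close>
  have "E = (\<Union>m\<in>{1..N}. {u. supp_proj p u = c m} \<times> D m)"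
  proof -
    have Y: "ch.Yr {0..<T} (u, z) = out_path g \<Delta> T enc m z" if "supp_proj p u = c m" for u z m
    proof -
      have "run g \<Delta> (aux_strategy enc) (c m) z = run g \<Delta> enc m z"
        by (rule run_cong_strategy) (simp add: aux_strategy_def c_def)
      then show ?thesis using that by (simp add: ch.Y_def A_def out_path_eq[OF \<Delta>])
    qed
    have cc: "c m = c m' \<longleftrightarrow> m = m'" for m m' by (simp add: c_def fun_eq_iff)
    show ?thesis
    proof (intro set_eqI iffI)
      fix \<omega> assume "\<omega> \<in> E"
      moreover obtain u z where uz: "\<omega> = (u, z)" by (cases \<omega>)
      moreover obtain m where m: "m \<in> {1..N}" "supp_proj p u = c m" using supp_proj_in[of p u] sp by auto
      ultimately have "z \<in> D m" using Y[OF m(2), of z]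
        by (simp add: E_def D_def A_def space_pair_measure cc)
      then show "\<omega> \<in> (\<Union>m\<in>{1..N}. {u. supp_proj p u = c m} \<times> D m)" using m uz by auto
    next
      fix \<omega> assume "\<omega> \<in> (\<Union>m\<in>{1..N}. {u. supp_proj p u = c m} \<times> D m)"
      then obtain m u z where m: "\<omega> = (u, z)" "supp_proj p u = c m" "z \<in> D m" by auto
      then show "\<omega> \<in> E" using Y[OF m(2), of z]
        by (simp add: E_def D_def A_def space_pair_measure cc)
    qed
  qed
  moreover have "P.prob (\<Union>m\<in>{1..N}. {u. supp_proj p u = c m} \<times> D m) = (\<Sum>m\<in>{1..N}. P.prob ({u. supp_proj p u = c m} \<times> D m))"
  proof (rule P.finite_measure_finite_Union)
    show "disjoint_family_on (\<lambda>m. {u. supp_proj p u = c m} \<times> D m) {1..N}"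
      by (auto simp: disjoint_family_on_def c_def fun_eq_iff)
    show "(\<lambda>m. {u. supp_proj p u = c m} \<times> D m) ` {1..N} \<subseteq> P.events"
      using D by (auto intro!: pair_measureI)
  qed simp
  ultimately have "P.prob E = (\<Sum>m\<in>{1..N}. P.prob ({u. supp_proj p u = c m} \<times> D m))"
    by (rule trans[OF arg_cong[where f="P.prob"]])
  also have "\<dots> = (\<Sum>m\<in>{1..N}. 1 / real N * measure mu (D m))"
    by (intro sum.cong refl) (simp only: prob_rect[OF D] pk)
  also have "\<dots> = err_prob g mu \<Delta> T R enc dec"
    by (simp add: err_prob_def N_def D_def sum_divide_distrib)
  finally have err: "P.prob E = err_prob g mu \<Delta> T R enc dec" .
  then show "err_prob g mu \<Delta> T R enc dec \<le> 1" using P.prob_le_1[of E] by simp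
  have "ereal ((1 - P.prob E) * log 2 N - 1) \<le> ch.DI"
    unfolding E_def
  proof (rule ch.DI_fano[OF T, where K="c ` {1..N}"])
    show "A ` space P \<subseteq> c ` {1..N}" using supp_proj_in[of p] by (auto simp: A_def sp)
    show "card (c ` {1..N}) = N" using card_image[OF inj] by simp
    show "(\<lambda>y. c (dec y)) \<in> measurable (PiM {0..<T} (\<lambda>_. SY)) (count_space UNIV)"
      by (rule measurable_compose[OF dec]) simp
    show "P.prob (A -` {k} \<inter> space P) = 1 / real N" if "k \<in> c ` {1..N}" for k
      using that pk by (auto simp: prob_A)
  qed simp
  also have "ch.DI \<le> sup_directed_info SX SY g mu \<Delta> T"
    unfolding directed_info_eq[symmetric] sup_directed_info_def
    by (rule SUP_upper2[OF adm]) simp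
  finally show "ereal ((1 - err_prob g mu \<Delta> T R enc dec) * log 2 (num_msgs T R) - 1) \<le> sup_directed_info SX SY g mu \<Delta> T"
    unfolding err N_def .
qed

lemma achievable_le_info_limit:
  assumes g: "(\<lambda>(x, z). g x z) \<in> measurable (SX \<Otimes>\<^sub>M SZ) SY" and \<Delta>: "\<Delta> > 0"
    and mu: "prob_space mu" "sets mu = sets (PiM {0..} (\<lambda>_. SZ))"
    and lim: "(info_rate SX SY g mu \<Delta> \<longlongrightarrow> L) at_top" and ach: "achievable SX SY g mu \<Delta> R"
  shows "ereal R \<le> L"
proof -
  obtain enc dec where code: "\<And>T. T > 0 \<Longrightarrow> is_code SX SY \<Delta> T R (enc T) (dec T)"
    and err: "((\<lambda>T. err_prob g mu \<Delta> T R (enc T) (dec T)) \<longlongrightarrow> 0) at_top"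
    using ach by (auto simp: achievable_def)
  define er where "er T = err_prob g mu \<Delta> T R (enc T) (dec T)" for T
  \<comment> \<open>One 1 / T comes from rounding T R down, the other from the additive bit in
    Fano's inequality.\<close>
  define l where "l T = (1 - er T) * (R - 1 / T) - 1 / T" for T
  have inv: "((\<lambda>T::real. 1 / T) \<longlongrightarrow> 0) at_top"
    using tendsto_inverse_0_at_top[OF filterlim_ident] by (simp add: inverse_eq_divide)
  have "(l \<longlongrightarrow> (1 - 0) * (R - 0) - 0) at_top"
    unfolding l_def[abs_def] er_def using err inv by (intro tendsto_intros)
  then have "((\<lambda>T. ereal (l T)) \<longlongrightarrow> ereal R) at_top" by simp
  moreover have "\<forall>\<^sub>F T in at_top. ereal (l T) \<le> info_rate SX SY g mu \<Delta> T"
    using eventually_gt_at_top[of 0]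
  proof eventually_elim
    case (elim T)
    note b = code_directed_info[OF g \<Delta> mu elim code[OF elim]]
    have lg: "log 2 (num_msgs T R) = real (nat \<lfloor>T * R\<rfloor>)"
      by (simp add: num_msgs_def log_nat_power)
    have "T * R - 1 \<le> real (nat \<lfloor>T * R\<rfloor>)" by linarith
    then have "(1 - er T) * (T * R - 1) \<le> (1 - er T) * log 2 (num_msgs T R)"
      unfolding lg using b(2) by (intro mult_left_mono) (auto simp: er_def)
    then have "1 / T * ((1 - er T) * (T * R - 1) - 1) \<le> 1 / T * ((1 - er T) * log 2 (num_msgs T R) - 1)"
      using elim by (intro mult_left_mono) auto
    moreover have "1 / T * ((1 - er T) * (T * R - 1) - 1) = l T"
      using elim by (simp add: l_def field_simps)
    ultimately have "ereal (l T) \<le> ereal (1 / T) * ereal ((1 - er T) * log 2 (num_msgs T R) - 1)"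
      by simp
    also have "\<dots> \<le> ereal (1 / T) * sup_directed_info SX SY g mu \<Delta> T"
      using b(1) elim unfolding er_def by (intro ereal_mult_left_mono) auto
    finally show ?case by (simp add: info_rate_def)
  qed
  ultimately show ?thesis
    using lim by (intro tendsto_le[of at_top "info_rate SX SY g mu \<Delta>" L "\<lambda>T. ereal (l T)"]) auto
qed

subsection \<open>An ergodic lower tail bound\<close>

definition birkhoff :: "('a \<Rightarrow> 'a) \<Rightarrow> ('a \<Rightarrow> real) \<Rightarrow> nat \<Rightarrow> 'a \<Rightarrow> real" where
  "birkhoff \<tau> f n x = (\<Sum>k<n. f ((\<tau> ^^ k) x))"

lemma birkhoff_Suc: "birkhoff \<tau> f (Suc n) x = f x + birkhoff \<tau> f n (\<tau> x)"
  by (simp add: birkhoff_def sum.lessThan_Suc_shift funpow_swap1 del: sum.lessThan_Suc)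

text \<open>The maximum of the Birkhoff sums of lengths 0 to n, in the recursive form that turns the
  maximal ergodic inequality into a one-step comparison.\<close>

fun birkhoff_max :: "('a \<Rightarrow> 'a) \<Rightarrow> ('a \<Rightarrow> real) \<Rightarrow> nat \<Rightarrow> 'a \<Rightarrow> real" where
  "birkhoff_max \<tau> f 0 x = 0"
| "birkhoff_max \<tau> f (Suc n) x = max 0 (f x + birkhoff_max \<tau> f n (\<tau> x))"

lemma birkhoff_max_nonneg: "0 \<le> birkhoff_max \<tau> f n x"
  by (cases n) auto

lemma birkhoff_max_mono: "birkhoff_max \<tau> f n x \<le> birkhoff_max \<tau> f (Suc n) x"
proof (induction n arbitrary: x)
  case (Suc n)
  have "f x + birkhoff_max \<tau> f n (\<tau> x) \<le> f x + birkhoff_max \<tau> f (Suc n) (\<tau> x)"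
    using Suc[of "\<tau> x"] by simp
  then show ?case by (simp only: birkhoff_max.simps(2)[of \<tau> f n x] birkhoff_max.simps(2)[of \<tau> f "Suc n" x] max.mono order_refl)
qed simp

lemma birkhoff_le_max: "birkhoff \<tau> f n x \<le> birkhoff_max \<tau> f n x"
proof (induction n arbitrary: x)
  case (Suc n)
  show ?case using Suc[of "\<tau> x"] by (simp add: birkhoff_Suc)
qed (simp add: birkhoff_def)

lemma birkhoff_max_bound:
  assumes "\<And>x. \<bar>f x\<bar> \<le> B"
  shows "birkhoff_max \<tau> f n x \<le> real n * B"
proof (induction n arbitrary: x)
  case (Suc n)
  have "0 \<le> B" using assms[of x] by simp
  then have "0 \<le> real (Suc n) * B" by simp
  moreover have "f x \<le> B" using assms[of x] by simp
  ultimately show ?case using Suc[of "\<tau> x"] by (simp add: algebra_simps)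
qed simp

context prob_space
begin

text \<open>Garsia's argument. Let M_n be the maximum. Where M_(m+1) > 0 it equals f plus M_m at
  \<tau> x, elsewhere it is 0; so the difference of M_(m+1) at x and M_m at \<tau> x is at most f on
  the positive set and at most 0 off it. Its integral is nonnegative because \<tau> preserves the
  measure and M_m <= M_(m+1).\<close>

lemma maximal_ergodic:
  assumes \<tau>: "\<tau> \<in> measurable M M" "distr M M \<tau> = M"
    and f: "f \<in> borel_measurable M" and fb: "\<And>x. \<bar>f x\<bar> \<le> B"
  shows "0 \<le> (\<integral>x. indicator {x. birkhoff_max \<tau> f n x > 0} x * f x \<partial>M)"
proof (cases n)
  case (Suc m)
  have mm [measurable]: "birkhoff_max \<tau> f n \<in> borel_measurable M" for n
  proof (induction n)
    case (Suc n)
    have "(\<lambda>x. birkhoff_max \<tau> f n (\<tau> x)) \<in> borel_measurable M" by (rule measurable_compose[OF \<tau>(1) Suc])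
    then show ?case using f by (simp add: birkhoff_max.simps(2)[abs_def])
  qed simp
  note f [measurable]
  have B: "0 \<le> B" using fb[of undefined] by simp
  have i: "integrable M (birkhoff_max \<tau> f n)" for n
    by (rule integrable_bounded[where B="real n * B"])
      (simp_all add: abs_of_nonneg birkhoff_max_nonneg birkhoff_max_bound[of f B, OF fb])
  have it: "integrable M (\<lambda>x. birkhoff_max \<tau> f n (\<tau> x))" "(\<integral>x. birkhoff_max \<tau> f n (\<tau> x) \<partial>M) = (\<integral>x. birkhoff_max \<tau> f n x \<partial>M)" for n
    using integrable_distr_eq[OF \<tau>(1) mm, of n] integral_distr[OF \<tau>(1) mm, of n] i[of n] \<tau>(2) by simp_all
  have "0 \<le> (\<integral>x. birkhoff_max \<tau> f (Suc m) x \<partial>M) - (\<integral>x. birkhoff_max \<tau> f m x \<partial>M)"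
    using integral_mono[OF i i birkhoff_max_mono] by simp
  also have "\<dots> = (\<integral>x. birkhoff_max \<tau> f (Suc m) x - birkhoff_max \<tau> f m (\<tau> x) \<partial>M)"
    using i[of "Suc m"] it[of m] by (simp del: birkhoff_max.simps)
  also have "\<dots> \<le> (\<integral>x. indicator {x. birkhoff_max \<tau> f (Suc m) x > 0} x * f x \<partial>M)"
  proof (rule integral_mono)
    show "integrable M (\<lambda>x. birkhoff_max \<tau> f (Suc m) x - birkhoff_max \<tau> f m (\<tau> x))" using i[of "Suc m"] it[of m] by (simp del: birkhoff_max.simps)
    have "(\<lambda>x. if birkhoff_max \<tau> f (Suc m) x > 0 then f x else 0) \<in> borel_measurable M" using mm by measurable
    then have "(\<lambda>x. indicator {x. birkhoff_max \<tau> f (Suc m) x > 0} x * f x) \<in> borel_measurable M"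
      by (rule measurable_cong[THEN iffD1, rotated]) (simp add: indicator_def del: birkhoff_max.simps)
    then show "integrable M (\<lambda>x. indicator {x. birkhoff_max \<tau> f (Suc m) x > 0} x * f x)"
      by (rule integrable_bounded[where B=B]) (use fb B in \<open>auto simp: indicator_def\<close>)
    show "birkhoff_max \<tau> f (Suc m) x - birkhoff_max \<tau> f m (\<tau> x) \<le> indicator {x. birkhoff_max \<tau> f (Suc m) x > 0} x * f x" for x
      using birkhoff_max_nonneg[of \<tau> f m "\<tau> x"] by (auto simp: indicator_def max_def)
  qed
  finally show ?thesis unfolding Suc .
qed simp

text \<open>A one-sided consequence of the ergodic theorem is all that coding asks for. The event
  that the sums of f, whose mean is negative, are unbounded above is invariant; had it probability
  1, the maximal inequality would give f a nonnegative mean.\<close>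

lemma ergodic_lower_tail:
  assumes \<tau>: "\<tau> \<in> measurable M M" "distr M M \<tau> = M"
    and erg: "\<And>A. A \<in> events \<Longrightarrow> \<tau> -` A \<inter> space M = A \<Longrightarrow> prob A = 0 \<or> prob A = 1"
    and \<phi>: "\<phi> \<in> borel_measurable M" and \<phi>b: "\<And>x. \<bar>\<phi> x\<bar> \<le> B" and \<delta>: "\<delta> > 0"
  shows "(\<lambda>n. prob {x\<in>space M. birkhoff \<tau> \<phi> n x < real n * (expectation \<phi> - \<delta>)}) \<longlonglongrightarrow> 0"
proof -
  \<comment> \<open>Half of \<delta> makes the mean of f negative; the other half, times n,
    eventually exceeds the random bound on the sums of f.\<close>
  define f where "f x = expectation \<phi> - \<delta> / 2 - \<phi> x" for x
  define C where "C = \<bar>expectation \<phi> - \<delta> / 2\<bar> + B"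
  have fm [measurable]: "f \<in> borel_measurable M" unfolding f_def[abs_def] using \<phi> by measurable
  have fb: "\<bar>f x\<bar> \<le> C" for x using \<phi>b[of x] unfolding f_def C_def by linarith
  have C: "0 \<le> C" using fb[of undefined] by simp
  have \<phi>i: "integrable M \<phi>" by (rule integrable_bounded[OF \<phi> \<phi>b])
  have fE: "expectation f = - \<delta> / 2" unfolding f_def using \<phi>i by (simp add: prob_space)
  have sm: "birkhoff \<tau> h n \<in> borel_measurable M" if "h \<in> borel_measurable M" for h n
  proof -
    have "\<tau> ^^ k \<in> measurable M M" for k by (induction k) (auto intro: measurable_compose[OF _ \<tau>(1)])
    then show ?thesis unfolding birkhoff_def[abs_def]
      by (intro borel_measurable_sum) (rule measurable_compose[OF _ that])
  qed
  note [measurable] = sm[OF fm] sm[OF \<phi>]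
  define U where "U = {x\<in>space M. \<forall>b::nat. \<exists>n. birkhoff \<tau> f n x > real b}"
  have U [measurable]: "U \<in> events" unfolding U_def by measurable
  \<comment> \<open>Passing from x to \<tau> x drops one bounded summand, which does not affect
    unboundedness.\<close>
  have "\<tau> -` U \<inter> space M = U"
  proof (intro set_eqI iffI)
    fix x assume x: "x \<in> \<tau> -` U \<inter> space M"
    show "x \<in> U" unfolding U_def
    proof (intro CollectI conjI allI)
      fix b :: nat
      obtain n where n: "birkhoff \<tau> f n (\<tau> x) > real (b + nat \<lceil>C\<rceil>)" using x unfolding U_def by blast
      have "birkhoff \<tau> f (Suc n) x > real b"
        using n fb[of x] unfolding birkhoff_Suc by (simp add: abs_le_iff) linarith
      then show "\<exists>n. birkhoff \<tau> f n x > real b" ..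
    qed (use x in simp)
  next
    fix x assume x: "x \<in> U"
    then have xs: "x \<in> space M" by (simp add: U_def)
    have "\<tau> x \<in> U" unfolding U_def
    proof (intro CollectI conjI allI)
      fix b :: nat
      obtain n where n: "birkhoff \<tau> f n x > real (b + nat \<lceil>C\<rceil>)" using x unfolding U_def by blast
      then obtain m where m: "n = Suc m" by (cases n) (auto simp: birkhoff_def)
      have "birkhoff \<tau> f m (\<tau> x) > real b"
        using n fb[of x] unfolding m birkhoff_Suc by (simp add: abs_le_iff) linarith
      then show "\<exists>n. birkhoff \<tau> f n (\<tau> x) > real b" ..
    qed (use xs measurable_space[OF \<tau>(1)] in simp)
    then show "x \<in> \<tau> -` U \<inter> space M" using xs by simp
  qed
  from erg[OF U this] have "prob U = 0"
  proof
    assume "prob U = 1"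
    then have aeU: "AE x in M. x \<in> U" using U by (simp add: prob_eq_1)
    \<comment> \<open>At points of U the maximum is eventually positive, so these functions converge
      to f and the maximal inequality passes to the limit.\<close>
    define h where "h n x = indicator {x. birkhoff_max \<tau> f n x > 0} x * f x" for n x
    have hm: "h n \<in> borel_measurable M" for n
    proof -
      have mm [measurable]: "birkhoff_max \<tau> f n \<in> borel_measurable M" for n
      proof (induction n)
        case (Suc n)
        have "(\<lambda>x. birkhoff_max \<tau> f n (\<tau> x)) \<in> borel_measurable M" by (rule measurable_compose[OF \<tau>(1) Suc])
        then show ?case by (simp add: birkhoff_max.simps(2)[abs_def])
      qed simp
      have "(\<lambda>x. if birkhoff_max \<tau> f n x > 0 then f x else 0) \<in> borel_measurable M" by measurable
      then show ?thesis
        by (rule measurable_cong[THEN iffD1, rotated]) (simp add: indicator_def h_def)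
    qed
    have "(\<lambda>n. \<integral>x. h n x \<partial>M) \<longlonglongrightarrow> (\<integral>x. f x \<partial>M)"
    proof (rule integral_dominated_convergence[where w="\<lambda>_. C"])
      show "AE x in M. (\<lambda>n. h n x) \<longlonglongrightarrow> f x"
        using aeU
      proof eventually_elim
        case (elim x)
        then obtain n where n: "birkhoff \<tau> f n x > real 0" unfolding U_def by blast
        have mono: "birkhoff_max \<tau> f n x \<le> birkhoff_max \<tau> f m x" if "n \<le> m" for m
          using that by (induction rule: dec_induct) (auto intro: order_trans[OF _ birkhoff_max_mono] simp del: birkhoff_max.simps)
        have "\<forall>\<^sub>F m in sequentially. h m x = f x"
          using eventually_ge_at_top[of n]
        proof eventually_elim
          case (elim m)
          have "birkhoff_max \<tau> f m x > 0" using n birkhoff_le_max[of \<tau> f n x] mono[OF elim] by simp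
          then show ?case by (simp add: h_def)
        qed
        then show ?case by (rule tendsto_eventually)
      qed
      show "AE x in M. norm (h n x) \<le> C" for n using fb C by (auto simp: h_def indicator_def)
    qed (use hm in auto)
    moreover have "0 \<le> (\<integral>x. h n x \<partial>M)" for n
      unfolding h_def by (rule maximal_ergodic[OF \<tau> fm fb])
    ultimately have "0 \<le> (\<integral>x. f x \<partial>M)"
      by (intro tendsto_lowerbound) auto
    with fE \<delta> show ?thesis by simp
  qed
  then have aeU: "AE x in M. x \<notin> U" using U by (simp add: prob_eq_0)
  define D where "D n = {x\<in>space M. birkhoff \<tau> \<phi> n x < real n * (expectation \<phi> - \<delta>)}" for n
  have D [measurable]: "D n \<in> events" for n unfolding D_def by measurable
  have "(\<lambda>n. \<integral>x. indicat_real (D n) x \<partial>M) \<longlonglongrightarrow> (\<integral>x. 0 \<partial>M)"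
  proof (rule integral_dominated_convergence[where w="\<lambda>_. 1"])
    show "AE x in M. (\<lambda>n. indicat_real (D n) x) \<longlonglongrightarrow> 0"
      using aeU AE_space
    proof eventually_elim
      case (elim x)
      then obtain b :: nat where b: "\<And>n. birkhoff \<tau> f n x \<le> real b" by (auto simp: U_def not_less)
      have "birkhoff \<tau> f n x = real n * (expectation \<phi> - \<delta> / 2) - birkhoff \<tau> \<phi> n x" for n
        by (simp add: birkhoff_def f_def sum_subtractf)
      then have b': "real n * (expectation \<phi> - \<delta> / 2) - birkhoff \<tau> \<phi> n x \<le> real b" for n
        using b[of n] by simp
      have "\<forall>\<^sub>F n in sequentially. indicat_real (D n) x = 0"
        using eventually_ge_at_top[of "nat \<lceil>2 * real b / \<delta>\<rceil>"]
      proof eventually_elim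
        case (elim n)
        then have "2 * real b / \<delta> \<le> real n" by linarith
        then have "real b \<le> real n * (\<delta> / 2)" using \<delta> by (simp add: field_simps)
        then have "real n * (expectation \<phi> - \<delta>) \<le> birkhoff \<tau> \<phi> n x" using b'[of n] by (simp add: algebra_simps)
        then show ?case by (simp add: D_def)
      qed
      then show ?case by (rule tendsto_eventually)
    qed
  qed auto
  then show ?thesis by (simp add: D_def[symmetric])
qed

end

subsection \<open>Coding for a finite-alphabet block channel\<close>

lemma weighted_average_witness:
  fixes w h :: "'u \<Rightarrow> real"
  assumes "finite U" "\<And>u. u \<in> U \<Longrightarrow> 0 \<le> w u" "(\<Sum>u\<in>U. w u) = 1" "(\<Sum>u\<in>U. w u * h u) \<le> c"
  shows "\<exists>u\<in>U. h u \<le> c"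
proof (rule ccontr)
  assume "\<not> ?thesis"
  then have h: "\<And>u. u \<in> U \<Longrightarrow> c < h u" by auto
  obtain u0 where u0: "u0 \<in> U" "w u0 \<noteq> 0" using assms(3) by (metis sum.neutral zero_neq_one)
  have "(\<Sum>u\<in>U. w u * c) < (\<Sum>u\<in>U. w u * h u)"
  proof (rule sum_strict_mono_ex1[OF assms(1)])
    show "\<forall>u\<in>U. w u * c \<le> w u * h u" using assms(2) h by (simp add: mult_left_mono less_imp_le)
    have "w u0 > 0" using assms(2)[OF u0(1)] u0(2) by simp
    then show "\<exists>u\<in>U. w u * c < w u * h u" using u0 h by (intro bexI[of _ u0]) auto
  qed
  then show False using assms(3,4) by (simp flip: sum_distrib_right)
qed

text \<open>Codewords are picked one at a time. The decoder prefers large message numbers, so a new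
  codeword only ever confuses the older ones, and that effect is small on average over the new
  codeword.\<close>

lemma greedy_code:
  fixes w a :: "'u \<Rightarrow> real" and b :: "'u \<Rightarrow> 'u \<Rightarrow> real"
  assumes U: "finite U" "\<And>u. u \<in> U \<Longrightarrow> 0 \<le> w u" "(\<Sum>u\<in>U. w u) = 1"
    and a: "(\<Sum>u\<in>U. w u * a u) \<le> \<alpha>" and b: "\<And>u. u \<in> U \<Longrightarrow> (\<Sum>u'\<in>U. w u' * b u u') \<le> \<beta>" and \<beta>: "0 \<le> \<beta>"
  shows "\<exists>c. (\<forall>m. c m \<in> U) \<and>
    (\<Sum>m\<in>{1..N}. a (c m) + (\<Sum>m'\<in>{m<..N}. b (c m) (c m'))) \<le> real N * (\<alpha> + real N * \<beta>)"
proof (induction N)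
  case 0
  obtain u where "u \<in> U" using U(3) by fastforce
  then show ?case by (intro exI[of _ "\<lambda>_. u"]) simp
next
  case (Suc N)
  then obtain c where c: "\<And>m. c m \<in> U"
    and le: "(\<Sum>m\<in>{1..N}. a (c m) + (\<Sum>m'\<in>{m<..N}. b (c m) (c m'))) \<le> real N * (\<alpha> + real N * \<beta>)" by blast
  \<comment> \<open>The expected increase when the new codeword is drawn with weights w: its own
    term and its effect on the N older ones. Some codeword does no worse than this average.\<close>
  have "(\<Sum>u\<in>U. w u * (a u + (\<Sum>m\<in>{1..N}. b (c m) u))) = (\<Sum>u\<in>U. w u * a u) + (\<Sum>m\<in>{1..N}. \<Sum>u\<in>U. w u * b (c m) u)"
    by (simp add: distrib_left sum.distrib sum_distrib_left sum.swap[of _ U])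
  also have "\<dots> \<le> \<alpha> + (\<Sum>m\<in>{1..N}. \<beta>)" by (intro add_mono a sum_mono b c)
  finally have "(\<Sum>u\<in>U. w u * (a u + (\<Sum>m\<in>{1..N}. b (c m) u))) \<le> \<alpha> + real N * \<beta>" by simp
  from weighted_average_witness[OF U this] obtain u where u: "u \<in> U" "a u + (\<Sum>m\<in>{1..N}. b (c m) u) \<le> \<alpha> + real N * \<beta>" by blast
  define c' where "c' = c(Suc N := u)"
  have ins: "{m<..Suc N} = insert (Suc N) {m<..N}" if "m \<le> N" for m using that by auto
  have "(\<Sum>m\<in>{1..Suc N}. a (c' m) + (\<Sum>m'\<in>{m<..Suc N}. b (c' m) (c' m')))
     = (\<Sum>m\<in>{1..N}. a (c' m) + (\<Sum>m'\<in>{m<..Suc N}. b (c' m) (c' m'))) + a u"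
    by (simp add: c'_def)
  also have "(\<Sum>m\<in>{1..N}. a (c' m) + (\<Sum>m'\<in>{m<..Suc N}. b (c' m) (c' m')))
     = (\<Sum>m\<in>{1..N}. a (c m) + (\<Sum>m'\<in>{m<..N}. b (c m) (c m')) + b (c m) u)"
  proof (rule sum.cong[OF refl])
    fix m assume m: "m \<in> {1..N}"
    have "(\<Sum>m'\<in>{m<..N}. b (c' m) (c' m')) = (\<Sum>m'\<in>{m<..N}. b (c m) (c m'))"
      using m by (intro sum.cong) (auto simp: c'_def)
    then show "a (c' m) + (\<Sum>m'\<in>{m<..Suc N}. b (c' m) (c' m')) = a (c m) + (\<Sum>m'\<in>{m<..N}. b (c m) (c m')) + b (c m) u"
      using m ins[of m] by (simp add: c'_def)
  qed
  finally have "(\<Sum>m\<in>{1..Suc N}. a (c' m) + (\<Sum>m'\<in>{m<..Suc N}. b (c' m) (c' m')))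
     = (\<Sum>m\<in>{1..N}. a (c m) + (\<Sum>m'\<in>{m<..N}. b (c m) (c m'))) + (a u + (\<Sum>m\<in>{1..N}. b (c m) u))"
    by (simp add: sum.distrib)
  also have "\<dots> \<le> real N * (\<alpha> + real N * \<beta>) + (\<alpha> + real N * \<beta>)" using le u by linarith
  also have "\<dots> \<le> real (Suc N) * (\<alpha> + real (Suc N) * \<beta>)"
    using \<beta> by (simp add: algebra_simps)
  finally show ?case using c u by (intro exI[of _ c']) (auto simp: c'_def)
qed

text \<open>For the moment generating function in the Chernoff bound: on a centred variable the
  linear term averages out and only the square remains.\<close>

lemma exp_le_quadratic:
  assumes "\<bar>x\<bar> \<le> (1::real)"
  shows "exp x \<le> 1 + x + x\<^sup>2"
proof (cases "0 \<le> x")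
  case True
  then show ?thesis using exp_bound[of x] assms by simp
next
  case False
  define y where "y = - x"
  have y: "0 < y" using False by (simp add: y_def)
  have "exp x = 1 / exp y" by (simp add: y_def exp_minus inverse_eq_divide)
  also have "\<dots> \<le> 1 / (1 + y)" using y exp_ge_add_one_self[of y] by (intro divide_left_mono) auto
  also have "\<dots> \<le> 1 - y + y\<^sup>2"
  proof -
    have "(1 - y + y\<^sup>2) * (1 + y) = 1 + y ^ 3" by (simp add: power2_eq_square power3_eq_cube algebra_simps)
    then have "1 \<le> (1 - y + y\<^sup>2) * (1 + y)" using y by simp
    then show ?thesis using y by (simp add: divide_le_eq)
  qed
  finally show ?thesis by (simp add: y_def)
qed

lemma sum_prod_words:
  fixes f :: "nat \<Rightarrow> 'i \<Rightarrow> real"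
  assumes "finite I"
  shows "(\<Sum>u\<in>PiE {..<n} (\<lambda>_. I). (\<Prod>k<n. f k (u k))) = (\<Prod>k<n. \<Sum>i\<in>I. f k i)"
  by (rule prod_sum_PiE[symmetric]) (use assms in auto)

text \<open>\<zeta> k i x is the output of block k when letter i is sent and the noise is x; all
  letters share one noise. \<open>W\<close> fixes the law of each single output, and the dependence
  between blocks is left open.\<close>

locale block_channel = prob_space M for M :: "'w measure" +
  fixes I :: "'i set" and p :: "'i \<Rightarrow> real" and \<zeta> :: "nat \<Rightarrow> 'i \<Rightarrow> 'w \<Rightarrow> 'v" and V :: "'v set" and W :: "'i \<Rightarrow> 'v \<Rightarrow> real"
  assumes I: "finite I" and p: "\<And>i. i \<in> I \<Longrightarrow> p i > 0" "(\<Sum>i\<in>I. p i) = 1" and V: "finite V"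
    and \<zeta>: "\<And>k i. \<zeta> k i \<in> measurable M (count_space UNIV)" "\<And>k i x. x \<in> space M \<Longrightarrow> \<zeta> k i x \<in> V"
    and W: "\<And>k i v. prob {x\<in>space M. \<zeta> k i x = v} = W i v"
begin

definition Q :: "'v \<Rightarrow> real" where "Q v = (\<Sum>i\<in>I. p i * W i v)"
definition \<psi> :: "'i \<Rightarrow> 'v \<Rightarrow> real" where "\<psi> i v = log 2 (W i v / Q v)"
text \<open>The information density of block k averaged over the letter with the noise kept
  fixed.\<close>

definition mean_density :: "nat \<Rightarrow> 'w \<Rightarrow> real" where "mean_density k x = (\<Sum>i\<in>I. p i * \<psi> i (\<zeta> k i x))"
definition words :: "nat \<Rightarrow> (nat \<Rightarrow> 'i) set" where "words n = PiE {..<n} (\<lambda>_. I)"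
definition weight :: "nat \<Rightarrow> (nat \<Rightarrow> 'i) \<Rightarrow> real" where "weight n u = (\<Prod>k<n. p (u k))"
text \<open>Positivity of \<open>W\<close> is included because only there is 2 powr \<psi> the
  likelihood ratio W / Q.\<close>

definition typical :: "nat \<Rightarrow> real \<Rightarrow> (nat \<Rightarrow> 'i) \<Rightarrow> (nat \<Rightarrow> 'v) \<Rightarrow> bool" where
  "typical n \<theta> u v \<longleftrightarrow> (\<forall>k<n. W (u k) (v k) > 0) \<and> (\<Sum>k<n. \<psi> (u k) (v k)) > \<theta>"
definition outp :: "(nat \<Rightarrow> 'i) \<Rightarrow> 'w \<Rightarrow> nat \<Rightarrow> 'v" where "outp u x k = \<zeta> k (u k) x"

lemma W_nonneg: "0 \<le> W i v"
  using W[of 0 i v] by (metis measure_nonneg)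

lemma Q_nonneg: "0 \<le> Q v"
  unfolding Q_def by (intro sum_nonneg mult_nonneg_nonneg W_nonneg less_imp_le p)

lemma Q_pos: "i \<in> I \<Longrightarrow> W i v > 0 \<Longrightarrow> Q v > 0"
  unfolding Q_def using I p W_nonneg by (intro sum_pos2[of I i]) (auto intro!: mult_nonneg_nonneg less_imp_le[OF p(1)])

lemma finite_words: "finite (words n)"
  unfolding words_def using I by (intro finite_PiE) auto

lemma weight_nonneg: "u \<in> words n \<Longrightarrow> 0 \<le> weight n u"
  unfolding weight_def words_def by (intro prod_nonneg) (auto intro!: less_imp_le p)

lemma sum_weight: "(\<Sum>u\<in>words n. weight n u) = 1"
  unfolding words_def weight_def by (subst sum_prod_words[OF I]) (simp add: p)

lemma measurable_outp [measurable]: "(\<lambda>x. h (outp u x k)) \<in> measurable M (count_space UNIV)"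
  unfolding outp_def by (rule measurable_compose[OF \<zeta>(1)]) simp

lemma measurable_outp_real [measurable]: "(\<lambda>x. h (outp u x k) :: real) \<in> borel_measurable M"
  unfolding outp_def by (rule measurable_compose[OF \<zeta>(1)]) simp

lemma typical_event [measurable]: "{x\<in>space M. typical n \<theta> u' (outp u x)} \<in> events"
  unfolding typical_def by measurable

text \<open>Markov's inequality after a change of measure: typicality makes the product of the
  ratios W / Q exceed 2 powr \<theta>, while its average over independent letters factors into sums
  Q / Q. This holds for each fixed output sequence, hence whatever was sent and however the blocks
  depend on each other.\<close>

lemma confusion_bound:
  "(\<Sum>u'\<in>words n. weight n u' * prob {x\<in>space M. typical n \<theta> u' (outp u x)}) \<le> 2 powr (- \<theta>)"
proof -
  have pointwise: "(\<Sum>u'\<in>words n. weight n u' * of_bool (typical n \<theta> u' v)) \<le> 2 powr (- \<theta>)" for v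
  proof -
    have "(\<Sum>u'\<in>words n. weight n u' * of_bool (typical n \<theta> u' v))
       \<le> (\<Sum>u'\<in>words n. 2 powr (- \<theta>) * (\<Prod>k<n. p (u' k) * (W (u' k) (v k) / Q (v k))))"
    proof (rule sum_mono)
      fix u assume u: "u \<in> words n"
      then have uI: "u k \<in> I" if "k < n" for k using that by (auto simp: words_def)
      show "weight n u * of_bool (typical n \<theta> u v) \<le> 2 powr (- \<theta>) * (\<Prod>k<n. p (u k) * (W (u k) (v k) / Q (v k)))"
      proof (cases "typical n \<theta> u v")
        case True
        have "2 powr (\<Sum>k<n. \<psi> (u k) (v k)) = (\<Prod>k<n. 2 powr \<psi> (u k) (v k))"
          by (simp add: powr_sum)
        also have "\<dots> = (\<Prod>k<n. W (u k) (v k) / Q (v k))"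
        proof (rule prod.cong[OF refl])
          fix k assume "k \<in> {..<n}"
          then have "W (u k) (v k) > 0" "Q (v k) > 0" using True uI Q_pos by (auto simp: typical_def)
          then show "2 powr \<psi> (u k) (v k) = W (u k) (v k) / Q (v k)" by (simp add: \<psi>_def)
        qed
        finally have e: "2 powr (\<Sum>k<n. \<psi> (u k) (v k)) = (\<Prod>k<n. W (u k) (v k) / Q (v k))" .
        have "1 \<le> 2 powr (- \<theta>) * 2 powr (\<Sum>k<n. \<psi> (u k) (v k))"
          using True by (simp add: typical_def ge_one_powr_ge_zero flip: powr_add)
        then have "weight n u * 1 \<le> weight n u * (2 powr (- \<theta>) * (\<Prod>k<n. W (u k) (v k) / Q (v k)))"
          unfolding e using weight_nonneg[OF u] by (intro mult_left_mono) auto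
        moreover have "(\<Prod>k<n. p (u k) * (W (u k) (v k) / Q (v k))) = weight n u * (\<Prod>k<n. W (u k) (v k) / Q (v k))"
          by (simp only: weight_def prod.distrib)
        ultimately show ?thesis using True by (simp add: mult_ac)
      next
        case False
        have "0 \<le> (\<Prod>k<n. p (u k) * (W (u k) (v k) / Q (v k)))"
          using uI by (intro prod_nonneg) (auto intro!: mult_nonneg_nonneg divide_nonneg_nonneg W_nonneg Q_nonneg less_imp_le[OF p(1)])
        then show ?thesis using False by simp
      qed
    qed
    also have "\<dots> = 2 powr (- \<theta>) * (\<Prod>k<n. \<Sum>i\<in>I. p i * (W i (v k) / Q (v k)))"
      unfolding words_def sum_distrib_left[symmetric] by (subst sum_prod_words[OF I]) simp
    also have "(\<Prod>k<n. \<Sum>i\<in>I. p i * (W i (v k) / Q (v k))) \<le> 1"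
    proof (rule prod_le_1)
      fix k
      \<comment> \<open>This is 1 or, where Q vanishes, 0 / 0 = 0; hence only a bound on the
        product.\<close>
      have "(\<Sum>i\<in>I. p i * (W i (v k) / Q (v k))) = Q (v k) / Q (v k)"
        unfolding Q_def[of "v k"] sum_divide_distrib by (simp only: times_divide_eq_right)
      then show "0 \<le> (\<Sum>i\<in>I. p i * (W i (v k) / Q (v k))) \<and> (\<Sum>i\<in>I. p i * (W i (v k) / Q (v k))) \<le> 1"
        by (simp add: divide_self_if)
    qed
    finally show ?thesis by simp
  qed
  have i: "integrable M (indicat_real {x\<in>space M. typical n \<theta> u' (outp u x)})" for u'
    by (simp add: integrable_real_indicator emeasure_finite less_top[symmetric])
  have "(\<Sum>u'\<in>words n. weight n u' * prob {x\<in>space M. typical n \<theta> u' (outp u x)})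
     = (\<integral>x. (\<Sum>u'\<in>words n. weight n u' * indicator {x\<in>space M. typical n \<theta> u' (outp u x)} x) \<partial>M)"
    using i by simp
  also have "\<dots> \<le> (\<integral>x. 2 powr (- \<theta>) \<partial>M)"
  proof (rule integral_mono)
    fix x assume "x \<in> space M"
    then show "(\<Sum>u'\<in>words n. weight n u' * indicator {x\<in>space M. typical n \<theta> u' (outp u x)} x) \<le> 2 powr (- \<theta>)"
      using pointwise[of "outp u x"] by (simp add: indicator_def of_bool_def)
  qed (use i in auto)
  finally show ?thesis by (simp add: prob_space)
qed

text \<open>Hence the codeword that was sent almost surely fails typicality only through a small
  sum. Each block has finitely many outputs, so those of probability 0 together form a null
  event.\<close>

lemma density_positive_AE: "AE x in M. \<forall>k<n. W (u k) (outp u x k) > 0"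
proof -
  have "AE x in M. W i (\<zeta> k i x) > 0" for k i
  proof -
    have "AE x in M. \<forall>v\<in>{v\<in>V. W i v = 0}. \<zeta> k i x \<noteq> v"
    proof (rule AE_finite_allI)
      fix v assume v: "v \<in> {v\<in>V. W i v = 0}"
      have "{x\<in>space M. \<zeta> k i x = v} \<in> events" 
        using measurable_sets[OF \<zeta>(1)[of k i], of "{v}"] by (simp add: vimage_def Int_def conj_commute)
      then show "AE x in M. \<zeta> k i x \<noteq> v" using v W[of k i v] by (simp add: prob_eq_0)
    qed (use V in simp)
    then show ?thesis using AE_space
    proof eventually_elim
      case (elim x)
      then have "W i (\<zeta> k i x) \<noteq> 0" using \<zeta>(2) by blast
      then show ?case using W_nonneg by (simp add: less_le)
    qed
  qed
  then show ?thesis unfolding outp_def by (subst AE_all_countable) auto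
qed

text \<open>Two deviations are separated, each with its own \<delta>. The noise may make the
  averaged density small, which stays as the first term; for fixed noise the letters may fall below
  that average, which is exponentially unlikely because they are independent.\<close>

lemma atypical_bound:
  assumes \<delta>: "\<delta> > 0"
  obtains s where "s > 0" "\<And>n c. (\<Sum>u\<in>words n. weight n u * prob {x\<in>space M. \<not> typical n (real n * (c - 2 * \<delta>)) u (outp u x)})
     \<le> prob {x\<in>space M. (\<Sum>k<n. mean_density k x) < real n * (c - \<delta>)} + exp (- (s * real n))"
proof -
  \<comment> \<open>Densities and their averages are at most (C - 1) / 2 in absolute value, so their
    difference is at most C; C >= 1 makes division by C harmless.\<close>
  define C where "C = 1 + 2 * (\<Sum>i\<in>I. \<Sum>v\<in>V. \<bar>\<psi> i v\<bar>)"
  have C1: "C \<ge> 1" unfolding C_def by (simp add: sum_nonneg)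
  have \<psi>b: "\<bar>\<psi> i (\<zeta> k i x)\<bar> \<le> (C - 1) / 2" if "i \<in> I" "x \<in> space M" for i k x
  proof -
    have "\<bar>\<psi> i (\<zeta> k i x)\<bar> \<le> (\<Sum>v\<in>V. \<bar>\<psi> i v\<bar>)"
      by (rule member_le_sum[where f="\<lambda>v. \<bar>\<psi> i v\<bar>"]) (use that \<zeta>(2) V in auto)
    also have "\<dots> \<le> (\<Sum>i\<in>I. \<Sum>v\<in>V. \<bar>\<psi> i v\<bar>)"
      by (rule member_le_sum[where f="\<lambda>i. \<Sum>v\<in>V. \<bar>\<psi> i v\<bar>"]) (use that I in \<open>auto intro: sum_nonneg\<close>)
    finally show ?thesis by (simp add: C_def)
  qed
  have mb: "\<bar>mean_density k x\<bar> \<le> (C - 1) / 2" if "x \<in> space M" for k x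
  proof -
    have "\<bar>mean_density k x\<bar> \<le> (\<Sum>i\<in>I. p i * ((C - 1) / 2))"
      unfolding mean_density_def
    proof (intro order_trans[OF sum_abs] sum_mono)
      fix i assume i: "i \<in> I"
      show "\<bar>p i * \<psi> i (\<zeta> k i x)\<bar> \<le> p i * ((C - 1) / 2)"
        unfolding abs_mult abs_of_pos[OF p(1)[OF i]]
        by (rule mult_left_mono[OF \<psi>b[OF i that] less_imp_le[OF p(1)[OF i]]])
    qed
    also have "\<dots> = (C - 1) / 2" by (simp only: sum_distrib_right[symmetric] p(2) mult_1_left)
    finally show ?thesis .
  qed
  \<comment> \<open>The first bound makes \<open>exp_le_quadratic\<close> applicable; the second
    lets the quadratic term use up only half of the gain s \<delta> per letter.\<close>
  define s where "s = min (1 / C) (\<delta> / (2 * C\<^sup>2))"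
  have s: "s > 0" "s * C \<le> 1" "s * s * C\<^sup>2 \<le> s * \<delta> / 2"
  proof -
    show s0: "s > 0" using C1 \<delta> by (simp add: s_def)
    have "s * C \<le> 1 / C * C" using C1 by (intro mult_right_mono) (auto simp: s_def)
    then show "s * C \<le> 1" using C1 by simp
    have "s * C\<^sup>2 \<le> \<delta> / (2 * C\<^sup>2) * C\<^sup>2" by (intro mult_right_mono) (auto simp: s_def)
    then have "s * C\<^sup>2 \<le> \<delta> / 2" using C1 by simp
    then have "s * (s * C\<^sup>2) \<le> s * (\<delta> / 2)" using s0 by (intro mult_left_mono) auto
    then show "s * s * C\<^sup>2 \<le> s * \<delta> / 2" by simp
  qed
  show thesis
  proof (rule that[of "s * \<delta> / 2"])
    show "s * \<delta> / 2 > 0" using s \<delta> by simp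
    fix n c
    define \<theta> where "\<theta> = real n * (c - 2 * \<delta>)"
    define B where "B = {x\<in>space M. (\<Sum>k<n. mean_density k x) < real n * (c - \<delta>)}"
    have [measurable]: "mean_density k \<in> borel_measurable M" for k
      unfolding mean_density_def[abs_def]
      by (intro borel_measurable_sum borel_measurable_times borel_measurable_const measurable_compose[OF \<zeta>(1)]) simp
    have B [measurable]: "B \<in> events" unfolding B_def by measurable
    define S where "S u = {x\<in>space M. (\<Sum>k<n. \<psi> (u k) (outp u x k)) \<le> \<theta>}" for u
    have S [measurable]: "S u \<in> events" for u unfolding S_def by measurable
    have pS: "prob {x\<in>space M. \<not> typical n \<theta> u (outp u x)} \<le> prob (S u)" for u
    proof (rule finite_measure_mono_AE)
      show "AE x in M. x \<in> {x\<in>space M. \<not> typical n \<theta> u (outp u x)} \<longrightarrow> x \<in> S u"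
        using density_positive_AE[of n u] by eventually_elim (auto simp: typical_def S_def)
    qed simp
    have pointwise: "(\<Sum>u\<in>words n. weight n u * indicator (S u) x) \<le> indicator B x + exp (- (s * \<delta> / 2 * real n))" if x: "x \<in> space M" for x
    proof (cases "x \<in> B")
      case True
      have "(\<Sum>u\<in>words n. weight n u * indicator (S u) x) \<le> (\<Sum>u\<in>words n. weight n u * 1)"
        by (intro sum_mono mult_left_mono weight_nonneg) (auto simp: indicator_def)
      then show ?thesis using True sum_weight[of n] by (simp add: add_increasing2)
    next
      case False
      then have mB: "real n * (c - \<delta>) \<le> (\<Sum>k<n. mean_density k x)" using x by (simp add: B_def)
      define d where "d k i = mean_density k x - \<psi> i (\<zeta> k i x)" for k i
      have db: "\<bar>s * d k i\<bar> \<le> 1" "(d k i)\<^sup>2 \<le> C\<^sup>2" if "i \<in> I" for k i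
      proof -
        have "\<bar>d k i\<bar> \<le> \<bar>mean_density k x\<bar> + \<bar>\<psi> i (\<zeta> k i x)\<bar>" unfolding d_def by (rule abs_triangle_ineq4)
        also have "\<dots> \<le> (C - 1) / 2 + (C - 1) / 2" by (rule add_mono[OF mb[OF x] \<psi>b[OF that x]])
        finally have "\<bar>d k i\<bar> \<le> C" by simp
        then show "(d k i)\<^sup>2 \<le> C\<^sup>2" using C1 by (simp add: abs_le_square_iff[symmetric])
        have "s * \<bar>d k i\<bar> \<le> s * C" using \<open>\<bar>d k i\<bar> \<le> C\<close> s(1) by (intro mult_left_mono) auto
        also note s(2)
        finally show "\<bar>s * d k i\<bar> \<le> 1" using s(1) by (simp add: abs_mult)
      qed
      have d0: "(\<Sum>i\<in>I. p i * d k i) = 0" for k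
        by (simp add: d_def right_diff_distrib sum_subtractf p mean_density_def flip: sum_distrib_right)
      have mgf: "(\<Sum>i\<in>I. p i * exp (s * d k i)) \<le> exp (s * \<delta> / 2)" for k
      proof -
        have "(\<Sum>i\<in>I. p i * exp (s * d k i)) \<le> (\<Sum>i\<in>I. p i * (1 + s * d k i + s * s * C\<^sup>2))"
        proof (intro sum_mono mult_left_mono)
          fix i assume i: "i \<in> I"
          have "(s * d k i)\<^sup>2 \<le> s * s * C\<^sup>2" using db(2)[OF i, of k] s by (simp add: power_mult_distrib power2_eq_square mult_left_mono mult.assoc)
          then show "exp (s * d k i) \<le> 1 + s * d k i + s * s * C\<^sup>2"
            using exp_le_quadratic[OF db(1)[OF i, of k]] by linarith
          show "0 \<le> p i" using p(1)[OF i] by simp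
        qed
        also have "\<dots> = (\<Sum>i\<in>I. p i) + s * (\<Sum>i\<in>I. p i * d k i) + (\<Sum>i\<in>I. p i) * (s * s * C\<^sup>2)"
          by (simp add: distrib_left sum.distrib sum_distrib_left sum_distrib_right mult_ac)
        also have "\<dots> = 1 + s * s * C\<^sup>2" by (simp add: d0 p)
        also have "\<dots> \<le> 1 + s * \<delta> / 2" using s by simp
        also have "\<dots> \<le> exp (s * \<delta> / 2)" by (rule exp_ge_add_one_self)
        finally show ?thesis .
      qed
      have "(\<Sum>u\<in>words n. weight n u * indicator (S u) x)
         \<le> (\<Sum>u\<in>words n. exp (- (s * \<delta> * real n)) * (\<Prod>k<n. p (u k) * exp (s * d k (u k))))"
      proof (rule sum_mono)
        fix u assume u: "u \<in> words n"
        have e: "(\<Prod>k<n. p (u k) * exp (s * d k (u k))) = weight n u * exp (s * (\<Sum>k<n. d k (u k)))"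
          by (simp add: weight_def prod.distrib exp_sum sum_distrib_left)
        show "weight n u * indicator (S u) x \<le> exp (- (s * \<delta> * real n)) * (\<Prod>k<n. p (u k) * exp (s * d k (u k)))"
        proof (cases "x \<in> S u")
          case True
          have "(\<Sum>k<n. d k (u k)) = (\<Sum>k<n. mean_density k x) - (\<Sum>k<n. \<psi> (u k) (outp u x k))"
            by (simp add: d_def outp_def sum_subtractf)
          then have "real n * \<delta> \<le> (\<Sum>k<n. d k (u k))"
            using True mB by (simp add: S_def \<theta>_def algebra_simps)
          then have "s * (real n * \<delta>) \<le> s * (\<Sum>k<n. d k (u k))" using s by (intro mult_left_mono) auto
          then have "1 \<le> exp (- (s * \<delta> * real n)) * exp (s * (\<Sum>k<n. d k (u k)))"
            by (simp add: mult_ac flip: exp_add)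
          then have "weight n u * 1 \<le> weight n u * (exp (- (s * \<delta> * real n)) * exp (s * (\<Sum>k<n. d k (u k))))"
            using weight_nonneg[OF u] by (intro mult_left_mono) auto
          then show ?thesis using True unfolding e by (simp add: mult_ac)
        next
          case False
          then show ?thesis unfolding e using weight_nonneg[OF u] by simp
        qed
      qed
      also have "\<dots> = exp (- (s * \<delta> * real n)) * (\<Prod>k<n. \<Sum>i\<in>I. p i * exp (s * d k i))"
        unfolding words_def sum_distrib_left[symmetric] by (subst sum_prod_words[OF I]) simp
      also have "\<dots> \<le> exp (- (s * \<delta> * real n)) * (\<Prod>k<n. exp (s * \<delta> / 2))"
        by (intro mult_left_mono prod_mono) (auto intro!: mgf sum_nonneg mult_nonneg_nonneg less_imp_le[OF p(1)])
      also have "\<dots> = exp (- (s * \<delta> / 2 * real n))"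
        by (simp add: exp_of_nat_mult[symmetric] algebra_simps flip: exp_add)
      finally show ?thesis using False by simp
    qed
    have iS: "integrable M (indicat_real (S u))" for u
      by (simp add: integrable_real_indicator emeasure_finite less_top[symmetric])
    have iB: "integrable M (indicat_real B)"
      by (simp add: integrable_real_indicator emeasure_finite less_top[symmetric])
    have "(\<Sum>u\<in>words n. weight n u * prob {x\<in>space M. \<not> typical n \<theta> u (outp u x)}) \<le> (\<Sum>u\<in>words n. weight n u * prob (S u))"
      by (intro sum_mono mult_left_mono pS weight_nonneg)
    also have "\<dots> = (\<integral>x. (\<Sum>u\<in>words n. weight n u * indicator (S u) x) \<partial>M)" using iS by simp
    also have "\<dots> \<le> (\<integral>x. indicator B x + exp (- (s * \<delta> / 2 * real n)) \<partial>M)"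
      by (rule integral_mono[OF _ _ pointwise]) (use iS iB in auto)
    also have "\<dots> = prob B + exp (- (s * \<delta> / 2 * real n))" using iB by (simp add: prob_space)
    finally show "(\<Sum>u\<in>words n. weight n u * prob {x\<in>space M. \<not> typical n (real n * (c - 2 * \<delta>)) u (outp u x)})
     \<le> prob {x\<in>space M. (\<Sum>k<n. mean_density k x) < real n * (c - \<delta>)} + exp (- (s * \<delta> / 2 * real n))"
      by (simp add: \<theta>_def B_def)
  qed
qed

text \<open>The value 0 is no message; it keeps the maximum defined when no codeword is
  typical.\<close>

definition decode :: "nat \<Rightarrow> real \<Rightarrow> nat \<Rightarrow> (nat \<Rightarrow> nat \<Rightarrow> 'i) \<Rightarrow> (nat \<Rightarrow> 'v) \<Rightarrow> nat" where
  "decode n \<theta> N c v = Max (insert 0 {m\<in>{1..N}. typical n \<theta> (c m) v})"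

lemma decode_cong: "(\<And>k. k < n \<Longrightarrow> v k = v' k) \<Longrightarrow> decode n \<theta> N c v = decode n \<theta> N c v'"
  unfolding decode_def typical_def by (simp cong: conj_cong)

lemma decode_correct:
  assumes "m \<in> {1..N}" "typical n \<theta> (c m) v" "\<And>m'. m' \<in> {m<..N} \<Longrightarrow> \<not> typical n \<theta> (c m') v"
  shows "decode n \<theta> N c v = m"
  unfolding decode_def
proof (rule Max_eqI)
  fix j assume "j \<in> insert 0 {m\<in>{1..N}. typical n \<theta> (c m) v}"
  then show "j \<le> m" using assms(3)[of j] by (cases "j \<le> m") auto
qed (use assms in auto)

text \<open>As the largest typical message wins, message m fails only if its own codeword is
  atypical or a later one is typical. These are the terms that \<open>greedy_code\<close>
  bounds.\<close>

lemma threshold_coding: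
  assumes \<delta>: "\<delta> > 0"
  obtains s where "s > 0" "\<And>n N c. N > 0 \<Longrightarrow> \<exists>cw. (\<forall>m. cw m \<in> words n) \<and>
    (\<Sum>m\<in>{1..N}. prob {x\<in>space M. decode n (real n * (c - 2 * \<delta>)) N cw (outp (cw m) x) \<noteq> m}) / real N
    \<le> prob {x\<in>space M. (\<Sum>k<n. mean_density k x) < real n * (c - \<delta>)} + exp (- (s * real n))
       + real N * 2 powr (- (real n * (c - 2 * \<delta>)))"
proof -
  obtain s where s: "s > 0" "\<And>n c. (\<Sum>u\<in>words n. weight n u * prob {x\<in>space M. \<not> typical n (real n * (c - 2 * \<delta>)) u (outp u x)})
     \<le> prob {x\<in>space M. (\<Sum>k<n. mean_density k x) < real n * (c - \<delta>)} + exp (- (s * real n))"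
    using atypical_bound[OF \<delta>] by blast
  show thesis
  proof (rule that[OF s(1)])
    fix n N :: nat and c :: real assume N: "N > 0"
    define \<theta> where "\<theta> = real n * (c - 2 * \<delta>)"
    define \<alpha> where "\<alpha> = prob {x\<in>space M. (\<Sum>k<n. mean_density k x) < real n * (c - \<delta>)} + exp (- (s * real n))"
    define a where "a u = prob {x\<in>space M. \<not> typical n \<theta> u (outp u x)}" for u
    define b where "b u u' = prob {x\<in>space M. typical n \<theta> u' (outp u x)}" for u u'
    have "\<exists>cw. (\<forall>m. cw m \<in> words n) \<and>
       (\<Sum>m\<in>{1..N}. a (cw m) + (\<Sum>m'\<in>{m<..N}. b (cw m) (cw m'))) \<le> real N * (\<alpha> + real N * 2 powr (- \<theta>))"
    proof (rule greedy_code[OF finite_words weight_nonneg sum_weight])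
      show "(\<Sum>u\<in>words n. weight n u * a u) \<le> \<alpha>" unfolding a_def \<alpha>_def \<theta>_def by (rule s(2))
      show "(\<Sum>u'\<in>words n. weight n u' * b u u') \<le> 2 powr (- \<theta>)" for u unfolding b_def by (rule confusion_bound)
    qed auto
    then obtain cw where cw: "\<And>m. cw m \<in> words n"
      "(\<Sum>m\<in>{1..N}. a (cw m) + (\<Sum>m'\<in>{m<..N}. b (cw m) (cw m'))) \<le> real N * (\<alpha> + real N * 2 powr (- \<theta>))" by blast
    have "(\<Sum>m\<in>{1..N}. prob {x\<in>space M. decode n \<theta> N cw (outp (cw m) x) \<noteq> m})
       \<le> (\<Sum>m\<in>{1..N}. a (cw m) + (\<Sum>m'\<in>{m<..N}. b (cw m) (cw m')))"
    proof (rule sum_mono)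
      fix m assume m: "m \<in> {1..N}"
      define E where "E m' = {x\<in>space M. typical n \<theta> (cw m') (outp (cw m) x)}" for m'
      have E: "E m' \<in> events" for m' unfolding E_def by simp
      have E': "{x\<in>space M. \<not> typical n \<theta> (cw m) (outp (cw m) x)} \<in> events"
      proof -
        have "{x\<in>space M. \<not> typical n \<theta> (cw m) (outp (cw m) x)} = space M - E m" by (auto simp: E_def)
        then show ?thesis using E by simp
      qed
      have "prob {x\<in>space M. decode n \<theta> N cw (outp (cw m) x) \<noteq> m}
         \<le> prob ({x\<in>space M. \<not> typical n \<theta> (cw m) (outp (cw m) x)} \<union> (\<Union>m'\<in>{m<..N}. E m'))"
      proof (rule finite_measure_mono)
        show "{x\<in>space M. decode n \<theta> N cw (outp (cw m) x) \<noteq> m}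
           \<subseteq> {x\<in>space M. \<not> typical n \<theta> (cw m) (outp (cw m) x)} \<union> (\<Union>m'\<in>{m<..N}. E m')"
          using decode_correct[OF m] unfolding E_def by blast
      qed (use E E' in auto)
      also have "\<dots> \<le> a (cw m) + prob (\<Union>m'\<in>{m<..N}. E m')"
        unfolding a_def by (rule measure_Un_le) (use E E' in auto)
      also have "prob (\<Union>m'\<in>{m<..N}. E m') \<le> (\<Sum>m'\<in>{m<..N}. prob (E m'))"
        by (rule finite_measure_subadditive_finite) (use E in auto)
      finally show "prob {x\<in>space M. decode n \<theta> N cw (outp (cw m) x) \<noteq> m} \<le> a (cw m) + (\<Sum>m'\<in>{m<..N}. b (cw m) (cw m'))"
        by (simp add: b_def E_def)
    qed
    also note cw(2)
    finally have "(\<Sum>m\<in>{1..N}. prob {x\<in>space M. decode n \<theta> N cw (outp (cw m) x) \<noteq> m}) / real N \<le> \<alpha> + real N * 2 powr (- \<theta>)"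
      using N by (simp add: divide_le_eq mult.commute)
    with cw(1) show "\<exists>cw. (\<forall>m. cw m \<in> words n) \<and>
      (\<Sum>m\<in>{1..N}. prob {x\<in>space M. decode n (real n * (c - 2 * \<delta>)) N cw (outp (cw m) x) \<noteq> m}) / real N
      \<le> prob {x\<in>space M. (\<Sum>k<n. mean_density k x) < real n * (c - \<delta>)} + exp (- (s * real n))
         + real N * 2 powr (- (real n * (c - 2 * \<delta>)))"
      unfolding \<theta>_def \<alpha>_def by blast
  qed
qed

end

subsection \<open>Achievability\<close>

text \<open>Collecting the n block symbols in a list keeps the type countable: the map is measurable
  for the discrete algebra, and any decoder may be applied to it.\<close>

lemma map_measurable:
  fixes w :: "nat \<Rightarrow> 's \<Rightarrow> nat"
  assumes "\<And>k. k < n \<Longrightarrow> w k \<in> measurable S (count_space UNIV)"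
  shows "(\<lambda>y. map (\<lambda>k. w k y) [0..<n]) \<in> measurable S (count_space UNIV)"
  using assms
proof (induction n)
  case (Suc n)
  have "(\<lambda>y. (\<lambda>k y. map (\<lambda>k. w k y) [0..<n] @ [k]) (w n y) y) \<in> measurable S (count_space UNIV)"
  proof (rule measurable_compose_countable[where f="\<lambda>k y. map (\<lambda>k. w k y) [0..<n] @ [k]"])
    show "w n \<in> measurable S (count_space UNIV)" using Suc by simp
    have "(\<lambda>y. map (\<lambda>k. w k y) [0..<n]) \<in> measurable S (count_space UNIV)" using Suc by simp
    then show "(\<lambda>y. map (\<lambda>k. w k y) [0..<n] @ [k]) \<in> measurable S (count_space UNIV)" for k
      by (rule measurable_compose) simp
  qed
  then show ?case by simp
qed simp

lemma shift_path_measurable: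
  assumes "s \<ge> 0"
  shows "shift_path s \<in> measurable (PiM {0..} (\<lambda>_. SZ)) (PiM {0..} (\<lambda>_. SZ))"
  unfolding shift_path_def
  by (rule measurable_restrict, rule measurable_component_singleton) (use assms in auto)

lemma shift_path_funpow:
  assumes "z \<in> extensional {0..}" "s \<ge> 0"
  shows "(shift_path s ^^ k) z = shift_path (real k * s) z"
proof (induction k)
  case 0
  show ?case using assms by (auto simp: shift_path_def fun_eq_iff extensional_def)
next
  case (Suc k)
  have "shift_path s (shift_path (real k * s) z) = shift_path (real (Suc k) * s) z"
    using assms(2) by (auto simp: shift_path_def fun_eq_iff algebra_simps)
  then show ?case using Suc by simp
qed

section \<open>The quantized channel of a single block\<close>

context channel_input
begin

definition qout :: "((real \<Rightarrow> 'y) \<Rightarrow> nat) \<Rightarrow> (real \<Rightarrow> nat) \<Rightarrow> (real \<Rightarrow> 'z) \<Rightarrow> nat" where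
  "qout v u z = v (out_path g \<Delta> T (aux_strategy gs) u z)"

definition Wq :: "((real \<Rightarrow> 'y) \<Rightarrow> nat) \<Rightarrow> (real \<Rightarrow> nat) \<Rightarrow> nat \<Rightarrow> real" where
  "Wq v u k = measure mu {z\<in>space mu. qout v u z = k}"

lemma qout_measurable:
  assumes "v \<in> measurable (PiM {0..<T} (\<lambda>_. SY)) (count_space UNIV)"
  shows "qout v u \<in> measurable mu (count_space UNIV)"
  unfolding qout_def
  by (rule measurable_compose[OF out_path_measurable[OF g_meas pos mu(2) strategy_measurable] assms])

lemma qout_range:
  assumes "z \<in> space mu"
  shows "qout v u z \<in> v ` space (PiM {0..<T} (\<lambda>_. SY))"
  unfolding qout_def
  using measurable_space[OF out_path_measurable[OF g_meas pos mu(2) strategy_measurable] assms] by blast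

text \<open>The entropy drop of A becomes the single-letter mutual information of the transition
  matrix \<open>Wq\<close> under p. The empty past Y_0^0 generates the trivial algebra, which makes
  the conditional entropies plain ones.\<close>

lemma discrete_information:
  assumes v: "quantizer (PiM {0..<T} (\<lambda>_. SY)) v"
  defines "K \<equiv> v ` space (PiM {0..<T} (\<lambda>_. SY))"
  defines "Q \<equiv> \<lambda>k. \<Sum>u\<in>set_pmf p. pmf p u * Wq v u k"
  shows "ch.cY 0 A - centropy P (gen_alg P (count_space UNIV \<Otimes>\<^sub>M ch.PY {0..<0}) (\<lambda>\<omega>. (v (ch.Yr {0..<T} \<omega>), ch.Yr {0..<0} \<omega>))) A
     = (\<Sum>u\<in>set_pmf p. \<Sum>k\<in>K. pmf p u * Wq v u k * log 2 (Wq v u k / Q k))"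
proof -
  interpret mu: prob_space mu by (rule mu)
  define vY where "vY \<omega> = v (ch.Yr {0..<T} \<omega>)" for \<omega>
  define S where "S = set_pmf p"
  have finS: "finite S" by (simp add: S_def fin)
  have finK: "finite K" using v by (simp add: K_def quantizer_def)
  have Y0: "ch.Yr {0..<0} \<in> measurable P (ch.PY {0..<0})" by (rule measurable_restrict) simp
  have YT: "ch.Yr {0..<T} \<in> measurable P (ch.PY {0..<T})" by (rule ch.Yr_measurable) simp
  note vY = P.quantizer_compose[OF YT v, folded vY_def]
  have c0: "ch.Yr {0..<0} \<omega> = (\<lambda>_. undefined)" for \<omega> by (simp add: restrict_def)
  have imA: "A ` space P = S"
  proof
    show "A ` space P \<subseteq> S" using supp_proj_in[of p] by (auto simp: A_def S_def)
    obtain z where z: "z \<in> space mu" using mu.not_empty by blast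
    show "S \<subseteq> A ` space P"
    proof
      fix u assume "u \<in> S"
      then have "A (u, z) = u" "(u, z) \<in> space P" using z by (auto simp: A_def S_def supp_proj_id space_pair_measure)
      then show "u \<in> A ` space P" by (metis image_eqI)
    qed
  qed
  have imV: "vY ` space P \<subseteq> K"
    using measurable_space[OF YT] by (auto simp: vY_def K_def)
  define D where "D u k = {z\<in>space mu. qout v u z = k}" for u k
  have D: "D u k \<in> sets mu" for u k
    using measurable_sets[OF qout_measurable[OF quantizer_measurable[OF v]], of "{k}" u]
    by (simp add: D_def vimage_def Int_def conj_commute)
  have vYq: "vY (u, z) = qout v (supp_proj p u) z" for u z
    by (simp add: vY_def qout_def ch.Y_def A_def out_path_eq[OF pos])
  have joint: "P.prob (vY -` {k} \<inter> A -` {u} \<inter> space P) = pmf p u * Wq v u k" for k u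
  proof -
    have "vY -` {k} \<inter> A -` {u} \<inter> space P = {u'. supp_proj p u' = u} \<times> D u k"
      by (auto simp: vYq A_def D_def space_pair_measure)
    then show ?thesis using prob_rect[OF D] by (simp add: Wq_def D_def)
  qed
  have ev: "vY -` {k} \<inter> A -` {u} \<inter> space P \<in> P.events" for k u
    using measurable_sets[OF vY(1), of "{k}"] measurable_sets[OF ch.A(1), of "{u}"]
      sets.Int[of "vY -` {k} \<inter> space P" P "A -` {u} \<inter> space P"] by (simp add: Int_ac)
  have pQ: "P.prob (vY -` {k} \<inter> space P) = Q k" for k
  proof -
    have "vY -` {k} \<inter> space P = (\<Union>u\<in>S. vY -` {k} \<inter> A -` {u} \<inter> space P)" using imA by auto
    moreover have "P.prob (\<Union>u\<in>S. vY -` {k} \<inter> A -` {u} \<inter> space P) = (\<Sum>u\<in>S. P.prob (vY -` {k} \<inter> A -` {u} \<inter> space P))"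
      by (rule P.finite_measure_finite_Union[OF finS]) (use ev in \<open>auto simp: disjoint_family_on_def\<close>)
    ultimately show ?thesis by (simp add: joint Q_def S_def)
  qed
  have W0: "0 \<le> Wq v u k" for u k by (simp add: Wq_def)
  have sumW: "(\<Sum>k\<in>K. Wq v u k) = 1" for u
  proof -
    have "(\<Union>k\<in>K. D u k) = space mu" using qout_range unfolding D_def K_def by fast
    moreover have "measure mu (\<Union>k\<in>K. D u k) = (\<Sum>k\<in>K. measure mu (D u k))"
      by (rule mu.finite_measure_finite_Union[OF finK]) (use D in \<open>auto simp: disjoint_family_on_def D_def\<close>)
    ultimately show ?thesis by (simp add: Wq_def D_def mu.prob_space)
  qed
  have "centropy P (gen_alg P (count_space UNIV \<Otimes>\<^sub>M ch.PY {0..<0}) (\<lambda>\<omega>. (vY \<omega>, ch.Yr {0..<0} \<omega>))) A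
      + centropy P (gen_alg P (ch.PY {0..<0}) (ch.Yr {0..<0})) vY
     = (\<Sum>k\<in>vY ` space P. \<Sum>u\<in>S. eta (P.prob (vY -` {k} \<inter> A -` {u} \<inter> space P)))"
    unfolding P.centropy_chain[OF Y0 vY ch.A] imA
    by (intro sum.cong refl P.expectation_eta_const[OF ev Y0 c0])
  also have "\<dots> = (\<Sum>k\<in>K. \<Sum>u\<in>S. eta (P.prob (vY -` {k} \<inter> A -` {u} \<inter> space P)))"
  proof (rule sum.mono_neutral_left[OF finK imV], rule ballI)
    fix k assume "k \<in> K - vY ` space P"
    then have "vY -` {k} \<inter> A -` {u} \<inter> space P = {}" for u by auto
    then show "(\<Sum>u\<in>S. eta (P.prob (vY -` {k} \<inter> A -` {u} \<inter> space P))) = 0" by simp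
  qed
  finally have 1: "centropy P (gen_alg P (count_space UNIV \<Otimes>\<^sub>M ch.PY {0..<0}) (\<lambda>\<omega>. (vY \<omega>, ch.Yr {0..<0} \<omega>))) A
      + centropy P (gen_alg P (ch.PY {0..<0}) (ch.Yr {0..<0})) vY = (\<Sum>k\<in>K. \<Sum>u\<in>S. eta (pmf p u * Wq v u k))"
    by (simp add: joint)
  have "centropy P (gen_alg P (ch.PY {0..<0}) (ch.Yr {0..<0})) vY = (\<Sum>k\<in>vY ` space P. eta (Q k))"
    by (subst P.centropy_const[OF vY(1) Y0 c0]) (simp add: pQ)
  also have "\<dots> = (\<Sum>k\<in>K. eta (Q k))"
  proof (rule sum.mono_neutral_left[OF finK imV], rule ballI)
    fix k assume "k \<in> K - vY ` space P"
    then have "vY -` {k} \<inter> space P = {}" by auto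
    then show "eta (Q k) = 0" using pQ[of k] by simp
  qed
  finally have 2: "centropy P (gen_alg P (ch.PY {0..<0}) (ch.Yr {0..<0})) vY = (\<Sum>k\<in>K. eta (Q k))" .
  have 3: "ch.cY 0 A = (\<Sum>u\<in>S. eta (pmf p u))"
    unfolding ch.cY_def by (subst P.centropy_const[OF ch.A(1) Y0 c0]) (simp add: imA prob_A)
  have summand: "pmf p u * Wq v u k * log 2 (Wq v u k / Q k)
     = eta (pmf p u) * Wq v u k - pmf p u * Wq v u k * log 2 (Q k) - eta (pmf p u * Wq v u k)" if u: "u \<in> S" for u k
  proof (cases "Wq v u k = 0")
    case False
    then have w: "Wq v u k > 0" using W0[of u k] by simp
    have pu: "pmf p u > 0" using u by (simp add: S_def pmf_positive)
    have "Q k > 0" unfolding Q_def S_def[symmetric]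
      by (rule sum_pos2[OF finS u]) (use w pu W0 in auto)
    then show ?thesis using w pu by (simp add: eta_def log_divide log_mult algebra_simps)
  qed simp
  have "(\<Sum>u\<in>S. \<Sum>k\<in>K. pmf p u * Wq v u k * log 2 (Wq v u k / Q k))
     = (\<Sum>u\<in>S. \<Sum>k\<in>K. eta (pmf p u) * Wq v u k) - (\<Sum>u\<in>S. \<Sum>k\<in>K. pmf p u * Wq v u k * log 2 (Q k)) - (\<Sum>u\<in>S. \<Sum>k\<in>K. eta (pmf p u * Wq v u k))"
    by (simp add: summand sum_subtractf)
  also have "(\<Sum>u\<in>S. \<Sum>k\<in>K. eta (pmf p u) * Wq v u k) = (\<Sum>u\<in>S. eta (pmf p u))"
    by (simp add: sum_distrib_left[symmetric] sumW)
  also have "(\<Sum>u\<in>S. \<Sum>k\<in>K. pmf p u * Wq v u k * log 2 (Q k)) = (\<Sum>k\<in>K. Q k * log 2 (Q k))"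
    by (subst sum.swap) (simp add: Q_def S_def sum_distrib_right)
  also have "(\<Sum>k\<in>K. Q k * log 2 (Q k)) = - (\<Sum>k\<in>K. eta (Q k))" by (simp add: eta_def sum_negf)
  also have "(\<Sum>u\<in>S. \<Sum>k\<in>K. eta (pmf p u * Wq v u k)) = (\<Sum>k\<in>K. \<Sum>u\<in>S. eta (pmf p u * Wq v u k))" by (rule sum.swap)
  finally show ?thesis using 1 2 3 unfolding vY_def S_def by simp
qed

lemma exists_quantizer:
  assumes T: "T > 0" and r: "ereal r < ch.DI"
  shows "\<exists>v. quantizer (PiM {0..<T} (\<lambda>_. SY)) v \<and> r < (\<Sum>u\<in>set_pmf p. \<Sum>k\<in>v ` space (PiM {0..<T} (\<lambda>_. SY)).
      pmf p u * Wq v u k * log 2 (Wq v u k / (\<Sum>u\<in>set_pmf p. pmf p u * Wq v u k)))"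
proof -
  have "ereal r < ereal (ch.cY 0 A - ch.cY T A)" using r ch.DI_upper[OF T] by (rule less_le_trans)
  then have "r < ch.cY 0 A - ch.cY T A" by simp
  \<comment> \<open>Quantizing at a cost of half the gap keeps the information above r.\<close>
  then have e: "(ch.cY 0 A - ch.cY T A - r) / 2 > 0" by simp
  have Y0: "ch.Yr {0..<0} \<in> measurable P (ch.PY {0..<0})" by (rule measurable_restrict) simp
  have YT: "ch.Yr {0..<T} \<in> measurable P (ch.PY {0..<T})" by (rule ch.Yr_measurable) simp
  obtain v where v: "quantizer (PiM {0..<T} (\<lambda>_. SY)) v" and
    "centropy P (gen_alg P (count_space UNIV \<Otimes>\<^sub>M ch.PY {0..<0}) (\<lambda>\<omega>. (v (ch.Yr {0..<T} \<omega>), ch.Yr {0..<0} \<omega>))) A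
     \<le> centropy P (gen_alg P (ch.PY {0..<T} \<Otimes>\<^sub>M ch.PY {0..<0}) (\<lambda>\<omega>. (ch.Yr {0..<T} \<omega>, ch.Yr {0..<0} \<omega>))) A + (ch.cY 0 A - ch.cY T A - r) / 2"
    using P.centropy_quantize[OF YT Y0 ch.A e] by blast
  moreover have "ch.cY T A = centropy P (gen_alg P (ch.PY {0..<T} \<Otimes>\<^sub>M ch.PY {0..<0}) (\<lambda>\<omega>. (ch.Yr {0..<T} \<omega>, ch.Yr {0..<0} \<omega>))) A"
    by (rule ch.cY_block) (use T ch.A in auto)
  ultimately have "r < ch.cY 0 A - centropy P (gen_alg P (count_space UNIV \<Otimes>\<^sub>M ch.PY {0..<0}) (\<lambda>\<omega>. (v (ch.Yr {0..<T} \<omega>), ch.Yr {0..<0} \<omega>))) A"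
    using \<open>r < ch.cY 0 A - ch.cY T A\<close> by (simp add: field_simps)
  then show ?thesis using v discrete_information[OF v] by auto
qed

end

section \<open>Block codes from single-block strategies\<close>

text \<open>Letters of a codeword are strategies for blocks of length \<open>T0\<close>. The input after the last full
  block is irrelevant; the one at time 0 serves because its feedback argument is trivial.\<close>

definition block_encoder :: "(real \<Rightarrow> nat \<Rightarrow> (real \<Rightarrow> 'y) \<Rightarrow> 'x) \<Rightarrow> real \<Rightarrow> real \<Rightarrow> nat \<Rightarrow> (nat \<Rightarrow> nat \<Rightarrow> real \<Rightarrow> nat)
    \<Rightarrow> real \<Rightarrow> nat \<Rightarrow> (real \<Rightarrow> 'y) \<Rightarrow> 'x" where
  "block_encoder gs \<Delta>' T0 n cw t m y =
    (let k = nat \<lfloor>t / T0\<rfloor>; s = t - real k * T0 in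
     if k < n then gs s (cw m k s) (\<lambda>r\<in>{0..<s - \<Delta>'}. y (r + real k * T0))
     else gs 0 0 (\<lambda>_. undefined))"

context channel_input
begin

lemma block_position:
  assumes T: "T > 0" and t: "0 \<le> t"
  shows "0 \<le> t - real (nat \<lfloor>t / T\<rfloor>) * T" "t - real (nat \<lfloor>t / T\<rfloor>) * T < T"
proof -
  have f: "real (nat \<lfloor>t / T\<rfloor>) = of_int \<lfloor>t / T\<rfloor>" using T t by simp
  have "of_int \<lfloor>t / T\<rfloor> * T \<le> t / T * T" using T by (intro mult_right_mono) auto
  moreover have "t / T < of_int \<lfloor>t / T\<rfloor> + 1" by linarith
  ultimately show "0 \<le> t - real (nat \<lfloor>t / T\<rfloor>) * T" "t - real (nat \<lfloor>t / T\<rfloor>) * T < T"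
    unfolding f using T by (simp_all add: pos_divide_less_eq algebra_simps)
qed

lemma block_index:
  assumes T: "T > 0" and r: "0 \<le> r" "r < T"
  shows "nat \<lfloor>(r + real k * T) / T\<rfloor> = k"
proof -
  have "(r + real k * T) / T = r / T + real k" using T by (simp add: add_divide_distrib)
  moreover have "\<lfloor>r / T + real k\<rfloor> = int k"
    using T r by (intro floor_unique) (auto simp: divide_less_eq)
  ultimately show ?thesis by simp
qed

lemma gs_measurable:
  assumes "t \<in> {0..<T}"
  shows "(\<lambda>(k, y). gs t k y) \<in> measurable (count_space UNIV \<Otimes>\<^sub>M PiM {0..<t - \<Delta>} (\<lambda>_. SY)) SX"
  using adm assms by (auto simp: admissible_inputs_def)

lemma const_input: "T > 0 \<Longrightarrow> gs 0 0 (\<lambda>_. undefined) \<in> space SX"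
  using measurable_space[OF gs_measurable[of 0], of "(0, \<lambda>_. undefined)"] pos
  by (simp add: space_pair_measure space_PiM)

text \<open>Feedback is taken from the current block only and with the longer delay, so at time t it
  consists of outputs before t - \<Delta> <= t - \<Delta>0, all available to an encoder with delay
  \<Delta>0.\<close>

lemma block_encoder_measurable:
  assumes T: "T > 0" and d: "\<Delta>0 \<le> \<Delta>" and t: "0 \<le> t"
  shows "(\<lambda>(m, y). block_encoder gs \<Delta> T n cw t m y) \<in> measurable (count_space UNIV \<Otimes>\<^sub>M PiM {0..<t - \<Delta>0} (\<lambda>_. SY)) SX"
proof -
  define k where "k = nat \<lfloor>t / T\<rfloor>"
  define s where "s = t - real k * T"
  have s: "0 \<le> s" "s < T" unfolding s_def k_def by (rule block_position[OF T t])+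
  show ?thesis
  proof (cases "k < n")
    case True
    have sub: "r + real k * T \<in> {0..<t - \<Delta>0}" if "r \<in> {0..<s - \<Delta>}" for r
      using that d T by (auto simp: s_def)
    have "(\<lambda>my. (cw (fst my) k s, \<lambda>r\<in>{0..<s - \<Delta>}. snd my (r + real k * T)))
      \<in> measurable (count_space UNIV \<Otimes>\<^sub>M PiM {0..<t - \<Delta>0} (\<lambda>_. SY)) (count_space UNIV \<Otimes>\<^sub>M PiM {0..<s - \<Delta>} (\<lambda>_. SY))"
    proof (intro measurable_Pair)
      show "(\<lambda>my. cw (fst my) k s) \<in> measurable (count_space UNIV \<Otimes>\<^sub>M PiM {0..<t - \<Delta>0} (\<lambda>_. SY)) (count_space UNIV)"
        by (rule measurable_compose[OF measurable_fst]) simp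
      show "(\<lambda>my. \<lambda>r\<in>{0..<s - \<Delta>}. snd my (r + real k * T)) \<in> measurable (count_space UNIV \<Otimes>\<^sub>M PiM {0..<t - \<Delta>0} (\<lambda>_. SY)) (PiM {0..<s - \<Delta>} (\<lambda>_. SY))"
        by (rule measurable_restrict, rule measurable_compose[OF measurable_snd measurable_component_singleton], rule sub)
    qed
    from measurable_compose[OF this gs_measurable[of s]] s True show ?thesis
      by (simp add: block_encoder_def split_beta Let_def flip: k_def s_def)
  next
    case False
    then show ?thesis using const_input[OF T]
      by (simp add: block_encoder_def split_beta Let_def flip: k_def)
  qed
qed

text \<open>Nothing from earlier blocks enters, so the outputs in block k solve the defining
  equation of a run from time 0 on the noise shifted by k T; uniqueness of runs identifies the
  two.\<close>

lemma block_output: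
  assumes T: "T > 0" and d: "0 < \<Delta>0" "\<Delta>0 \<le> \<Delta>" and k: "k < n"
  shows "(\<lambda>r\<in>{0..<T}. run g \<Delta>0 (block_encoder gs \<Delta> T n cw) m z (r + real k * T))
    = out_path g \<Delta> T (aux_strategy gs) (cw m k) (shift_path (real k * T) z)"
proof -
  define y where "y = run g \<Delta>0 (block_encoder gs \<Delta> T n cw) m z"
  have "y (r + real k * T) = run g \<Delta> (aux_strategy gs) (cw m k) (shift_path (real k * T) z) r" if r: "r \<in> {0..<T}" for r
  proof (rule run_unique[OF pos _ r, where y="\<lambda>r. y (r + real k * T)"])
    fix t assume t: "t \<in> {0..<T}"
    have kT: "0 \<le> real k * T" using T by simp
    have idx: "nat \<lfloor>(t + real k * T) / T\<rfloor> = k" using block_index[OF T] t by auto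
    have "(\<lambda>r\<in>{0..<t - \<Delta>}. restrict y {0..<t + real k * T - \<Delta>0} (r + real k * T)) = (\<lambda>r\<in>{0..<t - \<Delta>}. y (r + real k * T))"
      using d kT by (intro restrict_ext) auto
    then have "block_encoder gs \<Delta> T n cw (t + real k * T) m (restrict y {0..<t + real k * T - \<Delta>0})
       = aux_strategy gs t (cw m k) (\<lambda>r\<in>{0..<t - \<Delta>}. y (r + real k * T))"
      using k by (simp add: block_encoder_def idx aux_strategy_def)
    moreover have "z (t + real k * T) = shift_path (real k * T) z t" using t by (simp add: shift_path_def)
    ultimately show "y (t + real k * T) = g (aux_strategy gs t (cw m k) (\<lambda>r\<in>{0..<t - \<Delta>}. y (r + real k * T))) (shift_path (real k * T) z t)"
      unfolding y_def by (subst run_eq[OF d(1)]) simp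
  qed
  then show ?thesis unfolding out_path_eq[OF pos] y_def by (intro restrict_ext) auto
qed

lemma achievable_below_directed_info:
  assumes T: "T > 0" and d: "0 < \<Delta>0" "\<Delta>0 \<le> \<Delta>" and stat: "stationary_noise SZ mu" and erg: "block_ergodic SZ mu"
    and R: "R > 0" and RI: "ereal (R * T) < ch.DI"
  shows "achievable SX SY g mu \<Delta>0 R"
proof -
  interpret mu: prob_space mu by (rule mu)
  obtain v where v: "quantizer (PiM {0..<T} (\<lambda>_. SY)) v" and vI: "R * T < (\<Sum>u\<in>set_pmf p. \<Sum>k\<in>v ` space (PiM {0..<T} (\<lambda>_. SY)).
      pmf p u * Wq v u k * log 2 (Wq v u k / (\<Sum>u\<in>set_pmf p. pmf p u * Wq v u k)))"
    using exists_quantizer[OF T RI] by blast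
  note vm = quantizer_measurable[OF v]
  define \<tau> :: "(real \<Rightarrow> 'z) \<Rightarrow> real \<Rightarrow> 'z" where "\<tau> = shift_path T"
  have spmu: "space mu = space (PiM {0..} (\<lambda>_. SZ))" by (rule sets_eq_imp_space_eq[OF mu(2)])
  have \<tau>m: "\<tau> \<in> measurable mu mu"
    unfolding \<tau>_def measurable_cong_sets[OF mu(2) mu(2)] by (rule shift_path_measurable) (use T in simp)
  have \<tau>d: "distr mu mu \<tau> = mu"
  proof -
    have "distr mu mu \<tau> = distr mu (PiM {0..} (\<lambda>_. SZ)) \<tau>" by (rule distr_cong) (use mu in auto)
    then show ?thesis using stat T unfolding stationary_noise_def \<tau>_def by simp
  qed
  have \<tau>e: "measure mu B = 0 \<or> measure mu B = 1" if "B \<in> sets mu" "\<tau> -` B \<inter> space mu = B" for B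
    using erg T that unfolding block_ergodic_def \<tau>_def by blast
  have \<tau>km: "\<tau> ^^ k \<in> measurable mu mu" for k
    by (induction k) (auto intro: measurable_compose[OF _ \<tau>m])
  have \<tau>kd: "distr mu mu (\<tau> ^^ k) = mu" for k
  proof (induction k)
    case 0
    then show ?case using distr_id[of mu] by (simp add: id_def)
  next
    case (Suc k)
    have "distr mu mu (\<tau> ^^ Suc k) = distr (distr mu mu (\<tau> ^^ k)) mu \<tau>"
      using distr_distr[OF \<tau>m \<tau>km, of k] by (simp only: funpow.simps)
    then show ?case using Suc \<tau>d by (simp only:)
  qed
  \<comment> \<open>Block k sees the noise shifted k times, so stationarity gives every block the
    same transition matrix.\<close>
  define \<zeta> where "\<zeta> k u z = qout v u ((\<tau> ^^ k) z)" for k u z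
  define K where "K = v ` space (PiM {0..<T} (\<lambda>_. SY))"
  interpret bc: block_channel mu "set_pmf p" "pmf p" \<zeta> K "Wq v"
  proof
    show "finite (set_pmf p)" by (rule fin)
    show "(\<Sum>i\<in>set_pmf p. pmf p i) = 1" using fin by (intro sum_pmf_eq_1) auto
    show "finite K" using v by (simp add: K_def quantizer_def)
    show "\<zeta> k i \<in> measurable mu (count_space UNIV)" for k i
      unfolding \<zeta>_def by (rule measurable_compose[OF \<tau>km qout_measurable[OF vm]])
    show "\<zeta> k i x \<in> K" if "x \<in> space mu" for k i x
      unfolding \<zeta>_def K_def by (rule qout_range[OF measurable_space[OF \<tau>km that]])
    show "measure mu {x \<in> space mu. \<zeta> k i x = j} = Wq v i j" for k i j
    proof -
      have E: "{z \<in> space mu. qout v i z = j} \<in> sets mu"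
        using measurable_sets[OF qout_measurable[OF vm], of "{j}" i] by (simp add: vimage_def Int_def conj_commute)
      have "Wq v i j = measure (distr mu mu (\<tau> ^^ k)) {z \<in> space mu. qout v i z = j}" by (simp add: \<tau>kd Wq_def)
      also have "\<dots> = measure mu ((\<tau> ^^ k) -` {z \<in> space mu. qout v i z = j} \<inter> space mu)"
        by (rule measure_distr[OF \<tau>km E])
      also have "(\<tau> ^^ k) -` {z \<in> space mu. qout v i z = j} \<inter> space mu = {x \<in> space mu. \<zeta> k i x = j}"
        using measurable_space[OF \<tau>km] by (auto simp: \<zeta>_def)
      finally show ?thesis by simp
    qed
  qed (simp add: pmf_positive)
  define I where "I = (\<Sum>u\<in>set_pmf p. \<Sum>k\<in>K. pmf p u * Wq v u k * bc.\<psi> u k)"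
  have I: "R * T < I" using vI by (simp add: I_def K_def bc.\<psi>_def bc.Q_def)
  \<comment> \<open>A quarter of the gap: the decoding threshold I - 2 \<delta> per block still
    exceeds R T by 2 \<delta>.\<close>
  define \<delta> where "\<delta> = (I - R * T) / 4"
  have "4 * \<delta> = I - R * T" by (simp add: \<delta>_def)
  then have \<delta>: "\<delta> > 0" "R * T < I - 2 * \<delta>" using I by linarith+
  \<comment> \<open>Set to 0 off the space, since the ergodic bound asks for boundedness at every
    point.\<close>
  define \<phi> where "\<phi> z = (if z \<in> space mu then bc.mean_density 0 z else 0)" for z
  define B where "B = (\<Sum>u\<in>set_pmf p. pmf p u * (\<Sum>k\<in>K. \<bar>bc.\<psi> u k\<bar>))"
  have qK: "finite K" by (rule bc.V)
  have B: "\<bar>\<phi> z\<bar> \<le> B" for z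
  proof (cases "z \<in> space mu")
    case True
    have "\<bar>bc.mean_density 0 z\<bar> \<le> B"
      unfolding bc.mean_density_def B_def
    proof (intro order_trans[OF sum_abs] sum_mono)
      fix u assume "u \<in> set_pmf p"
      have "\<bar>bc.\<psi> u (\<zeta> 0 u z)\<bar> \<le> (\<Sum>k\<in>K. \<bar>bc.\<psi> u k\<bar>)"
        by (rule member_le_sum[where f="\<lambda>k. \<bar>bc.\<psi> u k\<bar>"]) (use bc.\<zeta>(2)[OF True] qK in auto)
      then show "\<bar>pmf p u * bc.\<psi> u (\<zeta> 0 u z)\<bar> \<le> pmf p u * (\<Sum>k\<in>K. \<bar>bc.\<psi> u k\<bar>)"
        by (simp add: abs_mult mult_left_mono)
    qed
    then show ?thesis using True by (simp add: \<phi>_def)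
  qed (auto simp: \<phi>_def B_def intro!: sum_nonneg mult_nonneg_nonneg)
  have dm: "bc.mean_density 0 \<in> borel_measurable mu"
    unfolding bc.mean_density_def[abs_def]
    by (intro borel_measurable_sum borel_measurable_times borel_measurable_const measurable_compose[OF bc.\<zeta>(1)]) simp
  have \<phi>m: "\<phi> \<in> borel_measurable mu"
    by (rule measurable_cong[THEN iffD1, OF _ dm]) (simp add: \<phi>_def)
  have birk: "birkhoff \<tau> \<phi> n z = (\<Sum>k<n. bc.mean_density k z)" if z: "z \<in> space mu" for n z
    unfolding birkhoff_def bc.mean_density_def
    using measurable_space[OF \<tau>km z] by (intro sum.cong refl) (simp add: \<phi>_def bc.mean_density_def \<zeta>_def)
  have E\<phi>: "mu.expectation \<phi> = I"
  proof -
    have E: "{x \<in> space mu. \<zeta> 0 u x = k} \<in> sets mu" for u k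
      using measurable_sets[OF bc.\<zeta>(1), of "{k}" 0 u] by (simp add: vimage_def Int_def conj_commute)
    have "\<phi> z = (\<Sum>u\<in>set_pmf p. \<Sum>k\<in>K. pmf p u * bc.\<psi> u k * indicator {x \<in> space mu. \<zeta> 0 u x = k} z)" if z: "z \<in> space mu" for z
    proof -
      have "(\<Sum>k\<in>K. pmf p u * bc.\<psi> u k * indicator {x \<in> space mu. \<zeta> 0 u x = k} z) = pmf p u * bc.\<psi> u (\<zeta> 0 u z)" for u
      proof -
        have "(\<Sum>k\<in>K. pmf p u * bc.\<psi> u k * indicator {x \<in> space mu. \<zeta> 0 u x = k} z) = (\<Sum>k\<in>K. if k = \<zeta> 0 u z then pmf p u * bc.\<psi> u k else 0)"
          using z by (intro sum.cong) (auto simp: indicator_def)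
        then show ?thesis using bc.\<zeta>(2)[OF z] qK by simp
      qed
      then show ?thesis using z by (simp add: \<phi>_def bc.mean_density_def)
    qed
    then have "mu.expectation \<phi> = (\<integral>z. (\<Sum>u\<in>set_pmf p. \<Sum>k\<in>K. pmf p u * bc.\<psi> u k * indicator {x \<in> space mu. \<zeta> 0 u x = k} z) \<partial>mu)"
      by (intro Bochner_Integration.integral_cong refl)
    also have "\<dots> = (\<Sum>u\<in>set_pmf p. \<Sum>k\<in>K. pmf p u * bc.\<psi> u k * measure mu {x \<in> space mu. \<zeta> 0 u x = k})"
      using E by (simp add: integrable_real_indicator mu.emeasure_finite less_top[symmetric])
    also have "\<dots> = I" unfolding I_def bc.W by (simp add: mult_ac)
    finally show ?thesis .
  qed
  define tail where "tail n = measure mu {x\<in>space mu. (\<Sum>k<n. bc.mean_density k x) < real n * (I - \<delta>)}" for n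
  have tail: "tail \<longlonglongrightarrow> 0"
  proof -
    have "{x\<in>space mu. birkhoff \<tau> \<phi> n x < real n * (mu.expectation \<phi> - \<delta>)} = {x\<in>space mu. (\<Sum>k<n. bc.mean_density k x) < real n * (I - \<delta>)}" for n
      using birk E\<phi> by auto
    then show ?thesis
      using mu.ergodic_lower_tail[OF \<tau>m \<tau>d \<tau>e \<phi>m B \<delta>(1)] by (simp add: tail_def[abs_def])
  qed
  obtain s where s: "s > 0" and cod: "\<And>n N c. N > 0 \<Longrightarrow> \<exists>cw. (\<forall>m. cw m \<in> bc.words n) \<and>
    (\<Sum>m\<in>{1..N}. measure mu {x\<in>space mu. bc.decode n (real n * (c - 2 * \<delta>)) N cw (bc.outp (cw m) x) \<noteq> m}) / real N
    \<le> measure mu {x\<in>space mu. (\<Sum>k<n. bc.mean_density k x) < real n * (c - \<delta>)} + exp (- (s * real n))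
       + real N * 2 powr (- (real n * (c - 2 * \<delta>)))"
    by (rule bc.threshold_coding[OF \<delta>(1)]) (rule that)
  define bound where "bound n N = tail n + exp (- (s * real n)) + real N * 2 powr (- (real n * (I - 2 * \<delta>)))" for n N :: nat
  have code: "\<exists>enc dec. is_code SX SY \<Delta>0 L R enc dec \<and> err_prob g mu \<Delta>0 L R enc dec \<le> bound (nat \<lfloor>L / T\<rfloor>) (num_msgs L R)"
    if L: "L > 0" for L
  proof -
    define n where "n = nat \<lfloor>L / T\<rfloor>"
    define N where "N = num_msgs L R"
    define \<theta> where "\<theta> = real n * (I - 2 * \<delta>)"
    have "N > 0" by (simp add: N_def num_msgs_def)
    from cod[OF this, of n I] obtain cw where cw:
      "(\<Sum>m\<in>{1..N}. measure mu {x\<in>space mu. bc.decode n \<theta> N cw (bc.outp (cw m) x) \<noteq> m}) / real N \<le> bound n N"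
      unfolding bound_def tail_def \<theta>_def by blast
    have nL: "real k * T + T \<le> L" if "k < n" for k
    proof -
      have "real k + 1 \<le> real n" using that by simp
      also have "real n \<le> L / T" using L T by (simp add: n_def)
      finally have "(real k + 1) * T \<le> L" using T by (simp add: pos_le_divide_eq)
      then show ?thesis by (simp add: algebra_simps)
    qed
    define enc where "enc = block_encoder gs \<Delta> T n cw"
    define w where "w k y = v (\<lambda>r\<in>{0..<T}. y (r + real k * T))" for k and y :: "real \<Rightarrow> 'y"
    define dec where "dec y = bc.decode n \<theta> N cw (\<lambda>k. w k y)" for y
    have wm: "w k \<in> measurable (PiM {0..<L} (\<lambda>_. SY)) (count_space UNIV)" if k: "k < n" for k
    proof -
      have "(\<lambda>y. \<lambda>r\<in>{0..<T}. y (r + real k * T)) \<in> measurable (PiM {0..<L} (\<lambda>_. SY)) (PiM {0..<T} (\<lambda>_. SY))"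
        by (rule measurable_restrict, rule measurable_component_singleton) (use nL[OF k] T in auto)
      from measurable_compose[OF this vm] show ?thesis by (simp add: w_def[abs_def])
    qed
    have dec_list: "dec = (\<lambda>y. bc.decode n \<theta> N cw (\<lambda>k. map (\<lambda>k. w k y) [0..<n] ! k))"
      unfolding dec_def by (intro ext bc.decode_cong) simp
    have decm: "dec \<in> measurable (PiM {0..<L} (\<lambda>_. SY)) (count_space UNIV)"
      unfolding dec_list by (rule measurable_compose[OF map_measurable[of n w, OF wm]]) simp_all
    have isc: "is_code SX SY \<Delta>0 L R enc dec"
      unfolding is_code_def enc_def using block_encoder_measurable[OF T d(2)] decm by auto
    have "dec (out_path g \<Delta>0 L enc m z) = bc.decode n \<theta> N cw (bc.outp (cw m) z)" if z: "z \<in> space mu" for m z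
      unfolding dec_def
    proof (rule bc.decode_cong)
      fix k assume k: "k < n"
      have "(\<lambda>r\<in>{0..<T}. restrict (run g \<Delta>0 enc m z) {0..<L} (r + real k * T)) = (\<lambda>r\<in>{0..<T}. run g \<Delta>0 enc m z (r + real k * T))"
        using nL[OF k] T by (intro restrict_ext) auto
      also have "\<dots> = out_path g \<Delta> T (aux_strategy gs) (cw m k) (shift_path (real k * T) z)"
        unfolding enc_def by (rule block_output[OF T d k])
      also have "shift_path (real k * T) z = (\<tau> ^^ k) z"
        unfolding \<tau>_def by (rule shift_path_funpow[symmetric]) (use z T in \<open>auto simp: spmu space_PiM PiE_def\<close>)
      finally show "w k (out_path g \<Delta>0 L enc m z) = bc.outp (cw m) z k"
        by (simp only: w_def out_path_eq[OF d(1)] bc.outp_def \<zeta>_def qout_def)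
    qed
    then have "err_prob g mu \<Delta>0 L R enc dec = (\<Sum>m\<in>{1..N}. measure mu {x\<in>space mu. bc.decode n \<theta> N cw (bc.outp (cw m) x) \<noteq> m}) / real N"
      unfolding err_prob_def N_def[symmetric] by (intro arg_cong2[where f="(/)"] sum.cong arg_cong[where f="measure mu"] refl) auto
    with cw have "err_prob g mu \<Delta>0 L R enc dec \<le> bound n N" by (simp only:)
    with isc show ?thesis unfolding n_def N_def by blast
  qed
  have "\<forall>L. \<exists>ed. L > 0 \<longrightarrow> is_code SX SY \<Delta>0 L R (fst ed) (snd ed) \<and> err_prob g mu \<Delta>0 L R (fst ed) (snd ed) \<le> bound (nat \<lfloor>L / T\<rfloor>) (num_msgs L R)"
    using code by auto
  then have "\<exists>ed. \<forall>L. L > 0 \<longrightarrow> is_code SX SY \<Delta>0 L R (fst (ed L)) (snd (ed L)) \<and> err_prob g mu \<Delta>0 L R (fst (ed L)) (snd (ed L)) \<le> bound (nat \<lfloor>L / T\<rfloor>) (num_msgs L R)"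
    by (rule choice)
  then obtain ed where ed: "\<And>L. L > 0 \<Longrightarrow> is_code SX SY \<Delta>0 L R (fst (ed L)) (snd (ed L))"
    "\<And>L. L > 0 \<Longrightarrow> err_prob g mu \<Delta>0 L R (fst (ed L)) (snd (ed L)) \<le> bound (nat \<lfloor>L / T\<rfloor>) (num_msgs L R)" by blast
  \<comment> \<open>Since L < (n + 1) T, there are at most 2 powr (R T (n + 1)) messages; the factor
    2 powr (R T) pays for the unfinished block.\<close>
  define bd where "bd n = tail n + exp (- (s * real n)) + 2 powr (R * T) * 2 powr (- ((I - 2 * \<delta> - R * T) * real n))" for n :: nat
  have "(\<lambda>n::nat. exp (- (s * real n))) \<longlonglongrightarrow> 0"
  proof -
    have "filterlim (\<lambda>n. - (s * real n)) at_bot sequentially"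
      using filterlim_tendsto_pos_mult_at_top[OF tendsto_const s filterlim_real_sequentially]
      by (simp add: filterlim_uminus_at_top)
    from filterlim_compose[OF exp_at_bot this] show ?thesis .
  qed
  moreover have "(\<lambda>n::nat. 2 powr (- ((I - 2 * \<delta> - R * T) * real n))) \<longlonglongrightarrow> 0"
  proof -
    have c: "(I - 2 * \<delta> - R * T) * ln 2 > 0" using \<delta> by simp
    have "filterlim (\<lambda>n. - ((I - 2 * \<delta> - R * T) * ln 2 * real n)) at_bot sequentially"
      using filterlim_tendsto_pos_mult_at_top[OF tendsto_const c filterlim_real_sequentially]
      by (simp add: filterlim_uminus_at_top)
    from filterlim_compose[OF exp_at_bot this] show ?thesis by (simp add: powr_def mult_ac)
  qed
  ultimately have "bd \<longlonglongrightarrow> 0 + 0 + 2 powr (R * T) * 0"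
    unfolding bd_def[abs_def] using tail by (intro tendsto_intros)
  then have bd0: "bd \<longlonglongrightarrow> 0" by simp
  have "filterlim (\<lambda>L::real. nat \<lfloor>L / T\<rfloor>) sequentially at_top"
  proof (rule filterlim_at_top[THEN iffD2], intro allI)
    fix Z :: nat
    show "\<forall>\<^sub>F L in at_top. Z \<le> nat \<lfloor>L / T\<rfloor>"
      using eventually_ge_at_top[of "real Z * T"]
    proof eventually_elim
      case (elim L)
      then have "real Z \<le> L / T" using T by (simp add: pos_le_divide_eq)
      then show ?case by (simp add: le_nat_floor)
    qed
  qed
  from filterlim_compose[OF bd0 this] have lim: "((\<lambda>L. bd (nat \<lfloor>L / T\<rfloor>)) \<longlongrightarrow> 0) at_top" .
  have "((\<lambda>L. err_prob g mu \<Delta>0 L R (fst (ed L)) (snd (ed L))) \<longlongrightarrow> 0) at_top"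
  proof (rule tendsto_sandwich[OF _ _ tendsto_const lim])
    show "\<forall>\<^sub>F L in at_top. 0 \<le> err_prob g mu \<Delta>0 L R (fst (ed L)) (snd (ed L))"
      by (simp add: err_prob_def sum_nonneg)
    show "\<forall>\<^sub>F L in at_top. err_prob g mu \<Delta>0 L R (fst (ed L)) (snd (ed L)) \<le> bd (nat \<lfloor>L / T\<rfloor>)"
      using eventually_gt_at_top[of 0]
    proof eventually_elim
      case (elim L)
      define n where "n = nat \<lfloor>L / T\<rfloor>"
      have "L / T < real n + 1" using elim T by (simp add: n_def)
      then have LT: "L \<le> (real n + 1) * T" using T by (simp add: pos_divide_less_eq)
      have "real (num_msgs L R) = 2 powr real (nat \<lfloor>L * R\<rfloor>)"
        by (simp add: num_msgs_def powr_realpow)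
      also have "\<dots> \<le> 2 powr (R * T * (real n + 1))"
      proof (rule powr_mono)
        have "real (nat \<lfloor>L * R\<rfloor>) \<le> L * R" using elim R by simp
        also have "\<dots> \<le> (real n + 1) * T * R" using LT R by (intro mult_right_mono) auto
        finally show "real (nat \<lfloor>L * R\<rfloor>) \<le> R * T * (real n + 1)" by (simp add: mult_ac)
      qed simp
      finally have "real (num_msgs L R) * 2 powr (- (real n * (I - 2 * \<delta>))) \<le> 2 powr (R * T * (real n + 1)) * 2 powr (- (real n * (I - 2 * \<delta>)))"
        by (intro mult_right_mono) auto
      also have "\<dots> = 2 powr (R * T) * 2 powr (- ((I - 2 * \<delta> - R * T) * real n))"
        by (simp add: algebra_simps flip: powr_add)
      finally have "bound n (num_msgs L R) \<le> bd n" by (simp add: bound_def bd_def)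
      with ed(2)[OF elim] show ?case unfolding n_def by linarith
    qed
  qed
  then show ?thesis
    unfolding achievable_def using ed(1) by (intro exI[of _ "\<lambda>L. fst (ed L)"] exI[of _ "\<lambda>L. snd (ed L)"]) auto
qed

end

text \<open>A nonpositive rate leaves a single message, which a constant decoder gets right. This
  covers the nonpositive candidates R in the final argument.\<close>

lemma achievable_nonpos:
  assumes x: "x \<in> space SX" and R: "R \<le> 0"
  shows "achievable SX SY g mu \<Delta> R"
proof -
  have N: "num_msgs T R = 1" if "T > 0" for T
  proof -
    have "T * R \<le> 0" using that R by (simp add: mult_nonneg_nonpos)
    then have "\<lfloor>T * R\<rfloor> \<le> 0" by simp
    then show ?thesis by (simp add: num_msgs_def)
  qed
  have "((\<lambda>T. err_prob g mu \<Delta> T R (\<lambda>_ _ _. x) (\<lambda>_. 1)) \<longlongrightarrow> 0) at_top"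
  proof (rule tendsto_eventually)
    show "\<forall>\<^sub>F T in at_top. err_prob g mu \<Delta> T R (\<lambda>_ _ _. x) (\<lambda>_. 1) = 0"
      using eventually_gt_at_top[of 0] by eventually_elim (simp add: err_prob_def N)
  qed
  moreover have "is_code SX SY \<Delta> T R (\<lambda>_ _ _. x) (\<lambda>_. 1)" for T
    using x by (simp add: is_code_def split_beta)
  ultimately show ?thesis unfolding achievable_def
    by (intro exI[of _ "\<lambda>_ _ _ _. x"] exI[of _ "\<lambda>_ _. 1"]) auto
qed

theorem theorem5:
  fixes SX :: "'x measure" and SY :: "'y measure" and SZ :: "'z measure"
    and g :: "'x \<Rightarrow> 'z \<Rightarrow> 'y" and mu :: "(real \<Rightarrow> 'z) measure" and \<Delta> :: real
  assumes g_meas: "(\<lambda>(x, z). g x z) \<in> measurable (SX \<Otimes>\<^sub>M SZ) SY"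
    and stat: "stationary_noise SZ mu"
    and erg: "block_ergodic SZ mu"
    and pos: "\<Delta> > 0"
  shows "(info_capacity_exists SX SY g mu \<Delta> \<longrightarrow>
            op_capacity SX SY g mu \<Delta> \<le> info_capacity SX SY g mu \<Delta>) \<and>
         (\<forall>\<Delta>'>\<Delta>. info_capacity_exists SX SY g mu \<Delta>' \<longrightarrow>
            info_capacity SX SY g mu \<Delta>' \<le> op_capacity SX SY g mu \<Delta>)"
proof (intro conjI impI allI)
  have mu: "prob_space mu" "sets mu = sets (PiM {0..} (\<lambda>_. SZ))"
    using stat by (auto simp: stationary_noise_def)
  have cap: "info_capacity SX SY g mu d = L" if "(info_rate SX SY g mu d \<longlongrightarrow> L) at_top" for d L
    unfolding info_capacity_def by (rule tendsto_Lim[OF trivial_limit_at_top_linorder that])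
  {
    assume "info_capacity_exists SX SY g mu \<Delta>"
    then obtain L where L: "(info_rate SX SY g mu \<Delta> \<longlongrightarrow> L) at_top" by (auto simp: info_capacity_exists_def)
    show "op_capacity SX SY g mu \<Delta> \<le> info_capacity SX SY g mu \<Delta>"
      unfolding cap[OF L] op_capacity_def
      by (rule Sup_least) (auto intro: achievable_le_info_limit[OF g_meas pos mu L])
  next
    fix \<Delta>' assume d: "\<Delta> < \<Delta>'" and "info_capacity_exists SX SY g mu \<Delta>'"
    then obtain L where L: "(info_rate SX SY g mu \<Delta>' \<longlongrightarrow> L) at_top" by (auto simp: info_capacity_exists_def)
    show "info_capacity SX SY g mu \<Delta>' \<le> op_capacity SX SY g mu \<Delta>"
      unfolding cap[OF L]
    proof (rule ccontr)
      assume "\<not> L \<le> op_capacity SX SY g mu \<Delta>"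
      then obtain R where R: "op_capacity SX SY g mu \<Delta> < ereal R" "ereal R < L"
        using ereal_dense2[of "op_capacity SX SY g mu \<Delta>" L] by (auto simp: not_le)
      \<comment> \<open>R lies strictly below the limit, so some horizon already has information
        rate above R; it becomes the block length of the code.\<close>
      have "\<forall>\<^sub>F T in at_top. T > 0 \<and> ereal R < info_rate SX SY g mu \<Delta>' T"
        using eventually_gt_at_top[of 0] order_tendstoD(1)[OF L R(2)] by (rule eventually_conj)
      then obtain T where T: "T > 0" "ereal R < info_rate SX SY g mu \<Delta>' T"
        using eventually_happens'[OF trivial_limit_at_top_linorder] by blast
      have "ereal (R * T) < sup_directed_info SX SY g mu \<Delta>' T"
        using T by (cases "sup_directed_info SX SY g mu \<Delta>' T") (auto simp: info_rate_def field_simps)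
      then obtain pg where pg: "pg \<in> admissible_inputs SX SY \<Delta>' T" and
        lt: "ereal (R * T) < directed_info (measure_pmf (fst pg) \<Otimes>\<^sub>M mu) SX SY
          (\<lambda>\<omega>. in_path g \<Delta>' T (aux_strategy (snd pg)) (fst \<omega>) (snd \<omega>))
          (\<lambda>\<omega>. out_path g \<Delta>' T (aux_strategy (snd pg)) (fst \<omega>) (snd \<omega>)) T"
        unfolding sup_directed_info_def less_SUP_iff by blast
      \<comment> \<open>The strategies are taken for the longer delay \<Delta>', while the code
        built from them has delay \<Delta>.\<close>
      interpret channel_input SX SY SZ g mu \<Delta>' T "fst pg" "snd pg"
        by (rule channel_input.intro[OF g_meas _ mu]) (use pos d pg in auto)
      have "achievable SX SY g mu \<Delta> R"
      \<comment> \<open>The block code is built for positive rates; in the other case the strategy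
        at time 0 supplies the point of the input space for the trivial code.\<close>
      proof (cases "R > 0")
        case True
        show ?thesis
          by (rule achievable_below_directed_info[OF T(1) assms(4) _ stat erg True]) (use d lt directed_info_eq in auto)
      next
        case False
        then show ?thesis by (intro achievable_nonpos[OF const_input[OF T(1)]]) simp
      qed
      then have "ereal R \<le> op_capacity SX SY g mu \<Delta>" unfolding op_capacity_def by (intro Sup_upper) auto
      with R(1) show False by simp
    qed
  }
qed

end
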